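(* Let $k$ be an algebraically closed field of characteristic $0$ and let $X\subset\mathbf{P}^n_k$ be an integral non-linear hypersurface which either has dimension at least four, or has dimension three and degree at least three. Suppose that for every hyperplane $\Pi\subset\mathbf{P}^n$, the scheme-theoretic hyperplane section $\Pi\cap X$ is covered by its linear divisors. Then $X$ is covered by its linear divisors.
   Context: Let $Z\subset\mathbf{P}^n_k$ ($k$ algebraically closed) be a closed equidimensional subscheme of dimension $s\ge1$. $Z$ is said to be covered by its linear divisors if every closed point of $Z$ lies on some linear subspace of $\mathbf{P}^n$ of dimension $s-1$ which is contained in $Z$ (as a closed subscheme); equivalently, the projection to $Z$ of the universal family over the Hilbert scheme $F_{s-1}(Z)$ of $(s-1)$-planes contained in $Z$ is surjective. Hyperplane sections are scheme-theoretic intersections (possibly reducible or non-reduced). *)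

theory Defs
  imports "HOL-Library.Poly_Mapping" "HOL-Computational_Algebra.Polynomial"
    "HOL-Computational_Algebra.Factorial_Ring"
begin

text \<open>Multivariate polynomials over 'k in the variables x_0, x_1, ...:
  finitely supported maps from monomials (exponent vectors) to coefficients.
  The ring structure is the convolution product of HOL-Library.Poly_Mapping.\<close>
type_synonym 'k mpoly = "(nat \<Rightarrow>\<^sub>0 nat) \<Rightarrow>\<^sub>0 'k"

definition alg_closed_field :: "'k::field itself \<Rightarrow> bool" where
  "alg_closed_field _ \<longleftrightarrow> (\<forall>p::'k poly. degree p \<ge> 1 \<longrightarrow> (\<exists>x. poly p x = 0))"

definition mon_deg :: "(nat \<Rightarrow>\<^sub>0 nat) \<Rightarrow> nat" where
  "mon_deg m = (\<Sum>i\<in>Poly_Mapping.keys m. Poly_Mapping.lookup m i)"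

definition meval :: "'k::comm_ring_1 mpoly \<Rightarrow> (nat \<Rightarrow> 'k) \<Rightarrow> 'k" where
  "meval F x = (\<Sum>m\<in>Poly_Mapping.keys F. Poly_Mapping.lookup F m * (\<Prod>i\<in>Poly_Mapping.keys m. x i ^ Poly_Mapping.lookup m i))"

definition homog_form :: "nat \<Rightarrow> nat \<Rightarrow> 'k::comm_ring_1 mpoly \<Rightarrow> bool" where
  "homog_form n d F \<longleftrightarrow> F \<noteq> 0 \<and>
     (\<forall>m\<in>Poly_Mapping.keys F. mon_deg m = d \<and> Poly_Mapping.keys m \<subseteq> {0..n})"

text \<open>Vectors of k^{n+1} (coordinates 0..n); the points of P^n are the nonzero ones up to scalars.\<close>
definition vec_in :: "nat \<Rightarrow> (nat \<Rightarrow> 'k::zero) \<Rightarrow> bool" where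
  "vec_in n v \<longleftrightarrow> (\<forall>i>n. v i = 0)"

definition proj_point :: "nat \<Rightarrow> (nat \<Rightarrow> 'k::zero) \<Rightarrow> bool" where
  "proj_point n v \<longleftrightarrow> vec_in n v \<and> v \<noteq> (\<lambda>_. 0)"

definition lincomb :: "nat \<Rightarrow> (nat \<Rightarrow> 'k::comm_ring_1) \<Rightarrow> (nat \<Rightarrow> nat \<Rightarrow> 'k) \<Rightarrow> nat \<Rightarrow> 'k" where
  "lincomb r c v = (\<lambda>i. \<Sum>j\<le>r. c j * v j i)"

text \<open>v_0..v_r are linearly independent vectors in k^{n+1}; their span is
  (the cone over) a linear subspace of P^n of dimension r.\<close>
definition lin_frame :: "nat \<Rightarrow> nat \<Rightarrow> (nat \<Rightarrow> nat \<Rightarrow> 'k::comm_ring_1) \<Rightarrow> bool" where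
  "lin_frame n r v \<longleftrightarrow> (\<forall>j\<le>r. vec_in n (v j)) \<and>
     (\<forall>c. lincomb r c v = (\<lambda>_. 0) \<longrightarrow> (\<forall>j\<le>r. c j = 0))"

definition in_span :: "nat \<Rightarrow> (nat \<Rightarrow> nat \<Rightarrow> 'k::comm_ring_1) \<Rightarrow> (nat \<Rightarrow> 'k) \<Rightarrow> bool" where
  "in_span r v p \<longleftrightarrow> (\<exists>c. p = lincomb r c v)"

definition lin_form :: "nat \<Rightarrow> (nat \<Rightarrow> 'k::comm_ring_1) \<Rightarrow> (nat \<Rightarrow> 'k) \<Rightarrow> 'k" where
  "lin_form n a x = (\<Sum>i\<le>n. a i * x i)"

definition hyperplane_coeffs :: "nat \<Rightarrow> (nat \<Rightarrow> 'k::comm_ring_1) \<Rightarrow> bool" where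
  "hyperplane_coeffs n a \<longleftrightarrow> (\<exists>i\<le>n. a i \<noteq> 0)"

definition hypersurface_covered :: "nat \<Rightarrow> 'k::comm_ring_1 mpoly \<Rightarrow> bool" where
  "hypersurface_covered n F \<longleftrightarrow>
     (\<forall>p. proj_point n p \<and> meval F p = 0 \<longrightarrow>
        (\<exists>v. lin_frame n (n - 2) v \<and> in_span (n - 2) v p \<and>
             (\<forall>q. in_span (n - 2) v q \<longrightarrow> meval F q = 0)))"

text \<open>The hyperplane section V(l) \<inter> V(F) (of dimension n-2) is covered by its linear
  divisors: every point of it lies on an (n-3)-plane contained in it.\<close>
definition section_covered :: "nat \<Rightarrow> (nat \<Rightarrow> 'k::comm_ring_1) \<Rightarrow> 'k mpoly \<Rightarrow> bool" where
  "section_covered n a F \<longleftrightarrow>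
     (\<forall>p. proj_point n p \<and> lin_form n a p = 0 \<and> meval F p = 0 \<longrightarrow>
        (\<exists>v. lin_frame n (n - 3) v \<and> in_span (n - 3) v p \<and>
             (\<forall>q. in_span (n - 3) v q \<longrightarrow> lin_form n a q = 0 \<and> meval F q = 0)))"

end

theory Submission
  imports Defs
begin

text \<open>Let \<open>p\<close> be a smooth point of \<open>X\<close>. Lines in \<open>X\<close> through \<open>p\<close> are isotropic for the second fundamental
  form \<open>q\<close> at \<open>p\<close>, and by hypothesis every hyperplane of the tangent space at \<open>p\<close> contains a hyperplane of such
  lines. If \<open>q\<close> has rank one or two, then its zero set consists of at most two hyperplanes, and moving the section
  shows that one of them consists of lines in \<open>X\<close>: this is the desired linear divisor through \<open>p\<close>.
  The form \<open>q\<close> cannot vanish at all smooth points, since then \<open>F\<close> would vanish on a tangent hyperplane. If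
  \<open>dim X \<ge> 4\<close>, then a form of rank at least three has a hyperplane section of rank at least three, which contains no
  isotropic hyperplane. If \<open>dim X = 3\<close> and \<open>q\<close> has rank three, then every isotropic direction at \<open>p\<close>, and at general
  points of the quadric cone swept out by these lines, is a line in \<open>X\<close>; comparing third and fourth order
  terms along these cones produces a quadric threefold contained in \<open>X\<close>, so that \<open>d = 2\<close>.
  Hence there is a linear divisor through every point of a dense open subset of \<open>X\<close>. At the remaining points one passes to
  the limit by means of a place, i.e. a maximal algebra of functions on that open set with a
  compatible evaluation at the limit point.\<close>

section \<open>Multivariate polynomials\<close>

definition MC :: "'k::comm_ring_1 \<Rightarrow> 'k mpoly" where "MC c = Poly_Mapping.single 0 c"

definition MX :: "nat \<Rightarrow> 'k::comm_ring_1 mpoly" where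
  "MX i = Poly_Mapping.single (Poly_Mapping.single i 1) 1"

definition rhom :: "('a::comm_ring_1 \<Rightarrow> 'b::comm_ring_1) \<Rightarrow> bool" where
  "rhom h \<longleftrightarrow> h 1 = 1 \<and> (\<forall>a b. h (a + b) = h a + h b) \<and> (\<forall>a b. h (a * b) = h a * h b)"

lemma rhomD: assumes "rhom h" shows "h 1 = 1" "h (a + b) = h a + h b" "h (a * b) = h a * h b" "h 0 = 0"
proof -
  show "h 1 = 1" "h (a + b) = h a + h b" "h (a * b) = h a * h b" using assms by (auto simp: rhom_def)
  have "h (0 + 0) = h 0 + h 0" using assms unfolding rhom_def by blast
  then show "h 0 = 0" by simp
qed

definition monv :: "(nat \<Rightarrow> 'r::comm_ring_1) \<Rightarrow> (nat \<Rightarrow>\<^sub>0 nat) \<Rightarrow> 'r" where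
  "monv x m = (\<Prod>i\<in>Poly_Mapping.keys m. x i ^ Poly_Mapping.lookup m i)"

definition ev :: "('k::comm_ring_1 \<Rightarrow> 'r::comm_ring_1) \<Rightarrow> (nat \<Rightarrow> 'r) \<Rightarrow> 'k mpoly \<Rightarrow> 'r" where
  "ev h x F = (\<Sum>m\<in>Poly_Mapping.keys F. h (Poly_Mapping.lookup F m) * monv x m)"

lemma meval_ev: "meval F x = ev id x F"
  by (simp add: meval_def ev_def monv_def)

lemma monv_superset: "finite A \<Longrightarrow> Poly_Mapping.keys m \<subseteq> A \<Longrightarrow> monv x m = (\<Prod>i\<in>A. x i ^ Poly_Mapping.lookup m i)"
  unfolding monv_def by (rule prod.mono_neutral_left) (auto simp: in_keys_iff)

lemma monv_add: "monv x (m + m') = monv x m * monv x m'"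
proof -
  let ?A = "Poly_Mapping.keys m \<union> Poly_Mapping.keys m'"
  have "monv x (m + m') = (\<Prod>i\<in>?A. x i ^ Poly_Mapping.lookup (m + m') i)"
    by (rule monv_superset) (simp_all add: keys_add)
  also have "\<dots> = (\<Prod>i\<in>?A. x i ^ Poly_Mapping.lookup m i) * (\<Prod>i\<in>?A. x i ^ Poly_Mapping.lookup m' i)"
    by (simp add: lookup_add power_add prod.distrib)
  finally show ?thesis by (simp add: monv_superset[of ?A])
qed

lemma monv_zero [simp]: "monv x 0 = 1" by (simp add: monv_def)

lemma monv_single: "monv x (Poly_Mapping.single i k) = x i ^ k"
  by (cases "k = 0") (auto simp: monv_def)

lemma ev_superset:
  assumes "rhom h" "finite A" "Poly_Mapping.keys F \<subseteq> A"
  shows "ev h x F = (\<Sum>m\<in>A. h (Poly_Mapping.lookup F m) * monv x m)"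
  unfolding ev_def using assms by (intro sum.mono_neutral_left) (auto simp: in_keys_iff rhomD)

lemma ev_add: assumes "rhom h" shows "ev h x (F + G) = ev h x F + ev h x G"
proof -
  let ?A = "Poly_Mapping.keys F \<union> Poly_Mapping.keys G"
  have "ev h x (F + G) = (\<Sum>m\<in>?A. h (Poly_Mapping.lookup (F + G) m) * monv x m)"
    by (rule ev_superset[OF assms]) (simp_all add: keys_add)
  also have "\<dots> = (\<Sum>m\<in>?A. h (Poly_Mapping.lookup F m) * monv x m) + (\<Sum>m\<in>?A. h (Poly_Mapping.lookup G m) * monv x m)"
    by (simp add: lookup_add rhomD[OF assms] sum.distrib algebra_simps)
  finally show ?thesis by (simp add: ev_superset[OF assms, of ?A])
qed

lemma ev_zero [simp]: "ev h x 0 = 0" by (simp add: ev_def)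

lemma ev_sum: assumes "rhom h" shows "ev h x (sum f A) = (\<Sum>a\<in>A. ev h x (f a))"
  by (induction A rule: infinite_finite_induct) (auto simp: ev_add[OF assms])

lemma ev_single: assumes "rhom h" shows "ev h x (Poly_Mapping.single m a) = h a * monv x m"
  by (cases "a = 0") (auto simp: ev_def rhomD[OF assms])

lemma mpoly_sum_single: "F = (\<Sum>m\<in>Poly_Mapping.keys F. Poly_Mapping.single m (Poly_Mapping.lookup F m))"
  by (rule poly_mapping_eqI) (auto simp: lookup_sum lookup_single when_def in_keys_iff)

lemma ev_mult: assumes "rhom h" shows "ev h x (F * G) = ev h x F * ev h x G"
proof -
  have "F * G = (\<Sum>m\<in>Poly_Mapping.keys F. Poly_Mapping.single m (Poly_Mapping.lookup F m)) *
      (\<Sum>m\<in>Poly_Mapping.keys G. Poly_Mapping.single m (Poly_Mapping.lookup G m))"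
    using mpoly_sum_single[of F] mpoly_sum_single[of G] by simp
  then show ?thesis
    by (simp add: sum_product mult_single ev_sum[OF assms] ev_single[OF assms] monv_add rhomD[OF assms]
      ev_def[of h x F] ev_def[of h x G] mult.assoc mult.left_commute)
qed

lemma ev_MC: assumes "rhom h" shows "ev h x (MC c) = h c"
  by (simp add: MC_def ev_single[OF assms])

lemma ev_MX: assumes "rhom h" shows "ev h x (MX i) = x i"
  by (simp add: MX_def ev_single[OF assms] monv_single rhomD[OF assms])

lemma MC_simps: "MC 0 = 0" "MC 1 = 1" "MC (a + b) = MC a + MC b" "MC (a * b) = MC a * MC b"
  by (auto simp: MC_def single_add mult_single)

lemma MC_inject: "MC a = MC b \<longleftrightarrow> a = b"
  by (auto simp: MC_def dest: arg_cong[where f = "\<lambda>f. Poly_Mapping.lookup f 0"])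

lemma rhom_ev: "rhom h \<Longrightarrow> rhom (ev h x)"
  using ev_MC[of h x 1] rhomD(1)[of h] by (simp add: rhom_def[of "ev h x"] ev_add ev_mult MC_simps)

inductive_set MP :: "nat \<Rightarrow> 'k::comm_ring_1 mpoly set" for n where
  MP_C: "MC c \<in> MP n"
| MP_X: "i < n \<Longrightarrow> MX i \<in> MP n"
| MP_add: "A \<in> MP n \<Longrightarrow> B \<in> MP n \<Longrightarrow> A + B \<in> MP n"
| MP_mult: "A \<in> MP n \<Longrightarrow> B \<in> MP n \<Longrightarrow> A * B \<in> MP n"

lemma MP_0: "0 \<in> MP n" and MP_1: "1 \<in> MP n"
  using MP_C[of 0 n] MP_C[of 1 n] by (auto simp: MC_simps)

lemma MP_uminus: "A \<in> MP n \<Longrightarrow> - A \<in> MP n"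
  using MP_mult[OF MP_C[of "-1" n], of A] by (simp add: MC_def single_uminus)

lemma MP_diff: "A \<in> MP n \<Longrightarrow> B \<in> MP n \<Longrightarrow> A - B \<in> MP n"
  using MP_add[OF _ MP_uminus, of A n B] by simp

lemma MP_sum: "(\<And>a. a \<in> A \<Longrightarrow> f a \<in> MP n) \<Longrightarrow> sum f A \<in> MP n"
  by (induction A rule: infinite_finite_induct) (auto simp: MP_0 intro: MP_add)

lemma MP_mono: "A \<in> MP n \<Longrightarrow> n \<le> m \<Longrightarrow> A \<in> MP m"
  by (induction rule: MP.induct) (auto intro: MP.intros)

lemma MP_single_var: "i < n \<Longrightarrow> Poly_Mapping.single (Poly_Mapping.single i k) 1 \<in> MP n"
proof (induction k)
  case 0 then show ?case using MP_1 by simp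
next
  case (Suc k)
  have "Poly_Mapping.single (Poly_Mapping.single i (Suc k)) 1 = MX i * Poly_Mapping.single (Poly_Mapping.single i k) (1::'a)"
    by (simp add: MX_def mult_single single_add[symmetric])
  then show ?case using Suc by (auto intro: MP_mult MP_X)
qed

lemma MP_monomial: "Poly_Mapping.keys m \<subseteq> {..<n} \<Longrightarrow> Poly_Mapping.single m c \<in> MP n"
proof (induction m arbitrary: c rule: update_induct)
  case const
  then show ?case using MP_C[of c n] by (simp add: MC_def)
next
  case (update m i k)
  have eq: "Poly_Mapping.update i k m = m + Poly_Mapping.single i k"
    using update(1) by (intro poly_mapping_eqI) (auto simp: lookup_update lookup_add lookup_single when_def in_keys_iff)
  have k: "Poly_Mapping.keys (Poly_Mapping.update i k m) = insert i (Poly_Mapping.keys m)"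
    using update(2) by (simp add: keys_update)
  have "Poly_Mapping.single (Poly_Mapping.update i k m) c = Poly_Mapping.single m c * Poly_Mapping.single (Poly_Mapping.single i k) 1"
    unfolding eq by (simp add: mult_single)
  then show ?case using update k by (auto intro!: MP_mult MP_single_var)
qed

lemma MP_I: "(\<And>m. m \<in> Poly_Mapping.keys F \<Longrightarrow> Poly_Mapping.keys m \<subseteq> {..<n}) \<Longrightarrow> F \<in> MP n"
proof -
  assume *: "\<And>m. m \<in> Poly_Mapping.keys F \<Longrightarrow> Poly_Mapping.keys m \<subseteq> {..<n}"
  have "(\<Sum>m\<in>Poly_Mapping.keys F. Poly_Mapping.single m (Poly_Mapping.lookup F m)) \<in> MP n"
    by (rule MP_sum, rule MP_monomial, rule *)
  then show ?thesis using mpoly_sum_single[of F] by simp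
qed

lemma MP_ex: "\<exists>n. F \<in> MP n"
proof -
  have "finite (\<Union>m\<in>Poly_Mapping.keys F. Poly_Mapping.keys m)" by auto
  then obtain n where "(\<Union>m\<in>Poly_Mapping.keys F. Poly_Mapping.keys m) \<subseteq> {..<n}"
    by (meson finite_nat_iff_bounded)
  then have "F \<in> MP n" by (intro MP_I) blast
  then show ?thesis by blast
qed

lemma rhom_eq_on_MP:
  assumes "rhom f" "rhom g" "\<And>c. f (MC c) = g (MC c)" "\<And>i. i < n \<Longrightarrow> f (MX i) = g (MX i)" "F \<in> MP n"
  shows "f F = g F"
  using assms(5) by induction (auto simp: assms rhomD[OF assms(1)] rhomD[OF assms(2)])

lemma rhom_eq:
  assumes "rhom f" "rhom g" "\<And>c. f (MC c) = g (MC c)" "\<And>i. f (MX i) = g (MX i)"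
  shows "f F = g F"
proof -
  obtain n where "F \<in> MP n" using MP_ex by blast
  from rhom_eq_on_MP[OF assms(1-3) assms(4) this] show ?thesis .
qed

lemma rhom_comp: "rhom f \<Longrightarrow> rhom g \<Longrightarrow> rhom (\<lambda>x. f (g x))"
  by (simp add: rhom_def)

lemma rhom_id: "rhom id" "rhom (\<lambda>x. x)" by (auto simp: rhom_def)

lemma rhom_MC: "rhom MC" by (auto simp: rhom_def MC_simps)

lemma rhom_const_poly: "rhom (\<lambda>c. [:c:])" by (auto simp: rhom_def)

lemma rhom_poly: "rhom (\<lambda>p. poly p x)" by (auto simp: rhom_def)

lemmas ev_id = ev_add[OF rhom_id(1)] ev_mult[OF rhom_id(1)] ev_MC[OF rhom_id(1)] ev_MX[OF rhom_id(1)]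

lemma meval_simps [simp]:
  "meval (F + G) x = meval F x + meval G x"
  "meval (F * G) x = meval F x * meval G x"
  "meval (MC c) x = c" "meval (MX i) x = x i" "meval 0 x = 0" "meval 1 x = 1"
  using rhomD(1)[OF rhom_ev[OF rhom_id(1), of x]] by (auto simp: meval_ev ev_id)

lemma rhom_meval: "rhom (\<lambda>F. meval F x)" by (simp add: rhom_def)

lemma meval_uminus [simp]: "meval (- F) x = - meval F x"
  using meval_simps(1)[of "-F" F x] by (simp add: eq_neg_iff_add_eq_0)

lemma meval_diff [simp]: "meval (F - G) x = meval F x - meval G x"
  using meval_simps(1)[of F "-G" x] by simp

lemma meval_sum [simp]: "meval (sum f A) x = (\<Sum>a\<in>A. meval (f a) x)"
  by (induction A rule: infinite_finite_induct) auto

lemma meval_power [simp]: "meval (F ^ k) x = meval F x ^ k"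
  by (induction k) auto

lemma meval_cong: "F \<in> MP n \<Longrightarrow> (\<And>i. i < n \<Longrightarrow> x i = y i) \<Longrightarrow> meval F x = meval F y"
  by (induction rule: MP.induct) auto

definition evP :: "'k::comm_ring_1 mpoly \<Rightarrow> (nat \<Rightarrow> 'k poly) \<Rightarrow> 'k poly" where
  "evP F c = ev (\<lambda>a. [:a:]) c F"

lemma evP_simps [simp]:
  "evP (F + G) x = evP F x + evP G x"
  "evP (F * G) x = evP F x * evP G x"
  "evP (MC c) x = [:c:]" "evP (MX i) x = x i" "evP 0 x = 0"
  by (auto simp: evP_def ev_add[OF rhom_const_poly] ev_mult[OF rhom_const_poly] ev_MC[OF rhom_const_poly]
      ev_MX[OF rhom_const_poly])

lemma evP_sum [simp]: "evP (sum f A) x = (\<Sum>a\<in>A. evP (f a) x)"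
  by (induction A rule: infinite_finite_induct) auto

lemma poly_evP: "poly (evP F c) t = meval F (\<lambda>i. poly (c i) t)"
  unfolding evP_def
  by (rule rhom_eq[OF rhom_comp[OF rhom_poly rhom_ev[OF rhom_const_poly]] rhom_meval])
     (auto simp: ev_MC[OF rhom_const_poly] ev_MX[OF rhom_const_poly])

text \<open>The partial derivative is the linear coefficient of \<open>F(X + t e\<^sub>i)\<close>.\<close>

definition shiftM :: "nat \<Rightarrow> 'k::comm_ring_1 mpoly \<Rightarrow> 'k mpoly poly" where
  "shiftM i F = ev (\<lambda>c. [:MC c:]) (\<lambda>j. [:MX j, if j = i then 1 else 0:]) F"

definition pd :: "nat \<Rightarrow> 'k::comm_ring_1 mpoly \<Rightarrow> 'k mpoly" where
  "pd i F = coeff (shiftM i F) 1"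

lemma rhom_MCP: "rhom (\<lambda>c. [:MC c:])"
  using rhom_comp[OF rhom_const_poly rhom_MC] .

lemma rhom_shiftM: "rhom (shiftM i)"
  unfolding shiftM_def[abs_def] by (rule rhom_ev[OF rhom_MCP])

lemma shiftM_0: "coeff (shiftM i F) 0 = F"
proof -
  have "poly (shiftM i F) 0 = F"
    by (rule rhom_eq[OF rhom_comp[OF rhom_poly rhom_shiftM] rhom_id(2)])
       (auto simp: shiftM_def ev_MC[OF rhom_MCP] ev_MX[OF rhom_MCP])
  then show ?thesis by (simp add: poly_0_coeff_0)
qed

lemma pd_simps [simp]:
  "pd i (MC c) = 0" "pd i (MX j) = (if j = i then 1 else 0)"
  "pd i (A + B) = pd i A + pd i B" "pd i (A * B) = A * pd i B + pd i A * B"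
  by (auto simp: pd_def rhomD[OF rhom_shiftM] coeff_mult shiftM_0)
     (auto simp: shiftM_def ev_MC[OF rhom_MCP] ev_MX[OF rhom_MCP] coeff_pCons split: nat.splits)

lemma pd_0 [simp]: "pd i 0 = 0" "pd i 1 = 0"
  using pd_simps(1)[of i 0] pd_simps(1)[of i 1] by (auto simp: MC_simps)

lemma pd_uminus [simp]: "pd i (- A) = - pd i A"
  using pd_simps(3)[of i A "-A"] by (simp add: eq_neg_iff_add_eq_0 add.commute)

lemma pd_MP: "F \<in> MP n \<Longrightarrow> pd i F \<in> MP n"
  by (induction rule: MP.induct) (auto intro: MP.intros MP_0 MP_1)

lemma pd_commute: "pd i (pd j F) = pd j (pd i F)"
proof -
  obtain n where "F \<in> MP n" using MP_ex by blast
  then show ?thesis by induction (auto simp: algebra_simps)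
qed

text \<open>Stated over \<open>k[t]\<close> so that the small quantity \<open>y\<close> may be any polynomial.\<close>

lemma taylor2:
  fixes F :: "'k::field_char_0 mpoly"
  assumes "F \<in> MP n"
  shows "\<exists>R. evP F (\<lambda>i. a i + y * b i + y\<^sup>2 * c i) = evP F a + y * (\<Sum>i<n. evP (pd i F) a * b i)
     + y\<^sup>2 * ((\<Sum>i<n. evP (pd i F) a * c i) + smult (1/2) (\<Sum>i<n. \<Sum>j<n. evP (pd j (pd i F)) a * b i * b j)) + y ^ 3 * R"
  using assms
proof induction
  case (MP_C c) then show ?case by (intro exI[of _ 0]) simp
next
  case (MP_X k)
  have d: "evP (if k = i then 1 else 0) a = (if k = i then 1 else 0)" for i
    using evP_simps(3)[of 1 a] by (auto simp: MC_simps one_pCons)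
  have s: "(\<Sum>i<n. (if k = i then 1 else 0) * b i) = b k" for b :: "nat \<Rightarrow> 'k poly"
  proof -
    have "(\<Sum>i<n. (if k = i then 1 else 0) * b i) = (\<Sum>i<n. if k = i then b i else 0)" by (rule sum.cong) auto
    then show ?thesis using MP_X by simp
  qed
  have z: "pd j (if k = i then 1 else 0) = 0" for i j by simp
  show ?case by (intro exI[of _ 0]) (simp add: d s z)
next
  case (MP_add A B)
  then obtain R S where "evP A (\<lambda>i. a i + y * b i + y\<^sup>2 * c i) = evP A a + y * (\<Sum>i<n. evP (pd i A) a * b i)
     + y\<^sup>2 * ((\<Sum>i<n. evP (pd i A) a * c i) + smult (1/2) (\<Sum>i<n. \<Sum>j<n. evP (pd j (pd i A)) a * b i * b j)) + y ^ 3 * R"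
   "evP B (\<lambda>i. a i + y * b i + y\<^sup>2 * c i) = evP B a + y * (\<Sum>i<n. evP (pd i B) a * b i)
     + y\<^sup>2 * ((\<Sum>i<n. evP (pd i B) a * c i) + smult (1/2) (\<Sum>i<n. \<Sum>j<n. evP (pd j (pd i B)) a * b i * b j)) + y ^ 3 * S"
    by blast
  then show ?case
    by (intro exI[of _ "R + S"]) (simp add: algebra_simps sum.distrib smult_add_right)
next
  case (MP_mult A B)
  define dA dB where "dA b = (\<Sum>i<n. evP (pd i A) a * b i)" and "dB b = (\<Sum>i<n. evP (pd i B) a * b i)" for b
  define hA hB where "hA = (\<Sum>i<n. \<Sum>j<n. evP (pd j (pd i A)) a * b i * b j)"
    and "hB = (\<Sum>i<n. \<Sum>j<n. evP (pd j (pd i B)) a * b i * b j)"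
  obtain R S where R: "evP A (\<lambda>i. a i + y * b i + y\<^sup>2 * c i) = evP A a + y * dA b + y\<^sup>2 * (dA c + smult (1/2) hA) + y ^ 3 * R"
   and S: "evP B (\<lambda>i. a i + y * b i + y\<^sup>2 * c i) = evP B a + y * dB b + y\<^sup>2 * (dB c + smult (1/2) hB) + y ^ 3 * S"
    using MP_mult.IH unfolding dA_def dB_def hA_def hB_def by blast
  have d: "(\<Sum>i<n. evP (pd i (A * B)) a * b i) = evP A a * dB b + evP B a * dA b" for b
    unfolding dA_def dB_def by (simp add: sum_distrib_left sum.distrib algebra_simps)
  have "(\<Sum>i<n. \<Sum>j<n. evP (pd j (pd i (A * B))) a * b i * b j)
    = evP A a * hB + evP B a * hA + ((\<Sum>i<n. \<Sum>j<n. (evP (pd j A) a * b j) * (evP (pd i B) a * b i))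
      + (\<Sum>i<n. \<Sum>j<n. (evP (pd i A) a * b i) * (evP (pd j B) a * b j)))"
    unfolding hA_def hB_def by (simp add: sum_distrib_left sum.distrib algebra_simps)
  also have "(\<Sum>i<n. \<Sum>j<n. (evP (pd i A) a * b i) * (evP (pd j B) a * b j)) = dA b * dB b"
    unfolding dA_def dB_def by (simp add: sum_product)
  also have "(\<Sum>i<n. \<Sum>j<n. (evP (pd j A) a * b j) * (evP (pd i B) a * b i)) = dA b * dB b"
    unfolding dA_def dB_def by (subst sum.swap) (simp add: sum_product)
  finally have h: "(\<Sum>i<n. \<Sum>j<n. evP (pd j (pd i (A * B))) a * b i * b j) = evP A a * hB + evP B a * hA + 2 * (dA b * dB b)"
    by simp
  have sm: "smult (1/2) (p + q + 2 * r) = smult (1/2) p + smult (1/2) q + r" for p q r :: "'k poly"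
    by (simp add: smult_add_right numeral_poly)
  define u where "u = dA c + smult (1/2) hA"
  define v where "v = dB c + smult (1/2) hB"
  have "smult (1/2) (evP A a * hB) = evP A a * smult (1/2) hB" "smult (1/2) (evP B a * hA) = evP B a * smult (1/2) hA"
    by simp_all
  then have "y\<^sup>2 * ((\<Sum>i<n. evP (pd i (A * B)) a * c i) + smult (1/2) (\<Sum>i<n. \<Sum>j<n. evP (pd j (pd i (A * B))) a * b i * b j))
     = y\<^sup>2 * (evP A a * v + evP B a * u + dA b * dB b)"
    unfolding h d sm u_def v_def by (simp only: algebra_simps)
  then show ?case unfolding d evP_simps(2) R S u_def[symmetric] v_def[symmetric]
    by (intro exI[of _ "dA b * v + u * dB b + evP A a * S + evP B a * R + y * (u * v + dA b * S + R * dB b) + y^2 * (u * S + R * v) + y^3 * R * S"])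
       (simp add: algebra_simps power2_eq_square power3_eq_cube)
qed

text \<open>The total degree, read off from \<open>F(t X)\<close>.\<close>

definition scaleM :: "'k::field mpoly \<Rightarrow> 'k mpoly poly" where
  "scaleM F = ev (\<lambda>c. [:MC c:]) (\<lambda>j. [:0, MX j:]) F"

definition tdeg :: "'k::field mpoly \<Rightarrow> nat" where "tdeg F = degree (scaleM F)"

lemma rhom_scaleM: "rhom scaleM" unfolding scaleM_def[abs_def] by (rule rhom_ev[OF rhom_MCP])

lemma scaleM_at_1: "poly (scaleM F) 1 = F"
  by (rule rhom_eq[OF rhom_comp[OF rhom_poly rhom_scaleM] rhom_id(2)])
     (auto simp: scaleM_def ev_MC[OF rhom_MCP] ev_MX[OF rhom_MCP])

lemma scaleM_at_0: "poly (scaleM F) 0 = MC (meval F (\<lambda>_. 0))"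
  by (rule rhom_eq[OF rhom_comp[OF rhom_poly rhom_scaleM] rhom_comp[OF rhom_MC rhom_meval]])
     (auto simp: scaleM_def ev_MC[OF rhom_MCP] ev_MX[OF rhom_MCP] MC_simps)

lemma tdeg_mult: "F \<noteq> 0 \<Longrightarrow> G \<noteq> 0 \<Longrightarrow> tdeg (F * G) = tdeg F + tdeg G"
proof -
  assume "F \<noteq> 0" "G \<noteq> 0"
  then have "scaleM F \<noteq> 0" "scaleM G \<noteq> 0" using scaleM_at_1[of F] scaleM_at_1[of G] by auto
  then show ?thesis by (simp add: tdeg_def rhomD[OF rhom_scaleM] degree_mult_eq)
qed

lemma tdeg_0: "tdeg F = 0 \<Longrightarrow> \<exists>c. F = MC c"
proof -
  assume "tdeg F = 0"
  then obtain c where c: "scaleM F = [:c:]" unfolding tdeg_def by (metis degree_0_id)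
  have "F = c" using scaleM_at_1[of F] c by simp
  also have "c = MC (meval F (\<lambda>_. 0))" using scaleM_at_0[of F] c by simp
  finally show ?thesis by blast
qed

section \<open>Gauss's lemma relative to a subring\<close>

definition subring :: "'a::idom set \<Rightarrow> bool" where
  "subring S \<longleftrightarrow> 0 \<in> S \<and> 1 \<in> S \<and> (\<forall>a\<in>S. \<forall>b\<in>S. a - b \<in> S \<and> a * b \<in> S)"

lemma subringD:
  assumes "subring S"
  shows "0 \<in> S" "1 \<in> S" "a \<in> S \<Longrightarrow> b \<in> S \<Longrightarrow> a - b \<in> S" "a \<in> S \<Longrightarrow> b \<in> S \<Longrightarrow> a * b \<in> S"
    "a \<in> S \<Longrightarrow> b \<in> S \<Longrightarrow> a + b \<in> S" "a \<in> S \<Longrightarrow> - a \<in> S"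
proof -
  show 1: "0 \<in> S" "1 \<in> S" "a \<in> S \<Longrightarrow> b \<in> S \<Longrightarrow> a - b \<in> S" "a \<in> S \<Longrightarrow> b \<in> S \<Longrightarrow> a * b \<in> S" for a b
    using assms by (auto simp: subring_def)
  show 2: "a \<in> S \<Longrightarrow> - a \<in> S" for a using 1(3)[of 0 a] 1(1) by simp
  show "a \<in> S \<Longrightarrow> b \<in> S \<Longrightarrow> a + b \<in> S" using 1(3)[of a "-b"] 2 by simp
qed

lemma subring_sum: "subring S \<Longrightarrow> (\<And>a. a \<in> A \<Longrightarrow> f a \<in> S) \<Longrightarrow> sum f A \<in> S"
  by (induction A rule: infinite_finite_induct) (auto simp: subringD)

definition sdvd :: "'a::idom set \<Rightarrow> 'a \<Rightarrow> 'a \<Rightarrow> bool" where "sdvd S a b \<longleftrightarrow> (\<exists>c\<in>S. b = a * c)"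

definition sunit :: "'a::idom set \<Rightarrow> 'a \<Rightarrow> bool" where "sunit S a \<longleftrightarrow> a \<in> S \<and> (\<exists>b\<in>S. a * b = 1)"

definition sirr :: "'a::idom set \<Rightarrow> 'a \<Rightarrow> bool" where
  "sirr S a \<longleftrightarrow> a \<in> S \<and> a \<noteq> 0 \<and> \<not> sunit S a \<and> (\<forall>b\<in>S. \<forall>c\<in>S. a = b * c \<longrightarrow> sunit S b \<or> sunit S c)"

definition sprime :: "'a::idom set \<Rightarrow> 'a \<Rightarrow> bool" where
  "sprime S a \<longleftrightarrow> a \<in> S \<and> a \<noteq> 0 \<and> \<not> sunit S a \<and> (\<forall>b\<in>S. \<forall>c\<in>S. sdvd S a (b * c) \<longrightarrow> sdvd S a b \<or> sdvd S a c)"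

inductive sPF :: "'a::idom set \<Rightarrow> 'a \<Rightarrow> bool" for S where
  sPF_unit: "sunit S a \<Longrightarrow> sPF S a"
| sPF_prime: "sprime S p \<Longrightarrow> sPF S a \<Longrightarrow> sPF S (p * a)"

text \<open>\<open>\<delta>\<close> is a multiplicative size function which detects units; it makes factorizations terminate.\<close>

definition size_fun :: "'a::idom set \<Rightarrow> ('a \<Rightarrow> nat) \<Rightarrow> bool" where
  "size_fun S \<delta> \<longleftrightarrow> (\<forall>a\<in>S. \<forall>b\<in>S. a \<noteq> 0 \<longrightarrow> b \<noteq> 0 \<longrightarrow> \<delta> (a * b) = \<delta> a + \<delta> b) \<and>
     (\<forall>a\<in>S. a \<noteq> 0 \<longrightarrow> \<delta> a = 0 \<longrightarrow> sunit S a)"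

lemma sPF_in: "subring S \<Longrightarrow> sPF S a \<Longrightarrow> a \<in> S \<and> a \<noteq> 0"
  by (rotate_tac, induction rule: sPF.induct) (auto simp: sunit_def sprime_def subringD)

lemma sunit_mult: "subring S \<Longrightarrow> sunit S a \<Longrightarrow> sunit S b \<Longrightarrow> sunit S (a * b)"
  unfolding sunit_def
  by (metis (no_types, lifting) mult.assoc mult.left_commute mult.right_neutral subringD(4))

lemma sPF_mult_unit:
  assumes S: "subring S" and u: "sunit S u" and a: "sPF S a" shows "sPF S (u * a)"
  using a
proof induction
  case (sPF_unit a)
  then show ?case using sunit_mult[OF S u] by (auto intro: sPF.intros)
next
  case (sPF_prime p a)
  then show ?case using sPF.sPF_prime[of S p "u * a"] by (simp add: mult.left_commute)
qed

lemma sPF_mult: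
  assumes S: "subring S" and a: "sPF S a" and b: "sPF S b" shows "sPF S (a * b)"
  using a
proof induction
  case (sPF_unit a) then show ?case using sPF_mult_unit[OF S] b by auto
next
  case (sPF_prime p a) then show ?case using sPF.sPF_prime[of S p "a * b"] by (simp add: mult.assoc)
qed

lemma sPF_exists:
  assumes S: "subring S" and d: "size_fun S \<delta>" and ip: "\<And>a. sirr S a \<Longrightarrow> sprime S a"
  shows "a \<in> S \<Longrightarrow> a \<noteq> 0 \<Longrightarrow> sPF S a"
proof (induction "\<delta> a" arbitrary: a rule: less_induct)
  case less
  consider "sunit S a" | "sirr S a" | b c where "b \<in> S" "c \<in> S" "a = b * c" "\<not> sunit S b" "\<not> sunit S c" "\<not> sunit S a"
    using less unfolding sirr_def by blast
  then show ?case
  proof cases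
    case 1 then show ?thesis by (rule sPF_unit)
  next
    case 2
    have "sPF S 1" by (rule sPF_unit) (auto simp: sunit_def subringD[OF S])
    then show ?thesis using sPF_prime[OF ip[OF 2]] by fastforce
  next
    case 3
    then have nz: "b \<noteq> 0" "c \<noteq> 0" using less by auto
    then have "\<delta> a = \<delta> b + \<delta> c" "\<delta> b \<noteq> 0" "\<delta> c \<noteq> 0" using d 3 by (auto simp: size_fun_def)
    then have "sPF S b" "sPF S c" using less(1) 3 nz by auto
    then show ?thesis using sPF_mult[OF S] 3 by auto
  qed
qed

definition SP :: "'a::idom set \<Rightarrow> 'a poly set" where "SP S = {p. \<forall>i. coeff p i \<in> S}"

lemma SP_const: "subring S \<Longrightarrow> [:c:] \<in> SP S \<longleftrightarrow> c \<in> S"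
  by (auto simp: SP_def coeff_pCons subringD split: nat.splits)

lemma SP_monom: "subring S \<Longrightarrow> c \<in> S \<Longrightarrow> monom c k \<in> SP S"
  by (auto simp: SP_def subringD)

lemma subring_SP: assumes "subring S" shows "subring (SP S)"
  unfolding subring_def
proof (intro conjI ballI)
  show "0 \<in> SP S" "1 \<in> SP S" using assms by (auto simp: SP_def subringD coeff_1)
  fix p q assume "p \<in> SP S" "q \<in> SP S"
  then show "p - q \<in> SP S" "p * q \<in> SP S"
    by (auto simp: SP_def coeff_mult subringD[OF assms] intro!: subring_sum[OF assms])
qed

lemma sunit_SP: assumes "subring S" shows "sunit (SP S) p \<longleftrightarrow> (\<exists>c. p = [:c:] \<and> sunit S c)"
proof
  assume "sunit (SP S) p"
  then obtain q where q: "p \<in> SP S" "q \<in> SP S" "p * q = 1" by (auto simp: sunit_def)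
  then have "degree p + degree q = 0" by (metis degree_1 degree_mult_eq mult_zero_left mult_zero_right zero_neq_one)
  then obtain c d where "p = [:c:]" "q = [:d:]" by (metis add_is_0 degree_0_id)
  then show "\<exists>c. p = [:c:] \<and> sunit S c" using q SP_const[OF assms]
    by (auto simp: sunit_def one_pCons) (metis mult.commute)
next
  assume "\<exists>c. p = [:c:] \<and> sunit S c"
  then obtain c d where "p = [:c:]" "c \<in> S" "d \<in> S" "c * d = 1" by (auto simp: sunit_def)
  then show "sunit (SP S) p" unfolding sunit_def
    by (intro conjI bexI[of _ "[:d:]"]) (auto simp: SP_const[OF assms] one_pCons mult.commute)
qed

lemma sdvd_SP_const: assumes S: "subring S" and s: "s \<noteq> 0"
  shows "sdvd (SP S) [:s:] p \<longleftrightarrow> (\<forall>i. sdvd S s (coeff p i))"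
proof
  show "sdvd (SP S) [:s:] p \<Longrightarrow> \<forall>i. sdvd S s (coeff p i)" by (auto simp: sdvd_def SP_def)
  assume "\<forall>i. sdvd S s (coeff p i)"
  then show "sdvd (SP S) [:s:] p"
  proof (induction p)
    case 0 then show ?case using subringD[OF subring_SP[OF S]] by (auto simp: sdvd_def)
  next
    case (pCons a p)
    have "\<forall>i. sdvd S s (coeff p i)" using pCons(3) by (metis coeff_pCons_Suc)
    then obtain c where c: "c \<in> SP S" "p = [:s:] * c" using pCons by (auto simp: sdvd_def)
    obtain d where d: "d \<in> S" "a = s * d" using pCons(3)[rule_format, of 0] by (auto simp: sdvd_def)
    have "pCons d c \<in> SP S" using c d by (auto simp: SP_def coeff_pCons split: nat.splits)
    moreover have "pCons a p = [:s:] * pCons d c" using c d by simp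
    ultimately show ?case unfolding sdvd_def by blast
  qed
qed

lemma sdvd_add: "subring S \<Longrightarrow> sdvd S a b \<Longrightarrow> sdvd S a c \<Longrightarrow> sdvd S a (b + c)"
  unfolding sdvd_def by (metis distrib_left subringD(5))

lemma sdvd_diff: "subring S \<Longrightarrow> sdvd S a b \<Longrightarrow> sdvd S a c \<Longrightarrow> sdvd S a (b - c)"
  unfolding sdvd_def by (metis right_diff_distrib subringD(3))

lemma sdvd_mult: "subring S \<Longrightarrow> sdvd S a b \<Longrightarrow> c \<in> S \<Longrightarrow> sdvd S a (b * c)"
  unfolding sdvd_def by (metis mult.assoc subringD(4))

lemma sdvd_mult2: "subring S \<Longrightarrow> sdvd S a b \<Longrightarrow> c \<in> S \<Longrightarrow> sdvd S a (c * b)"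
  using sdvd_mult by (metis mult.commute)

lemma sdvd_sum: "subring S \<Longrightarrow> (\<And>i. i \<in> I \<Longrightarrow> sdvd S a (f i)) \<Longrightarrow> sdvd S a (sum f I)"
proof (induction I rule: infinite_finite_induct)
  case (insert x I) then show ?case by (simp add: sdvd_add)
qed (auto simp: sdvd_def intro!: bexI[of _ 0] subringD)

lemma sprime_const:
  assumes S: "subring S" and s: "sprime S s" shows "sprime (SP S) [:s:]"
  unfolding sprime_def
proof (intro conjI ballI impI)
  have s0: "s \<noteq> 0" "s \<in> S" using s by (auto simp: sprime_def)
  show "[:s:] \<in> SP S" "[:s:] \<noteq> 0" "\<not> sunit (SP S) [:s:]"
    using s by (auto simp: sprime_def SP_const[OF S] sunit_SP[OF S])
  fix p q assume pq: "p \<in> SP S" "q \<in> SP S" and d: "sdvd (SP S) [:s:] (p * q)"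
  show "sdvd (SP S) [:s:] p \<or> sdvd (SP S) [:s:] q"
  proof (rule ccontr)
    assume "\<not> ?thesis"
    then have ex: "\<exists>i. \<not> sdvd S s (coeff p i)" "\<exists>i. \<not> sdvd S s (coeff q i)"
      by (auto simp: sdvd_SP_const[OF S s0(1)])
    define i where "i = (LEAST i. \<not> sdvd S s (coeff p i))"
    define j where "j = (LEAST i. \<not> sdvd S s (coeff q i))"
    have i: "\<not> sdvd S s (coeff p i)" "k < i \<Longrightarrow> sdvd S s (coeff p k)" for k
      unfolding i_def by (rule LeastI_ex[OF ex(1)]) (use not_less_Least in blast)
    have j: "\<not> sdvd S s (coeff q j)" "k < j \<Longrightarrow> sdvd S s (coeff q k)" for k
      unfolding j_def by (rule LeastI_ex[OF ex(2)]) (use not_less_Least in blast)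
    have cS: "coeff p k \<in> S" "coeff q k \<in> S" for k using pq by (auto simp: SP_def)
    have eq: "coeff (p * q) (i + j) = coeff p i * coeff q j + (\<Sum>k\<in>{..i+j}-{i}. coeff p k * coeff q (i + j - k))"
      by (subst coeff_mult, subst sum.remove[of _ i]) auto
    have "sdvd S s (coeff p k * coeff q (i + j - k))" if "k \<in> {..i+j}-{i}" for k
    proof (cases "k < i")
      case True then show ?thesis using sdvd_mult[OF S] i cS by blast
    next
      case False
      then have "i + j - k < j" using that by auto
      then show ?thesis using sdvd_mult2[OF S] j cS by blast
    qed
    then have 1: "sdvd S s (\<Sum>k\<in>{..i+j}-{i}. coeff p k * coeff q (i + j - k))" by (rule sdvd_sum[OF S])
    have 2: "sdvd S s (coeff (p * q) (i + j))" using d sdvd_SP_const[OF S s0(1)] by blast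
    have "sdvd S s (coeff p i * coeff q j)" using sdvd_diff[OF S 2 1] unfolding eq by simp
    then show False using s i(1) j(1) cS by (auto simp: sprime_def)
  qed
qed

lemma relative_pseudo_division:
  assumes S: "subring S" and H: "H \<in> SP S" "H \<noteq> 0"
  shows "f \<in> SP S \<Longrightarrow> \<exists>c\<in>S. c \<noteq> 0 \<and> (\<exists>q\<in>SP S. \<exists>r\<in>SP S. [:c:] * f = q * H + r \<and> (r = 0 \<or> degree r < degree H))"
proof (induction "if f = 0 then 0 else Suc (degree f)" arbitrary: f rule: less_induct)
  case less
  note SPS = subringD[OF subring_SP[OF S]]
  show ?case
  proof (cases "f = 0 \<or> degree f < degree H")
    case True
    then show ?thesis using SPS(1,2) less(2) subringD(1,2)[OF S]
      by (intro bexI[of _ 1] conjI bexI[of _ 0] bexI[of _ f]) (auto simp: one_pCons[symmetric])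
  next
    case False
    define m where "m = monom (lead_coeff f) (degree f - degree H)"
    define f' where "f' = [:lead_coeff H:] * f - m * H"
    have lS: "lead_coeff f \<in> S" "lead_coeff H \<in> S" using less(2) H by (auto simp: SP_def)
    have mS: "m \<in> SP S" unfolding m_def using lS(1) by (rule SP_monom[OF S])
    have f'S: "f' \<in> SP S" unfolding f'_def by (intro SPS(3-5) SP_const[OF S, THEN iffD2]) (fact mS H less(2) lS)+
    have "degree (m * H) \<le> degree f"
      using degree_mult_le[of m H] degree_monom_le[of "lead_coeff f" "degree f - degree H"] False unfolding m_def by linarith
    then have "degree f' \<le> degree f" unfolding f'_def by (intro degree_diff_le) auto
    moreover have "coeff (m * H) (degree f) = lead_coeff f * lead_coeff H"
      using False unfolding m_def by (simp add: coeff_monom_mult)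
    then have "coeff f' (degree f) = 0" unfolding f'_def by simp
    ultimately have "f' = 0 \<or> degree f' < degree f" by (rule eq_zero_or_degree_less)
    then have "(if f' = 0 then 0 else Suc (degree f')) < (if f = 0 then 0 else Suc (degree f))" using False by auto
    from less(1)[OF this f'S] obtain c q r where c: "c \<in> S" "c \<noteq> 0" "q \<in> SP S" "r \<in> SP S" "[:c:] * f' = q * H + r"
      "r = 0 \<or> degree r < degree H" by blast
    have e: "[:c * lead_coeff H:] = [:c:] * [:lead_coeff H:]" by simp
    have "[:c * lead_coeff H:] * f = (q + [:c:] * m) * H + r"
      unfolding e using c(5) unfolding f'_def by (simp only: algebra_simps)
    moreover have "q + [:c:] * m \<in> SP S" by (intro SPS(3-5) SP_const[OF S, THEN iffD2]) (fact c mS)+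
    moreover have "c * lead_coeff H \<in> S" "c * lead_coeff H \<noteq> 0" using c lS H subringD[OF S] by auto
    ultimately show ?thesis using c by blast
  qed
qed

lemma cancel_const_factor:
  assumes S: "subring S" and c: "sPF S c" and g: "\<And>s. sprime S s \<Longrightarrow> \<not> sdvd (SP S) [:s:] g"
    and gS: "g \<in> SP S"
  shows "A \<in> SP S \<Longrightarrow> t \<in> SP S \<Longrightarrow> [:c:] * A = g * t \<Longrightarrow> sdvd (SP S) g A"
  using c
proof (induction arbitrary: t)
  note SPS = subringD[OF subring_SP[OF S]]
  case (sPF_unit a)
  then obtain b where b: "b \<in> S" "a * b = 1" by (auto simp: sunit_def)
  have "A = [:b:] * ([:a:] * A)" using b(2) by (simp add: mult.commute)
  also have "\<dots> = g * ([:b:] * t)" using sPF_unit by (simp add: mult.left_commute)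
  finally have "A = g * ([:b:] * t)" .
  moreover have "[:b:] * t \<in> SP S" by (intro SPS(4) SP_const[OF S, THEN iffD2]) (fact b sPF_unit)+
  ultimately show ?case unfolding sdvd_def by blast
next
  note SPS = subringD[OF subring_SP[OF S]]
  case (sPF_prime s a)
  have s: "sprime (SP S) [:s:]" by (rule sprime_const[OF S sPF_prime(1)])
  have aS: "a \<in> S" using sPF_in[OF S sPF_prime(2)] by simp
  have e: "g * t = [:s:] * ([:a:] * A)" using sPF_prime.prems by (simp add: mult.commute[of a s])
  moreover have "[:a:] * A \<in> SP S" by (intro SPS(3-5) SP_const[OF S, THEN iffD2]) (fact aS sPF_prime.prems)+
  ultimately have "sdvd (SP S) [:s:] (g * t)" unfolding sdvd_def by blast
  then have "sdvd (SP S) [:s:] t" using s g[OF sPF_prime(1)] gS sPF_prime.prems by (auto simp: sprime_def)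
  then obtain t' where t': "t' \<in> SP S" "t = [:s:] * t'" by (auto simp: sdvd_def)
  have "[:s:] \<noteq> 0" using s by (simp add: sprime_def)
  then have "[:a:] * A = g * t'" using e t' by (metis mult_left_cancel mult.left_commute)
  then show ?case using sPF_prime t' by blast
qed

lemma distribute_const_factor:
  assumes S: "subring S" and c: "sPF S c"
  shows "g \<in> SP S \<Longrightarrow> q \<in> SP S \<Longrightarrow> H \<in> SP S \<Longrightarrow> [:c:] * g = q * H \<Longrightarrow>
    \<exists>q'\<in>SP S. \<exists>H'\<in>SP S. \<exists>a\<in>S. \<exists>b\<in>S. q = [:a:] * q' \<and> H = [:b:] * H' \<and> g = q' * H'"
  using c
proof (induction arbitrary: q H)
  note SPS = subringD[OF subring_SP[OF S]]
  case (sPF_unit a)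
  then obtain b where b: "b \<in> S" "a * b = 1" "a \<in> S" by (auto simp: sunit_def)
  have "g = [:b:] * ([:a:] * g)" using b(2) by (simp add: mult.commute)
  also have "\<dots> = ([:b:] * q) * H" using sPF_unit by (simp only: mult.assoc)
  finally have "g = ([:b:] * q) * H" .
  moreover have "q = [:a:] * ([:b:] * q)" "H = [:1:] * H" using b(2) by (auto simp: mult.commute)
  moreover have "[:b:] * q \<in> SP S" by (intro SPS(3-5) SP_const[OF S, THEN iffD2]) (fact b sPF_unit)+
  ultimately show ?case using b sPF_unit subringD(2)[OF S] by blast
next
  note SPS = subringD[OF subring_SP[OF S]]
  case (sPF_prime s c)
  have s: "sprime (SP S) [:s:]" "[:s:] \<noteq> 0" "s \<in> S"
    using sprime_const[OF S sPF_prime(1)] sPF_prime(1) by (auto simp: sprime_def)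
  have cS: "c \<in> S" using sPF_in[OF S sPF_prime(2)] by simp
  have e: "q * H = [:s:] * ([:c:] * g)" using sPF_prime.prems by (simp add: mult.commute[of c s])
  moreover have "[:c:] * g \<in> SP S" by (intro SPS(3-5) SP_const[OF S, THEN iffD2]) (fact cS sPF_prime.prems)+
  ultimately have "sdvd (SP S) [:s:] (q * H)" unfolding sdvd_def by blast
  then consider "sdvd (SP S) [:s:] q" | "sdvd (SP S) [:s:] H" using s sPF_prime.prems by (auto simp: sprime_def)
  then show ?case
  proof cases
    case 1
    then obtain q1 where q1: "q1 \<in> SP S" "q = [:s:] * q1" by (auto simp: sdvd_def)
    have "[:c:] * g = q1 * H" using e q1 s by (metis mult_left_cancel mult.assoc)
    then obtain q' H' a b where *: "q' \<in> SP S" "H' \<in> SP S" "a \<in> S" "b \<in> S" "q1 = [:a:] * q'" "H = [:b:] * H'" "g = q' * H'"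
      using sPF_prime q1 by metis
    have "q = [:s * a:] * q'" "s * a \<in> S" using q1 * s subringD(4)[OF S] by (auto simp: mult.commute[of a s])
    then show ?thesis using * by blast
  next
    case 2
    then obtain H1 where H1: "H1 \<in> SP S" "H = [:s:] * H1" by (auto simp: sdvd_def)
    have "[:c:] * g = q * H1" using e H1 s by (metis mult_left_cancel mult.left_commute)
    then obtain q' H' a b where *: "q' \<in> SP S" "H' \<in> SP S" "a \<in> S" "b \<in> S" "q = [:a:] * q'" "H1 = [:b:] * H'" "g = q' * H'"
      using sPF_prime H1 by metis
    have "H = [:s * b:] * H'" "s * b \<in> S" using H1 * s subringD(4)[OF S] by (auto simp: mult.commute[of b s])
    then show ?thesis using * by blast
  qed
qed

lemma sirr_no_const_factor:
  assumes S: "subring S" and g: "sirr (SP S) g" "degree g > 0" and s: "sprime S s"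
  shows "\<not> sdvd (SP S) [:s:] g"
proof
  assume "sdvd (SP S) [:s:] g"
  then obtain h where h: "h \<in> SP S" "g = [:s:] * h" by (auto simp: sdvd_def)
  have "[:s:] \<in> SP S" using s SP_const[OF S] by (auto simp: sprime_def)
  then have "sunit (SP S) [:s:] \<or> sunit (SP S) h" using g h by (auto simp: sirr_def)
  moreover have "\<not> sunit (SP S) [:s:]" using sprime_const[OF S s] by (simp add: sprime_def)
  ultimately obtain c where "h = [:c:]" using sunit_SP[OF S] by blast
  then show False using g(2) h by simp
qed

text \<open>A polynomial of minimal degree in the ideal \<open>(g, A)\<close> divides a constant multiple of both generators.\<close>

lemma sirr_elimination:
  assumes S: "subring S" and U: "\<And>c. c \<in> S \<Longrightarrow> c \<noteq> 0 \<Longrightarrow> sPF S c"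
    and g: "sirr (SP S) g" "degree g > 0" and A: "A \<in> SP S" and nd: "\<not> sdvd (SP S) g A"
  shows "\<exists>u\<in>SP S. \<exists>v\<in>SP S. \<exists>h\<in>S. h \<noteq> 0 \<and> u * g + v * A = [:h:]"
proof -
  note SPS = subringD[OF subring_SP[OF S]]
  have gS: "g \<in> SP S" and g0: "g \<noteq> 0" using g by (auto simp: sirr_def)
  define J where "J = {H. H \<noteq> 0 \<and> (\<exists>u\<in>SP S. \<exists>v\<in>SP S. H = u * g + v * A)}"
  have JJ: "u * g + v * A \<in> J" if "u \<in> SP S" "v \<in> SP S" "u * g + v * A \<noteq> 0" for u v
    using that unfolding J_def by blast
  have "1 * g + 0 * A \<in> J" using JJ[of 1 0] SPS(1,2) g0 by auto
  then obtain H where H: "H \<in> J" and min: "\<And>r. r \<in> J \<Longrightarrow> degree H \<le> degree r"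
    using ex_has_least_nat[of "\<lambda>H. H \<in> J" _ degree] by blast
  obtain u v where uv: "u \<in> SP S" "v \<in> SP S" "H = u * g + v * A" and H0: "H \<noteq> 0" using H unfolding J_def by blast
  have HS: "H \<in> SP S" unfolding uv(3) by (intro SPS(3-5) SP_const[OF S, THEN iffD2]) (fact uv gS A)+
  have div: "\<exists>c\<in>S. c \<noteq> 0 \<and> (\<exists>q\<in>SP S. [:c:] * f = q * H)" if f: "f = x * g + y * A" "x \<in> SP S" "y \<in> SP S" for f x y
  proof -
    have fS: "f \<in> SP S" unfolding f(1) by (intro SPS(3-5) SP_const[OF S, THEN iffD2]) (fact f gS A)+
    obtain c q r where c: "c \<in> S" "c \<noteq> 0" "q \<in> SP S" "r \<in> SP S" "[:c:] * f = q * H + r" "r = 0 \<or> degree r < degree H"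
      using relative_pseudo_division[OF S HS H0 fS] by blast
    have "r = ([:c:] * x - q * u) * g + ([:c:] * y - q * v) * A"
      using c(5) unfolding f(1) uv(3) by (simp add: algebra_simps)
    moreover have "[:c:] * x - q * u \<in> SP S" "[:c:] * y - q * v \<in> SP S"
      by (intro SPS(3-5) SP_const[OF S, THEN iffD2]; fact c f uv)+
    ultimately have "r \<noteq> 0 \<Longrightarrow> r \<in> J" using JJ by blast
    then have "r = 0" using c(6) min by fastforce
    then show ?thesis using c by auto
  qed
  obtain c q where c: "c \<in> S" "c \<noteq> 0" "q \<in> SP S" "[:c:] * g = q * H" using div[of g 1 0] SPS(1,2) by auto
  obtain c' q' where c': "c' \<in> S" "c' \<noteq> 0" "q' \<in> SP S" "[:c':] * A = q' * H" using div[of A 0 1] SPS(1,2) by auto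
  obtain q1 H1 a b where *: "q1 \<in> SP S" "H1 \<in> SP S" "a \<in> S" "b \<in> S" "q = [:a:] * q1" "H = [:b:] * H1" "g = q1 * H1"
    using distribute_const_factor[OF S U[OF c(1,2)] gS c(3) HS c(4)] by blast
  have "sunit (SP S) q1 \<or> sunit (SP S) H1" using g * by (auto simp: sirr_def)
  then show ?thesis
  proof
    assume "sunit (SP S) H1"
    then obtain d where "H1 = [:d:]" using sunit_SP[OF S] by auto
    then have "H = [:b * d:]" using * by simp
    then show ?thesis using uv H0 HS SP_const[OF S] by (metis pCons_0_0)
  next
    assume "sunit (SP S) q1"
    then obtain w where w: "w \<in> SP S" "q1 * w = 1" by (auto simp: sunit_def)
    have "[:c':] * A = g * (q' * [:b:] * w)"
    proof -
      have "g * (q' * [:b:] * w) = (q1 * w) * (q' * ([:b:] * H1))" unfolding *(7) by (simp only: ac_simps)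
      then show ?thesis using w c' * by simp
    qed
    moreover have "q' * [:b:] * w \<in> SP S" by (intro SPS(3-5) SP_const[OF S, THEN iffD2]) (fact c' w *)+
    ultimately have "sdvd (SP S) g A"
      using cancel_const_factor[OF S U[OF c'(1,2)] sirr_no_const_factor[OF S g] gS A] by blast
    then show ?thesis using nd by blast
  qed
qed

lemma sirr_SP_prime:
  assumes S: "subring S" and d: "size_fun S \<delta>" and ip: "\<And>a. sirr S a \<Longrightarrow> sprime S a" and g: "sirr (SP S) g"
  shows "sprime (SP S) g"
proof (cases "degree g = 0")
  case True
  then obtain a where a: "g = [:a:]" by (metis degree_0_id)
  have "sirr S a" unfolding sirr_def
  proof (intro conjI ballI impI)
    show "a \<in> S" "a \<noteq> 0" "\<not> sunit S a" using g a SP_const[OF S] sunit_SP[OF S] by (auto simp: sirr_def)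
    fix b c assume "b \<in> S" "c \<in> S" "a = b * c"
    moreover from this have "g = [:b:] * [:c:]" using a by simp
    ultimately have "sunit (SP S) [:b:] \<or> sunit (SP S) [:c:]" using g SP_const[OF S] unfolding sirr_def by blast
    then show "sunit S b \<or> sunit S c" using sunit_SP[OF S] by auto
  qed
  then show ?thesis using sprime_const[OF S ip] a by blast
next
  case False
  note SPS = subringD[OF subring_SP[OF S]]
  have U: "\<And>c. c \<in> S \<Longrightarrow> c \<noteq> 0 \<Longrightarrow> sPF S c" by (rule sPF_exists[OF S d ip])
  have gS: "g \<in> SP S" using g by (simp add: sirr_def)
  show ?thesis unfolding sprime_def
  proof (intro conjI ballI impI)
    show "g \<in> SP S" "g \<noteq> 0" "\<not> sunit (SP S) g" using g by (auto simp: sirr_def)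
    fix A B assume AB: "A \<in> SP S" "B \<in> SP S" "sdvd (SP S) g (A * B)"
    show "sdvd (SP S) g A \<or> sdvd (SP S) g B"
    proof (rule ccontr)
      assume n: "\<not> ?thesis"
      obtain u v h where uv: "u \<in> SP S" "v \<in> SP S" "h \<in> S" "h \<noteq> 0" "u * g + v * A = [:h:]"
        using sirr_elimination[OF S U g _ AB(1)] n False by auto
      obtain t where t: "t \<in> SP S" "A * B = g * t" using AB(3) by (auto simp: sdvd_def)
      have "[:h:] * B = g * (u * B) + v * (A * B)" unfolding uv(5)[symmetric] by (simp add: algebra_simps)
      then have "[:h:] * B = g * (u * B + v * t)" unfolding t(2) by (simp add: algebra_simps)
      moreover have "u * B + v * t \<in> SP S" by (intro SPS(3-5) SP_const[OF S, THEN iffD2]) (fact uv t AB)+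
      ultimately have "sdvd (SP S) g B"
        using cancel_const_factor[OF S U[OF uv(3,4)] sirr_no_const_factor[OF S g] gS AB(2)] False by blast
      then show False using n by blast
    qed
  qed
qed

section \<open>Irreducible polynomials over an algebraically closed field\<close>

lemma subring_MP: "subring (MP n :: 'k::field mpoly set)"
  unfolding subring_def by (auto intro: MP_0 MP_1 MP_diff MP_mult)

lemma MC_eq_0 [simp]: "MC c = 0 \<longleftrightarrow> c = 0"
  using MC_inject[of c 0] by (simp add: MC_simps)

lemma MC_unit: "(c::'k::field) \<noteq> 0 \<Longrightarrow> MC c * MC (inverse c) = 1"
  by (simp flip: MC_simps(4) add: MC_simps(2))

lemma unit_MC: assumes "(a::'k::field mpoly) * b = 1" shows "\<exists>c. c \<noteq> 0 \<and> a = MC c"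
proof -
  have nz: "a \<noteq> 0" "b \<noteq> 0" using assms by auto
  have "tdeg (1 * 1 :: 'k mpoly) = tdeg (1::'k mpoly) + tdeg (1::'k mpoly)" by (rule tdeg_mult) auto
  then have "tdeg a + tdeg b = 0" using tdeg_mult[OF nz] assms by simp
  then obtain c where "a = MC c" using tdeg_0 by auto
  then show ?thesis using nz by (auto simp: MC_simps)
qed

lemma is_unit_MC: "(a::'k::field mpoly) dvd 1 \<longleftrightarrow> (\<exists>c. c \<noteq> 0 \<and> a = MC c)"
proof
  show "a dvd 1 \<Longrightarrow> \<exists>c. c \<noteq> 0 \<and> a = MC c" using unit_MC by (metis dvdE)
  show "\<exists>c. c \<noteq> 0 \<and> a = MC c \<Longrightarrow> a dvd 1" using MC_unit by (metis dvdI)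
qed

lemma sunit_MP: "sunit (MP n) (a::'k::field mpoly) \<longleftrightarrow> a dvd 1"
proof
  show "sunit (MP n) a \<Longrightarrow> a dvd 1" by (metis dvdI sunit_def)
  assume "a dvd 1"
  then obtain c where c: "c \<noteq> 0" "a = MC c" using is_unit_MC by blast
  then show "sunit (MP n) a" unfolding sunit_def using MC_unit[OF c(1)] MP_C by blast
qed

lemma size_fun_MP: "size_fun (MP n :: 'k::field mpoly set) tdeg"
  unfolding size_fun_def
proof (intro conjI ballI impI)
  fix a :: "'k mpoly" assume "a \<in> MP n" "a \<noteq> 0" "tdeg a = 0"
  then show "sunit (MP n) a" using tdeg_0[of a] by (auto simp: sunit_MP is_unit_MC MC_simps)
qed (simp add: tdeg_mult)

definition inM :: "nat \<Rightarrow> 'k::comm_ring_1 mpoly poly \<Rightarrow> 'k mpoly" where "inM n q = poly q (MX n)"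

lemma inM_simps: "inM n (p * q) = inM n p * inM n q" "inM n (p + q) = inM n p + inM n q" "inM n [:c:] = c"
  "inM n 1 = 1" "inM n 0 = 0"
  by (auto simp: inM_def)

lemma inM_MP: "q \<in> SP (MP n) \<Longrightarrow> inM n q \<in> MP (Suc n)" for q :: "'k::field mpoly poly"
proof (induction q)
  case (pCons a q)
  have "coeff (pCons a q) i \<in> MP n" for i using pCons(3) by (simp add: SP_def)
  from this[of 0] this[of "Suc _"] have "a \<in> MP n" "\<forall>i. coeff q i \<in> MP n" by auto
  then have "a \<in> MP (Suc n)" "q \<in> SP (MP n)" by (auto simp: SP_def intro: MP_mono)
  then show ?case using MP_add[OF _ MP_mult[OF MP_X[OF lessI]]] pCons(2) by (simp add: inM_def)
qed (simp add: inM_def MP_0)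

lemma MP_Suc_ex: "F \<in> MP (Suc n) \<Longrightarrow> \<exists>q\<in>SP (MP n). F = inM n q" for F :: "'k::field mpoly"
proof (induction rule: MP.induct)
  case (MP_C c)
  show ?case by (intro bexI[of _ "[:MC c:]"]) (auto simp: inM_simps SP_const[OF subring_MP] MP.MP_C)
next
  case (MP_X i)
  show ?case
  proof (cases "i = n")
    case True
    have "monom 1 1 \<in> SP (MP n :: 'k mpoly set)" by (rule SP_monom[OF subring_MP MP_1])
    then show ?thesis using True by (intro bexI[of _ "monom 1 1"]) (auto simp: inM_def poly_monom)
  next
    case False
    then show ?thesis using MP_X
      by (intro bexI[of _ "[:MX i:]"]) (auto simp: inM_simps SP_const[OF subring_MP] MP.MP_X)
  qed
next
  case (MP_add A B)
  then show ?case using subringD(5)[OF subring_SP[OF subring_MP]] inM_simps(2) by metis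
next
  case (MP_mult A B)
  then show ?case using subringD(4)[OF subring_SP[OF subring_MP]] inM_simps(1) by metis
qed

definition specialize :: "(nat \<Rightarrow> 'k::comm_ring_1) \<Rightarrow> 'k mpoly poly \<Rightarrow> 'k poly" where
  "specialize x q = map_poly (\<lambda>A. meval A x) q"

lemma coeff_specialize: "coeff (specialize x q) i = meval (coeff q i) x"
  by (simp add: specialize_def coeff_map_poly)

lemma meval_inM: "meval (inM n q) x = poly (specialize x q) (x n)"
  unfolding inM_def specialize_def by (induction q) (auto simp: map_poly_pCons)

lemma meval_inM_upd:
  assumes "q \<in> SP (MP n)" shows "meval (inM n q) (x(n := t)) = poly (specialize x q) t"
proof -
  have "specialize (x(n := t)) q = specialize x q"
    using assms by (intro poly_eqI) (auto simp: coeff_specialize SP_def intro!: meval_cong[where n = n])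
  then show ?thesis by (simp add: meval_inM)
qed

lemma MP_0_const: "F \<in> MP 0 \<Longrightarrow> \<exists>c. F = MC c"
  by (induction rule: MP.induct) (auto simp flip: MC_simps)

lemma meval_eq_0: "F \<in> MP n \<Longrightarrow> (\<And>x. meval F x = 0) \<Longrightarrow> F = 0" for F :: "'k::field_char_0 mpoly"
proof (induction n arbitrary: F)
  case 0
  then obtain c where "F = MC c" using MP_0_const by blast
  then show ?case using 0(2)[of undefined] by (simp add: MC_simps)
next
  case (Suc n)
  obtain q where q: "q \<in> SP (MP n)" "F = inM n q" using MP_Suc_ex[OF Suc(2)] by blast
  have "specialize x q = 0" for x
  proof -
    have "poly (specialize x q) t = 0" for t using Suc(3)[of "x(n := t)"] q meval_inM_upd by metis
    then show ?thesis using poly_all_0_iff_0 by blast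
  qed
  then have "meval (coeff q i) x = 0" for i x using coeff_specialize[of x q i] by simp
  then have "coeff q i = 0" for i using Suc(1) q(1) by (auto simp: SP_def)
  then have "q = 0" by (simp add: poly_eq_iff)
  then show ?case using q by (simp add: inM_simps)
qed

lemma meval_nonzero: "F \<noteq> 0 \<Longrightarrow> \<exists>x. meval F x \<noteq> 0" for F :: "'k::field_char_0 mpoly"
  using meval_eq_0 MP_ex by blast

lemma inM_inj: assumes "p \<in> SP (MP n)" "q \<in> SP (MP n)" "inM n p = inM n (q :: 'k::field_char_0 mpoly poly)" shows "p = q"
proof -
  have *: "p - q \<in> SP (MP n)" using assms subringD(3)[OF subring_SP[OF subring_MP]] by blast
  have "inM n (p - q) = 0" using assms(3) by (simp add: inM_def)
  have "meval (coeff (p - q) i) x = 0" for i x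
  proof -
    have "poly (specialize x (p - q)) t = 0" for t
      using meval_inM_upd[OF *, of x t] \<open>inM n (p - q) = 0\<close> by simp
    then have "specialize x (p - q) = 0" using poly_all_0_iff_0 by blast
    then show ?thesis using coeff_specialize[of x "p - q" i] by simp
  qed
  then have "coeff (p - q) i = 0" for i using meval_eq_0[of "coeff (p - q) i" n] * by (auto simp: SP_def)
  then show ?thesis by (simp add: poly_eq_iff)
qed

lemma sirr_inM:
  fixes g :: "'k::field_char_0 mpoly poly"
  assumes g: "g \<in> SP (MP n)" and F: "sirr (MP (Suc n)) (inM n g)" shows "sirr (SP (MP n)) g"
proof -
  have u: "sunit (SP (MP n)) b" if b: "b \<in> SP (MP n)" and u: "sunit (MP (Suc n)) (inM n b)" for b :: "'k mpoly poly"
  proof -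
    obtain c where "c \<noteq> 0" "inM n b = MC c" using u sunit_MP is_unit_MC by metis
    moreover from this have "b = [:MC c:]"
      using inM_inj[OF b, of "[:MC c:]"] by (simp add: inM_simps SP_const[OF subring_MP] MP_C)
    ultimately show ?thesis using sunit_SP[OF subring_MP] sunit_MP is_unit_MC by blast
  qed
  show ?thesis unfolding sirr_def
  proof (intro conjI ballI impI)
    show "g \<in> SP (MP n)" by fact
    show "g \<noteq> 0" using F by (auto simp: sirr_def inM_simps)
    show "\<not> sunit (SP (MP n)) g"
    proof
      assume "sunit (SP (MP n)) g"
      then obtain c where "g = [:c:]" "sunit (MP n) c" using sunit_SP[OF subring_MP] by blast
      then have "sunit (MP (Suc n)) (inM n g)" by (simp add: inM_simps sunit_MP)
      then show False using F by (simp add: sirr_def)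
    qed
    fix b c assume bc: "b \<in> SP (MP n)" "c \<in> SP (MP n)" "g = b * c"
    then have "inM n g = inM n b * inM n c" "inM n b \<in> MP (Suc n)" "inM n c \<in> MP (Suc n)"
      by (auto simp: inM_simps inM_MP)
    then have "sunit (MP (Suc n)) (inM n b) \<or> sunit (MP (Suc n)) (inM n c)"
      using F unfolding sirr_def by blast
    then show "sunit (SP (MP n)) b \<or> sunit (SP (MP n)) c" using u bc by blast
  qed
qed

lemma sdvd_inM:
  fixes g :: "'k::field_char_0 mpoly poly"
  assumes "a \<in> SP (MP n)" "g \<in> SP (MP n)"
  shows "sdvd (MP (Suc n)) (inM n g) (inM n a) \<longleftrightarrow> sdvd (SP (MP n)) g a"
proof
  assume "sdvd (MP (Suc n)) (inM n g) (inM n a)"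
  then obtain c where "c \<in> MP (Suc n)" "inM n a = inM n g * c" by (auto simp: sdvd_def)
  then obtain q where q: "q \<in> SP (MP n)" "inM n a = inM n (g * q)" using MP_Suc_ex by (metis inM_simps(1))
  then have "a = g * q" using inM_inj assms subringD(4)[OF subring_SP[OF subring_MP]] by blast
  then show "sdvd (SP (MP n)) g a" using q by (auto simp: sdvd_def)
next
  assume "sdvd (SP (MP n)) g a"
  then obtain c where "c \<in> SP (MP n)" "a = g * c" by (auto simp: sdvd_def)
  then show "sdvd (MP (Suc n)) (inM n g) (inM n a)" using inM_MP[of c n] inM_simps(1) unfolding sdvd_def by metis
qed

lemma sirr_MP_prime: "sirr (MP n) F \<Longrightarrow> sprime (MP n) F" for F :: "'k::field_char_0 mpoly"
proof (induction n arbitrary: F)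
  case 0
  then obtain c where "F = MC c" using MP_0_const[of F] 0 unfolding sirr_def by blast
  then show ?case using 0 by (auto simp: sirr_def sunit_MP is_unit_MC MC_simps)
next
  case (Suc n)
  obtain g where g: "g \<in> SP (MP n)" "F = inM n g" using MP_Suc_ex[of F n] Suc(2) unfolding sirr_def by blast
  have p: "sprime (SP (MP n)) g"
    using sirr_SP_prime[OF subring_MP size_fun_MP Suc(1) sirr_inM[OF g(1)]] Suc(2) g(2) by blast
  show ?case unfolding sprime_def
  proof (intro conjI ballI impI)
    show "F \<in> MP (Suc n)" "F \<noteq> 0" "\<not> sunit (MP (Suc n)) F" using Suc(2) by (auto simp: sirr_def)
    fix A B assume AB: "A \<in> MP (Suc n)" "B \<in> MP (Suc n)" "sdvd (MP (Suc n)) F (A * B)"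
    obtain a where a: "a \<in> SP (MP n)" "A = inM n a" using MP_Suc_ex[OF AB(1)] by blast
    obtain b where b: "b \<in> SP (MP n)" "B = inM n b" using MP_Suc_ex[OF AB(2)] by blast
    have "sdvd (SP (MP n)) g (a * b)"
      using AB(3) sdvd_inM[OF subringD(4)[OF subring_SP[OF subring_MP] a(1) b(1)] g(1)]
      by (simp add: a b g inM_simps)
    then show "sdvd (MP (Suc n)) F A \<or> sdvd (MP (Suc n)) F B"
      using p a b g sdvd_inM unfolding sprime_def by metis
  qed
qed

lemma irreducible_sirr:
  fixes F :: "'k::field_char_0 mpoly"
  assumes "irreducible F" "F \<in> MP n" shows "sirr (MP n) F"
  using assms unfolding sirr_def irreducible_def by (auto simp: sunit_MP)

lemma irreducible_prime: fixes F :: "'k::field_char_0 mpoly" assumes "irreducible F" shows "prime_elem F"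
proof (rule prime_elemI)
  show "F \<noteq> 0" "\<not> F dvd 1" using assms by (auto simp: irreducible_def)
  fix A B assume "F dvd A * B"
  then obtain K where K: "A * B = F * K" by blast
  obtain a where a: "F \<in> MP a" using MP_ex by blast
  obtain b where b: "A \<in> MP b" using MP_ex by blast
  obtain c where c: "B \<in> MP c" using MP_ex by blast
  obtain d where d: "K \<in> MP d" using MP_ex by blast
  define n where "n = a + b + c + d"
  have m: "F \<in> MP n" "A \<in> MP n" "B \<in> MP n" "K \<in> MP n"
    using MP_mono[OF a, of n] MP_mono[OF b, of n] MP_mono[OF c, of n] MP_mono[OF d, of n] by (auto simp: n_def)
  have "sprime (MP n) F" by (rule sirr_MP_prime[OF irreducible_sirr[OF assms m(1)]])
  moreover have "sdvd (MP n) F (A * B)" using m K by (auto simp: sdvd_def)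
  ultimately have "sdvd (MP n) F A \<or> sdvd (MP n) F B" using m by (auto simp: sprime_def)
  then show "F dvd A \<or> F dvd B" by (auto simp: sdvd_def)
qed

lemma vanishing_imp_dvd:
  fixes F :: "'k::field_char_0 mpoly"
  assumes ac: "alg_closed_field TYPE('k)" and F: "irreducible F" and van: "\<And>x. meval F x = 0 \<Longrightarrow> meval A x = 0"
  shows "F dvd A"
proof -
  define m where "m = (LEAST m. F \<in> MP m)"
  have Fm: "F \<in> MP m" unfolding m_def by (rule LeastI_ex[OF MP_ex])
  have least: "F \<notin> MP k" if "k < m" for k using that not_less_Least unfolding m_def by blast
  have "m \<noteq> 0"
  proof
    assume "m = 0"
    then obtain c where "F = MC c" using Fm MP_0_const by blast
    then show False using F is_unit_MC unfolding irreducible_def by (metis MC_simps(1))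
  qed
  then obtain k where k: "m = Suc k" by (cases m) auto
  obtain g where g: "g \<in> SP (MP k)" "F = inM k g" using MP_Suc_ex Fm k by blast
  have dg: "degree g > 0"
  proof (rule ccontr)
    assume "\<not> degree g > 0"
    then obtain c where "g = [:c:]" by (metis degree_0_id gr0I)
    then show False using g least[of k] k by (auto simp: inM_simps SP_const[OF subring_MP])
  qed
  have irr: "sirr (SP (MP k)) g" using sirr_inM[OF g(1)] irreducible_sirr[OF F Fm] k g by simp
  have "A \<in> MP (m + j) \<Longrightarrow> (\<And>x. meval F x = 0 \<Longrightarrow> meval A x = 0) \<Longrightarrow> F dvd A" for j A
  proof (induction j arbitrary: A)
    case 0
    obtain a where a: "a \<in> SP (MP k)" "A = inM k a" using MP_Suc_ex 0(1) k by auto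
    show ?case
    proof (rule ccontr)
      assume "\<not> F dvd A"
      then have "\<not> sdvd (SP (MP k)) g a" using a g by (auto simp: sdvd_def inM_simps)
      then obtain u v h where h: "u \<in> SP (MP k)" "v \<in> SP (MP k)" "h \<in> MP k" "h \<noteq> 0" "u * g + v * a = [:h:]"
        using sirr_elimination[OF subring_MP sPF_exists[OF subring_MP size_fun_MP sirr_MP_prime] irr dg a(1)] by blast
      have "h * lead_coeff g \<noteq> 0" using h dg by auto
      then obtain x where "meval (h * lead_coeff g) x \<noteq> 0" using meval_nonzero by blast
      then have x: "meval h x \<noteq> 0" "meval (lead_coeff g) x \<noteq> 0" by auto
      have "degree (specialize x g) \<ge> degree g" using x by (intro le_degree) (simp add: coeff_specialize)
      then obtain t where t: "poly (specialize x g) t = 0" using ac dg unfolding alg_closed_field_def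
        by fastforce
      define y where "y = x(k := t)"
      have "meval F y = 0" unfolding y_def using meval_inM_upd[OF g(1)] t g by simp
      moreover from this have "meval A y = 0" by (rule 0(2))
      moreover have "inM k u * F + inM k v * A = h"
        using arg_cong[OF h(5), of "inM k"] by (simp add: inM_simps g a)
      ultimately have "meval h y = 0" by (metis add.right_neutral meval_simps(1,2) mult_zero_right)
      moreover have "meval h y = meval h x" using h(3) by (rule meval_cong) (simp add: y_def)
      ultimately show False using x by simp
    qed
  next
    case (Suc j)
    obtain a where a: "a \<in> SP (MP (m + j))" "A = inM (m + j) a" using MP_Suc_ex Suc(2) by auto
    have "F dvd coeff a i" for i
    proof (rule Suc(1))
      show "coeff a i \<in> MP (m + j)" using a by (auto simp: SP_def)
      fix x assume x: "meval F x = 0"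
      have "poly (specialize x a) t = 0" for t
      proof -
        have "meval F (x(m + j := t)) = 0" using meval_cong[OF Fm, of "x(m + j := t)" x] x by simp
        then have "meval A (x(m + j := t)) = 0" by (rule Suc(3))
        then show ?thesis using meval_inM_upd[OF a(1)] a by simp
      qed
      then have "specialize x a = 0" using poly_all_0_iff_0 by blast
      then show "meval (coeff a i) x = 0" using coeff_specialize[of x a i] by simp
    qed
    then show ?case unfolding a inM_def poly_altdef by (intro dvd_sum dvd_mult2) auto
  qed
  moreover obtain b where "A \<in> MP b" using MP_ex by blast
  then have "A \<in> MP (m + b)" by (rule MP_mono) simp
  ultimately show ?thesis using van by blast
qed

lemma irreducible_factor_at_point:
  fixes A :: "'k::field_char_0 mpoly"
  shows "A \<noteq> 0 \<Longrightarrow> meval A a = 0 \<Longrightarrow> \<exists>q. irreducible q \<and> q dvd A \<and> meval q a = 0"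
proof (induction "tdeg A" arbitrary: A rule: less_induct)
  case less
  have nu: "\<not> B dvd 1" if "meval B a = 0" for B using that by (auto simp: is_unit_MC)
  show ?case
  proof (cases "irreducible A")
    case True then show ?thesis using less(2,3) by (intro exI[of _ A]) simp
  next
    case False
    then obtain B C where BC: "A = B * C" "\<not> B dvd 1" "\<not> C dvd 1"
      using less nu[of A] unfolding irreducible_def by blast
    have nz: "B \<noteq> 0" "C \<noteq> 0" using BC less by auto
    have "tdeg B \<noteq> 0" "tdeg C \<noteq> 0" using BC nz tdeg_0 is_unit_MC by (metis MC_simps(1))+
    then have t: "tdeg B < tdeg A" "tdeg C < tdeg A" using tdeg_mult[OF nz] BC by auto
    have "meval B a = 0 \<or> meval C a = 0" using less BC by auto
    then show ?thesis using less(1)[OF t(1) nz(1)] less(1)[OF t(2) nz(2)] BC by (metis dvd_mult dvd_mult2)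
  qed
qed

lemma irreducible_dvd_of_vanishing:
  fixes F :: "'k::field_char_0 mpoly"
  assumes ac: "alg_closed_field TYPE('k)" and F: "irreducible F" and Q: "Q \<noteq> 0" "meval Q a = 0" "meval z a \<noteq> 0"
    and van: "\<And>x. meval Q x = 0 \<Longrightarrow> meval z x \<noteq> 0 \<Longrightarrow> meval F x = 0"
  shows "F dvd Q"
proof -
  obtain q where q: "irreducible q" "q dvd Q" "meval q a = 0" using irreducible_factor_at_point[OF Q(1,2)] by blast
  have "q dvd z * F"
  proof (rule vanishing_imp_dvd[OF ac q(1)])
    fix x assume "meval q x = 0"
    then have "meval Q x = 0" using q(2) by (auto elim!: dvdE)
    then show "meval (z * F) x = 0" using van by auto
  qed
  moreover have "\<not> q dvd z" using q(3) Q(3) by (auto elim!: dvdE)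
  ultimately have "q dvd F" using irreducible_prime[OF q(1)] by (auto simp: prime_elem_dvd_mult_iff)
  then obtain r where r: "F = q * r" by blast
  then have "r dvd 1" using F q(1) unfolding irreducible_def by blast
  then obtain s where "1 = r * s" by blast
  then have "q = F * s" using r by (simp add: mult.assoc)
  then have "F dvd q" by simp
  then show ?thesis using q(2) dvd_trans by blast
qed

section \<open>Linear algebra with coordinate vectors\<close>

lemma homogeneous_system:
  fixes a :: "'r \<Rightarrow> 'i \<Rightarrow> 'k::field"
  assumes "finite R" "finite I" "card R < card I"
  shows "\<exists>x. (\<exists>i\<in>I. x i \<noteq> 0) \<and> (\<forall>i. i \<notin> I \<longrightarrow> x i = 0) \<and> (\<forall>r\<in>R. (\<Sum>i\<in>I. a r i * x i) = 0)"
  using assms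
proof (induction R arbitrary: I a rule: finite_induct)
  case empty
  then obtain k where "k \<in> I" by fastforce
  then show ?case by (intro exI[of _ "\<lambda>i. if i = k then 1 else 0"]) auto
next
  case (insert m R)
  show ?case
  proof (cases "\<forall>i\<in>I. a m i = 0")
    case True
    have "card R < card I" using insert by simp
    then obtain x where x: "\<exists>i\<in>I. x i \<noteq> 0" "\<forall>i. i \<notin> I \<longrightarrow> x i = 0" "\<forall>r\<in>R. (\<Sum>i\<in>I. a r i * x i) = 0"
      using insert(3)[OF insert(4), of a] by blast
    have "(\<Sum>i\<in>I. a m i * x i) = 0" using True by (intro sum.neutral) auto
    then show ?thesis using x by blast
  next
    case False
    then obtain k where k: "k \<in> I" "a m k \<noteq> 0" by blast
    have "card R < card (I - {k})" using insert k by simp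
    from insert(3)[OF _ this, of "\<lambda>r i. a r i - a r k * a m i / a m k"] insert(4) obtain x where
      x: "\<exists>i\<in>I-{k}. x i \<noteq> 0" "\<And>i. i \<notin> I - {k} \<Longrightarrow> x i = 0"
        "\<And>r. r \<in> R \<Longrightarrow> (\<Sum>i\<in>I-{k}. (a r i - a r k * a m i / a m k) * x i) = 0" by auto
    define s where "s = (\<Sum>i\<in>I-{k}. a m i * x i)"
    define y where "y = x(k := - s / a m k)"
    have sum: "(\<Sum>i\<in>I. b i * y i) = b k * (- s / a m k) + (\<Sum>i\<in>I-{k}. b i * x i)" for b
      using k insert(4) by (subst sum.remove[of I k]) (auto simp: y_def intro!: sum.cong)
    have "(\<Sum>i\<in>I. a r i * y i) = 0" if "r \<in> insert m R" for r
    proof (cases "r = m")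
      case True then show ?thesis using k by (simp add: sum s_def)
    next
      case False
      then have "(\<Sum>i\<in>I-{k}. (a r i - a r k * a m i / a m k) * x i) = 0" using that x by blast
      moreover have "(\<Sum>i\<in>I-{k}. (a r i - a r k * a m i / a m k) * x i) = (\<Sum>i\<in>I-{k}. a r i * x i) - a r k / a m k * s"
        unfolding s_def by (simp add: algebra_simps sum_subtractf sum_distrib_left sum_divide_distrib)
      ultimately show ?thesis by (simp add: sum)
    qed
    moreover have "\<exists>i\<in>I. y i \<noteq> 0" using x(1) by (auto simp: y_def)
    moreover have "y i = 0" if "i \<notin> I" for i using that x(2)[of i] k by (auto simp: y_def)
    ultimately show ?thesis by blast
  qed
qed

definition vadd :: "(nat \<Rightarrow> 'k::comm_ring_1) \<Rightarrow> (nat \<Rightarrow> 'k) \<Rightarrow> nat \<Rightarrow> 'k" (infixl "\<oplus>" 65) where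
  "u \<oplus> v = (\<lambda>i. u i + v i)"

definition smul :: "'k::comm_ring_1 \<Rightarrow> (nat \<Rightarrow> 'k) \<Rightarrow> nat \<Rightarrow> 'k" (infixr "\<odot>" 75) where
  "c \<odot> v = (\<lambda>i. c * v i)"

lemma vapp [simp]: "(u \<oplus> v) i = u i + v i" "(c \<odot> v) i = c * v i"
  by (auto simp: vadd_def smul_def)

lemma vec_in_simps [simp]: "vec_in n u \<Longrightarrow> vec_in n v \<Longrightarrow> vec_in n (u \<oplus> v)" "vec_in n v \<Longrightarrow> vec_in n (c \<odot> v)"
  by (auto simp: vec_in_def)

lemma lin_form_simps [simp]:
  "lin_form n a (u \<oplus> v) = lin_form n a u + lin_form n a v" "lin_form n a (c \<odot> v) = c * lin_form n a v"
  by (auto simp: lin_form_def algebra_simps sum.distrib sum_distrib_left)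

lemma lin_form_sum: "lin_form n f (\<lambda>r. \<Sum>k\<in>K. s k * g k r) = (\<Sum>k\<in>K. s k * lin_form n f (g k))"
proof -
  have "lin_form n f (\<lambda>r. \<Sum>k\<in>K. s k * g k r) = (\<Sum>i\<le>n. \<Sum>k\<in>K. f i * (s k * g k i))"
    unfolding lin_form_def sum_distrib_left ..
  also have "\<dots> = (\<Sum>k\<in>K. \<Sum>i\<le>n. f i * (s k * g k i))" by (rule sum.swap)
  also have "\<dots> = (\<Sum>k\<in>K. s k * lin_form n f (g k))"
    unfolding lin_form_def sum_distrib_left by (simp add: mult.left_commute)
  finally show ?thesis .
qed

definition unitv :: "nat \<Rightarrow> nat \<Rightarrow> 'k::comm_ring_1" where "unitv j = (\<lambda>i. if i = j then 1 else 0)"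

lemma vec_in_unitv: "j \<le> n \<Longrightarrow> vec_in n (unitv j)" by (auto simp: vec_in_def unitv_def)

lemma lin_form_unitv: "j \<le> n \<Longrightarrow> lin_form n a (unitv j) = a j"
  by (simp add: lin_form_def unitv_def if_distrib cong: if_cong)

lemma exists_form_vanishing:
  fixes u :: "'r \<Rightarrow> nat \<Rightarrow> 'k::field"
  assumes "finite R" "card R < n"
  shows "\<exists>c. c j = 0 \<and> (\<exists>i\<le>n. c i \<noteq> 0) \<and> (\<forall>r\<in>R. lin_form n c (u r) = 0)"
proof -
  have "card (Some ` R \<union> {None}) < card {..n}"
    using assms by (simp add: card_image)
  from homogeneous_system[OF _ _ this, of "\<lambda>r. case r of Some r \<Rightarrow> u r | None \<Rightarrow> unitv j"] assms(1)
  obtain c where "(\<exists>i\<in>{..n}. c i \<noteq> 0) \<and> (\<forall>i. i \<notin> {..n} \<longrightarrow> c i = 0) \<and> (\<forall>r\<in>Some ` R \<union> {None}.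
      (\<Sum>i\<le>n. (case r of Some r \<Rightarrow> u r | None \<Rightarrow> unitv j) i * c i) = 0)" by auto
  then have c: "\<exists>i\<le>n. c i \<noteq> 0" "\<And>i. i > n \<Longrightarrow> c i = 0"
    "\<And>r. r \<in> R \<Longrightarrow> (\<Sum>i\<le>n. u r i * c i) = 0" "(\<Sum>i\<le>n. unitv j i * c i) = 0" for i r by auto
  have "c j = 0"
  proof (cases "j \<le> n")
    case True
    have "lin_form n c (unitv j) = 0" using c(4) by (simp add: lin_form_def mult.commute)
    then show ?thesis using lin_form_unitv[OF True, of c] by simp
  qed (use c in auto)
  moreover have "\<forall>r\<in>R. lin_form n c (u r) = 0" using c(3) by (auto simp: lin_form_def mult.commute)
  ultimately show ?thesis using c(1) by blast
qed

lemma span_of_three_forms: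
  fixes m :: "nat \<Rightarrow> nat \<Rightarrow> 'k::field"
  assumes n: "n \<ge> 3" and m: "lin_frame n (n - 3) m"
    and w: "w j \<noteq> 0" and c: "c j = 0" "c i \<noteq> 0" and mu: "\<mu> j = 0" "\<mu> i = 0" "\<mu> h \<noteq> 0"
    and le: "i \<le> n" "j \<le> n" "h \<le> n"
    and van: "\<And>l. l \<le> n - 3 \<Longrightarrow> lin_form n w (m l) = 0 \<and> lin_form n c (m l) = 0 \<and> lin_form n \<mu> (m l) = 0"
    and x: "vec_in n x" "lin_form n w x = 0" "lin_form n c x = 0" "lin_form n \<mu> x = 0"
  shows "in_span (n - 3) m x"
proof -
  have ne: "i \<noteq> j" "h \<noteq> j" "h \<noteq> i" using w c mu by auto
  define u where "u l = (if l = n - 2 then x else m l)" for l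
  have "card ({..n} - {i,j,h}) = n - 2" using le ne by (subst card_Diff_subset) auto
  then have "card ({..n} - {i,j,h}) < card {..n - 2}" by simp
  from homogeneous_system[OF _ _ this, of "\<lambda>r l. u l r"] obtain s where
    s: "\<exists>l\<le>n-2. s l \<noteq> 0" "\<And>r. r \<in> {..n} - {i,j,h} \<Longrightarrow> (\<Sum>l\<le>n-2. u l r * s l) = 0" by auto
  define y where "y r = (\<Sum>l\<le>n-2. u l r * s l)" for r
  have lf: "lin_form n a y = 0" if "\<And>l. l \<le> n - 3 \<Longrightarrow> lin_form n a (m l) = 0" "lin_form n a x = 0" for a
  proof -
    have "lin_form n a y = (\<Sum>l\<le>n-2. s l * lin_form n a (u l))"
    proof -
      have "y = (\<lambda>r. \<Sum>k\<le>n-2. s k * u k r)" by (simp add: fun_eq_iff y_def mult.commute)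
      then show ?thesis using lin_form_sum[of n a s u "{..n-2}"] by simp
    qed
    also have "\<dots> = 0" using that by (intro sum.neutral) (auto simp: u_def)
    finally show ?thesis .
  qed
  have y0: "y r = 0" if "r \<le> n" "r \<noteq> i" "r \<noteq> j" "r \<noteq> h" for r using s(2)[of r] that by (simp add: y_def)
  have sub: "lin_form n a y = (\<Sum>r\<in>{i,j,h}. a r * y r)" for a
    unfolding lin_form_def using le y0 by (intro sum.mono_neutral_right) auto
  have "lin_form n \<mu> y = 0" by (rule lf) (use van x in auto)
  then have yh: "y h = 0" using ne mu by (simp add: sub)
  have "lin_form n c y = 0" by (rule lf) (use van x in auto)
  then have yi: "y i = 0" using ne c yh by (simp add: sub)
  have "lin_form n w y = 0" by (rule lf) (use van x in auto)
  then have yj: "y j = 0" using ne w yh yi by (simp add: sub)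
  have yy: "y r = 0" for r
  proof (cases "r \<le> n")
    case True then show ?thesis using y0 yh yi yj by blast
  next
    case False
    then have "u l r = 0" if "l \<le> n - 2" for l
      using that m x(1) by (cases "l = n - 2") (auto simp: u_def lin_frame_def vec_in_def)
    then show ?thesis by (simp add: y_def)
  qed
  have split: "y r = (\<Sum>l\<le>n-3. m l r * s l) + x r * s (n - 2)" for r
  proof -
    have "{..n-2} = insert (n - 2) {..n-3}" using n by auto
    moreover have "(\<Sum>l\<le>n-3. u l r * s l) = (\<Sum>l\<le>n-3. m l r * s l)" using n by (intro sum.cong) (auto simp: u_def)
    ultimately show ?thesis unfolding y_def using n by (simp add: u_def)
  qed
  have s0: "s (n - 2) \<noteq> 0"
  proof
    assume z: "s (n - 2) = 0"
    have "lincomb (n - 3) s m = (\<lambda>_. 0)" using split yy z by (auto simp: lincomb_def mult.commute)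
    then have "\<forall>l\<le>n-3. s l = 0" using m by (auto simp: lin_frame_def)
    moreover have "l \<le> n - 3 \<or> l = n - 2" if "l \<le> n - 2" for l using that n by auto
    ultimately show False using s(1) z by metis
  qed
  have "x r = (\<Sum>l\<le>n-3. (- s l / s (n - 2)) * m l r)" for r
  proof -
    have "x r * s (n - 2) = - (\<Sum>l\<le>n-3. m l r * s l)" using split[of r] yy[of r] by (simp add: eq_neg_iff_add_eq_0 add.commute)
    then have "x r = - (\<Sum>l\<le>n-3. m l r * s l) / s (n - 2)" using s0 by (simp add: field_simps)
    then show ?thesis by (simp add: sum_negf sum_divide_distrib mult.commute)
  qed
  then have "x = lincomb (n - 3) (\<lambda>l. - s l / s (n - 2)) m" by (simp add: lincomb_def fun_eq_iff)
  then show ?thesis unfolding in_span_def by blast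
qed

lemma frame_of_two_forms:
  fixes a b :: "nat \<Rightarrow> 'k::field"
  assumes n: "n \<ge> 2" and ij: "i \<le> n" "j \<le> n" "i \<noteq> j" and a: "a i = 1" "a j = 0" and b: "b i = 0" "b j = 1"
  shows "\<exists>v. lin_frame n (n - 2) v \<and>
    (\<forall>q. in_span (n - 2) v q \<longleftrightarrow> vec_in n q \<and> lin_form n a q = 0 \<and> lin_form n b q = 0)"
proof -
  have "card ({..n} - {i,j}) = card {..n-2}" using ij n by (subst card_Diff_subset) auto
  then obtain e where e: "bij_betw e {..n-2} ({..n} - {i,j})"
    by (metis finite_atMost finite_Diff finite_same_card_bij)
  define v where "v l = unitv (e l) \<oplus> (- a (e l)) \<odot> unitv i \<oplus> (- b (e l)) \<odot> unitv j" for l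
  have el: "e l \<le> n" "e l \<noteq> i" "e l \<noteq> j" if "l \<le> n - 2" for l
    using bij_betwE[OF e] that by auto
  have vin: "vec_in n (v l)" if "l \<le> n - 2" for l
    unfolding v_def using el[OF that] ij by (simp add: vec_in_unitv)
  have va: "lin_form n a (v l) = 0" "lin_form n b (v l) = 0" if "l \<le> n - 2" for l
    unfolding v_def using el[OF that] ij a b by (simp_all add: lin_form_unitv)
  have coord: "lincomb (n - 2) c v (e l) = c l" if "l \<le> n - 2" for c l
  proof -
    have "c k * v k (e l) = (if k = l then c k else 0)" if "k \<le> n - 2" for k
    proof -
      have "e k = e l \<longleftrightarrow> k = l" using e that \<open>l \<le> n - 2\<close> by (auto simp: bij_betw_def inj_on_def)
      then show ?thesis using el[OF \<open>l \<le> n - 2\<close>] by (auto simp: v_def unitv_def)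
    qed
    then have "lincomb (n - 2) c v (e l) = (\<Sum>k\<le>n-2. if k = l then c k else 0)" by (simp add: lincomb_def)
    then show ?thesis using that by simp
  qed
  have lin: "lin_form n f (lincomb (n - 2) c v) = (\<Sum>k\<le>n-2. c k * lin_form n f (v k))" for f c
    using lin_form_sum[of n f c v "{..n-2}"] by (simp add: lincomb_def)
  have fr: "lin_frame n (n - 2) v"
    unfolding lin_frame_def
  proof (intro conjI allI impI)
    fix c k assume "lincomb (n - 2) c v = (\<lambda>_. 0)" "k \<le> n - 2"
    then show "c k = 0" using coord[of k c] by simp
  qed (use vin in auto)
  have "in_span (n - 2) v q \<longleftrightarrow> vec_in n q \<and> lin_form n a q = 0 \<and> lin_form n b q = 0" for q
  proof
    assume "in_span (n - 2) v q"
    then obtain c where q: "q = lincomb (n - 2) c v" by (auto simp: in_span_def)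
    have "vec_in n q" unfolding q lincomb_def vec_in_def using vin by (auto simp: vec_in_def)
    then show "vec_in n q \<and> lin_form n a q = 0 \<and> lin_form n b q = 0" using va by (auto simp: q lin)
  next
    assume q: "vec_in n q \<and> lin_form n a q = 0 \<and> lin_form n b q = 0"
    define c where "c l = q (e l)" for l
    define y where "y = q \<oplus> (-1) \<odot> lincomb (n - 2) c v"
    have y0: "y r = 0" if r: "r \<le> n" "r \<noteq> i" "r \<noteq> j" for r
    proof -
      have "r \<in> e ` {..n-2}" using e r by (auto simp: bij_betw_def)
      then obtain l where "l \<le> n - 2" "r = e l" by auto
      then show ?thesis using coord[of l c] by (simp add: y_def c_def)
    qed
    have sub: "lin_form n f y = (\<Sum>r\<in>{i,j}. f r * y r)" for f
      unfolding lin_form_def using ij y0 by (intro sum.mono_neutral_right) auto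
    have "lin_form n a y = 0" "lin_form n b y = 0" using q va by (simp_all add: y_def lin)
    then have "y i = 0" "y j = 0" using ij a b by (simp_all add: sub)
    moreover have "y r = 0" if "r > n" for r
      using that q vin by (auto simp: y_def lincomb_def vec_in_def intro!: sum.neutral)
    ultimately have "y r = 0" for r using y0 by (metis not_le)
    then have "q r = lincomb (n - 2) c v r" for r by (simp add: y_def)
    then have "q = lincomb (n - 2) c v" by (rule ext)
    then show "in_span (n - 2) v q" unfolding in_span_def by blast
  qed
  then show ?thesis using fr by blast
qed

section \<open>Polar forms of a hypersurface\<close>

locale hform =
  fixes F :: "'k::field_char_0 mpoly" and n d :: nat
  assumes FM: "F \<in> MP (Suc n)" and hom: "\<And>c x. meval F (c \<odot> x) = c ^ d * meval F x" and d2: "d \<ge> 2"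
begin

definition gr :: "(nat \<Rightarrow> 'k) \<Rightarrow> nat \<Rightarrow> 'k" where "gr p i = meval (pd i F) p"

definition D1 :: "(nat \<Rightarrow> 'k) \<Rightarrow> (nat \<Rightarrow> 'k) \<Rightarrow> 'k" where "D1 p v = lin_form n (gr p) v"

definition D2 :: "(nat \<Rightarrow> 'k) \<Rightarrow> (nat \<Rightarrow> 'k) \<Rightarrow> (nat \<Rightarrow> 'k) \<Rightarrow> 'k" where
  "D2 p u v = (\<Sum>i\<le>n. \<Sum>j\<le>n. meval (pd j (pd i F)) p * u i * v j)"

lemma D1_simps [simp]: "D1 p (u \<oplus> v) = D1 p u + D1 p v" "D1 p (c \<odot> v) = c * D1 p v"
  by (auto simp: D1_def)

lemma D2_sym: "D2 p u v = D2 p v u"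
  unfolding D2_def by (subst sum.swap) (simp add: pd_commute ac_simps)

lemma D2_simps [simp]: "D2 p (u \<oplus> v) w = D2 p u w + D2 p v w" "D2 p (c \<odot> v) w = c * D2 p v w"
  "D2 p w (u \<oplus> v) = D2 p w u + D2 p w v" "D2 p w (c \<odot> v) = c * D2 p w v"
proof -
  show 1: "D2 p (u \<oplus> v) w = D2 p u w + D2 p v w" "D2 p (c \<odot> v) w = c * D2 p v w" for c u v w
    by (auto simp: D2_def algebra_simps sum.distrib sum_distrib_left)
  show "D2 p w (u \<oplus> v) = D2 p w u + D2 p w v" "D2 p w (c \<odot> v) = c * D2 p w v"
    using 1(1)[of u v w] 1(2)[of c v w] D2_sym[of p] by metis+
qed

definition D1P :: "(nat \<Rightarrow> 'k poly) \<Rightarrow> (nat \<Rightarrow> 'k) \<Rightarrow> 'k poly" where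
  "D1P c v = (\<Sum>i\<le>n. evP (pd i F) c * [:v i:])"

lemma poly_D1P: "poly (D1P c v) t = D1 (\<lambda>i. poly (c i) t) v"
  by (simp add: D1P_def poly_sum poly_evP D1_def lin_form_def gr_def mult.commute)

definition line :: "(nat \<Rightarrow> 'k) \<Rightarrow> (nat \<Rightarrow> 'k) \<Rightarrow> nat \<Rightarrow> 'k poly" where "line p u i = [:p i, u i:]"

definition curve :: "(nat \<Rightarrow> 'k) \<Rightarrow> (nat \<Rightarrow> 'k) \<Rightarrow> (nat \<Rightarrow> 'k) \<Rightarrow> nat \<Rightarrow> 'k poly" where
  "curve p u v i = [:p i, u i, v i:]"

lemma poly_line: "(\<lambda>i. poly (line p u i) t) = p \<oplus> t \<odot> u"
  by (auto simp: line_def fun_eq_iff)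

lemma poly_curve: "(\<lambda>i. poly (curve p u v i) t) = p \<oplus> t \<odot> u \<oplus> t\<^sup>2 \<odot> v"
  by (auto simp: curve_def fun_eq_iff power2_eq_square algebra_simps)

lemma poly_eq_0I: "(\<And>t. t \<noteq> a \<Longrightarrow> poly p t = 0) \<Longrightarrow> p = (0::'k poly)"
proof (rule ccontr)
  assume *: "\<And>t. t \<noteq> a \<Longrightarrow> poly p t = 0" "p \<noteq> 0"
  then have "finite {t. poly p t = 0}" by (simp add: poly_roots_finite)
  moreover have "UNIV \<subseteq> insert a {t. poly p t = 0}" using * by auto
  ultimately show False using infinite_UNIV_char_0[where 'a = 'k] by (meson finite.insertI finite_subset)
qed

lemma poly_eqI_except: "(\<And>t. t \<noteq> a \<Longrightarrow> poly p t = poly q t) \<Longrightarrow> p = (q::'k poly)"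
  using poly_eq_0I[of a "p - q"] by simp

lemma evP_const: "evP G (\<lambda>i. [:(p :: nat \<Rightarrow> 'k) i:]) = [:meval G p:]"
  by (rule poly_eqI_except) (simp add: poly_evP)

lemma curve_taylor:
  assumes "G \<in> MP (Suc n)"
  shows "\<exists>R. evP G (curve p u v) = [:meval G p, (\<Sum>i\<le>n. meval (pd i G) p * u i),
     (\<Sum>i\<le>n. meval (pd i G) p * v i) + (\<Sum>i\<le>n. \<Sum>j\<le>n. meval (pd j (pd i G)) p * u i * u j) / 2:] + [:0,1:]^3 * R"
proof -
  have c: "curve p u v = (\<lambda>i. [:p i:] + [:0,1:] * [:u i:] + [:0,1:]\<^sup>2 * [:v i:])"
    by (auto simp: curve_def fun_eq_iff power2_eq_square)
  obtain R where R: "evP G (curve p u v) = evP G (\<lambda>i. [:p i:]) + [:0,1:] * (\<Sum>i<Suc n. evP (pd i G) (\<lambda>i. [:p i:]) * [:u i:])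
     + [:0,1:]\<^sup>2 * ((\<Sum>i<Suc n. evP (pd i G) (\<lambda>i. [:p i:]) * [:v i:]) +
        smult (1/2) (\<Sum>i<Suc n. \<Sum>j<Suc n. evP (pd j (pd i G)) (\<lambda>i. [:p i:]) * [:u i:] * [:u j:])) + [:0,1:] ^ 3 * R"
    unfolding c using taylor2[OF assms, of "\<lambda>i. [:p i:]" "[:0,1:]" "\<lambda>i. [:u i:]" "\<lambda>i. [:v i:]"] by blast
  have s: "(\<Sum>i\<in>A. [:f i:]) = [:sum f A:]" for f :: "nat \<Rightarrow> 'k" and A
    by (induction A rule: infinite_finite_induct) auto
  show ?thesis unfolding R evP_const lessThan_Suc_atMost
    by (intro exI[of _ R]) (simp add: s power2_eq_square mult.commute mult.left_commute)
qed

lemma coeff_X3: "coeff ([:0,1:]^3 * R) 0 = 0" "coeff ([:0,1:]^3 * R) 1 = 0" "coeff ([:0,1:]^3 * R) 2 = (0::'k)"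
  by (simp_all add: power3_eq_cube numeral_2_eq_2)

lemma coeff_curve_general:
  assumes "G \<in> MP (Suc n)"
  shows "coeff (evP G (curve p u v)) 0 = meval G p" "coeff (evP G (curve p u v)) 1 = (\<Sum>i\<le>n. meval (pd i G) p * u i)"
  "coeff (evP G (curve p u v)) 2 = (\<Sum>i\<le>n. meval (pd i G) p * v i) + (\<Sum>i\<le>n. \<Sum>j\<le>n. meval (pd j (pd i G)) p * u i * u j) / 2"
proof -
  obtain R where R: "evP G (curve p u v) = [:meval G p, (\<Sum>i\<le>n. meval (pd i G) p * u i),
     (\<Sum>i\<le>n. meval (pd i G) p * v i) + (\<Sum>i\<le>n. \<Sum>j\<le>n. meval (pd j (pd i G)) p * u i * u j) / 2:] + [:0,1:]^3 * R"
    using curve_taylor[OF assms, of p u v] by blast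
  show "coeff (evP G (curve p u v)) 0 = meval G p" "coeff (evP G (curve p u v)) 1 = (\<Sum>i\<le>n. meval (pd i G) p * u i)"
  "coeff (evP G (curve p u v)) 2 = (\<Sum>i\<le>n. meval (pd i G) p * v i) + (\<Sum>i\<le>n. \<Sum>j\<le>n. meval (pd j (pd i G)) p * u i * u j) / 2"
    unfolding R coeff_add coeff_X3 by (simp_all add: numeral_2_eq_2)
qed

lemma coeff_curve:
  "coeff (evP F (curve p u v)) 0 = meval F p" "coeff (evP F (curve p u v)) 1 = D1 p u"
  "coeff (evP F (curve p u v)) 2 = D1 p v + D2 p u u / 2"
  using coeff_curve_general[OF FM, of p u v] by (auto simp: D1_def lin_form_def gr_def D2_def)

lemma line_curve: "line p u = curve p u (\<lambda>_. 0)"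
  by (auto simp: line_def curve_def)

lemma D1_zero [simp]: "D1 p (\<lambda>_. 0) = 0" by (simp add: D1_def lin_form_def)

lemma coeff_line:
  "coeff (evP F (line p u)) 0 = meval F p" "coeff (evP F (line p u)) 1 = D1 p u"
  "coeff (evP F (line p u)) 2 = D2 p u u / 2"
  unfolding line_curve coeff_curve by auto

definition K2 :: "(nat \<Rightarrow> 'k) \<Rightarrow> (nat \<Rightarrow> 'k) \<Rightarrow> (nat \<Rightarrow> 'k) \<Rightarrow> (nat \<Rightarrow> 'k) \<Rightarrow> 'k" where
  "K2 p v a b = (\<Sum>l\<le>n. v l * ((\<Sum>i\<le>n. \<Sum>j\<le>n. meval (pd j (pd i (pd l F))) p * a i * b j) / 2))"

lemma coeff_D1P:
  "coeff (D1P (curve p u w) v) 0 = D1 p v" "coeff (D1P (curve p u w) v) 1 = D2 p u v"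
  "coeff (D1P (curve p u (\<lambda>_. 0)) v) 2 = K2 p v u u"
proof -
  note c = coeff_curve_general[OF pd_MP[OF FM]]
  show "coeff (D1P (curve p u w) v) 0 = D1 p v" using c(1) by (simp add: D1P_def coeff_sum D1_def lin_form_def gr_def mult.commute)
  show "coeff (D1P (curve p u w) v) 1 = D2 p u v"
    using c(2) unfolding D2_sym[of p u v] by (simp add: D1P_def coeff_sum D2_def sum_distrib_left mult.assoc mult.left_commute)
  have z: "(\<Sum>i\<le>n. meval (pd i (pd l F)) p * 0) = 0" for l by simp
  have q: "coeff (q * [:a:]) 2 = a * coeff q 2" for q and a :: 'k by simp
  show "coeff (D1P (curve p u (\<lambda>_. 0)) v) 2 = K2 p v u u"
    unfolding D1P_def coeff_sum K2_def q c(3) z by simp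
qed

lemma curve_vanish:
  assumes "\<And>t. t \<noteq> 0 \<Longrightarrow> meval F (p \<oplus> t \<odot> u \<oplus> t\<^sup>2 \<odot> v) = 0"
  shows "meval F p = 0" "D1 p u = 0" "D1 p v + D2 p u u / 2 = 0"
proof -
  have "evP F (curve p u v) = 0"
    by (rule poly_eq_0I[of 0]) (simp add: poly_evP poly_curve assms)
  then show "meval F p = 0" "D1 p u = 0" "D1 p v + D2 p u u / 2 = 0" using coeff_curve[of p u v] by auto
qed

lemma line_vanish:
  assumes "\<And>t. t \<noteq> 0 \<Longrightarrow> meval F (p \<oplus> t \<odot> u) = 0"
  shows "meval F p = 0" "D1 p u = 0" "D2 p u u = 0"
proof -
  have "p \<oplus> t \<odot> u \<oplus> t\<^sup>2 \<odot> (\<lambda>_. 0) = p \<oplus> t \<odot> u" for t by (simp add: fun_eq_iff)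
  then show "meval F p = 0" "D1 p u = 0" "D2 p u u = 0" using curve_vanish[of p u "\<lambda>_. 0"] assms by auto
qed

lemma D1_curve_derivative:
  assumes "\<And>t. t \<noteq> a \<Longrightarrow> D1 (p \<oplus> t \<odot> u \<oplus> t\<^sup>2 \<odot> w) v = 0"
  shows "D1 p v = 0" "D2 p u v = 0"
proof -
  have "D1P (curve p u w) v = 0"
    by (rule poly_eq_0I[of a]) (simp add: poly_D1P poly_curve assms)
  then show "D1 p v = 0" "D2 p u v = 0" using coeff_D1P(1,2)[of p u w v] by auto
qed

lemma D1_scale_hom: "c * D1 (c \<odot> x) u = c ^ d * D1 x u" "c\<^sup>2 * D2 (c \<odot> x) u u = c ^ d * D2 x u u"
proof -
  have "evP F (line (c \<odot> x) (c \<odot> u)) = smult (c ^ d) (evP F (line x u))"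
  proof (rule poly_eqI_except)
    fix t
    have "c \<odot> x \<oplus> t \<odot> c \<odot> u = c \<odot> (x \<oplus> t \<odot> u)" by (simp add: fun_eq_iff algebra_simps)
    then show "poly (evP F (line (c \<odot> x) (c \<odot> u))) t = poly (smult (c ^ d) (evP F (line x u))) t"
      by (simp add: poly_evP poly_line hom)
  qed
  then show "c * D1 (c \<odot> x) u = c ^ d * D1 x u" "c\<^sup>2 * D2 (c \<odot> x) u u = c ^ d * D2 x u u"
    using coeff_line(2,3)[of "c \<odot> x" "c \<odot> u"] coeff_line(2,3)[of x u] by (simp_all add: power2_eq_square)
qed

lemma D1_hom: "D1 (c \<odot> x) u = c ^ (d - 1) * D1 x u"
proof (cases "c = 0")
  case False
  obtain e where e: "d = Suc e" using d2 by (cases d) auto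
  show ?thesis using D1_scale_hom(1)[of c x u] False by (simp add: e)
next
  case True
  have "evP F (line (\<lambda>_. 0) u) = [:0,1:]^d * [:meval F u:]"
  proof (rule poly_eqI_except)
    fix t
    have "(\<lambda>_. 0) \<oplus> t \<odot> u = t \<odot> u" by (simp add: fun_eq_iff)
    then show "poly (evP F (line (\<lambda>_. 0) u)) t = poly ([:0,1:]^d * [:meval F u:]) t"
      by (simp add: poly_evP poly_line hom)
  qed
  moreover have "[:0,1:]^d = [:0,0,1::'k:] * [:0,1:]^(d-2)"
    using power_add[of "[:0,1::'k:]" 2 "d - 2"] d2 by (simp only: le_add_diff_inverse) (simp add: power2_eq_square)
  ultimately have "coeff (evP F (line (\<lambda>_. 0) u)) 1 = 0" by simp
  moreover have "c \<odot> x = (\<lambda>_. 0)" using True by (simp add: fun_eq_iff)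
  ultimately show ?thesis using coeff_line(2)[of "\<lambda>_. 0" u] True d2 by simp
qed

lemma D2_hom_diag: "c \<noteq> 0 \<Longrightarrow> D2 (c \<odot> x) u u = c ^ (d - 2) * D2 x u u"
proof -
  assume c: "c \<noteq> 0"
  obtain e where e: "d = Suc (Suc e)" using d2 by (metis Suc_le_D numeral_2_eq_2 Suc_le_mono)
  show ?thesis using D1_scale_hom(2)[of c x u] c by (simp add: e power2_eq_square)
qed

lemma D2_polar: "2 * D2 x u v = D2 x (u \<oplus> v) (u \<oplus> v) - D2 x u u - D2 x v v"
  using D2_sym[of x u v] by simp

lemma D2_hom: "c \<noteq> 0 \<Longrightarrow> D2 (c \<odot> x) u v = c ^ (d - 2) * D2 x u v"
proof -
  assume c: "c \<noteq> 0"
  have "2 * D2 (c \<odot> x) u v = c ^ (d - 2) * (2 * D2 x u v)"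
    unfolding D2_polar D2_hom_diag[OF c] by (simp add: algebra_simps)
  then show ?thesis by simp
qed

lemma coeff_pow_linear: "coeff ([:1,1::'k:]^m) 0 = 1 \<and> coeff ([:1,1::'k:]^m) 1 = of_nat m"
  by (induction m) (auto simp: coeff_pCons)

lemma euler: "D1 x x = of_nat d * meval F x"
proof -
  have "evP F (line x x) = [:1,1:]^d * [:meval F x:]"
  proof (rule poly_eqI_except)
    fix t
    have "x \<oplus> t \<odot> x = (1 + t) \<odot> x" by (simp add: fun_eq_iff algebra_simps)
    then show "poly (evP F (line x x)) t = poly ([:1,1:]^d * [:meval F x:]) t"
      by (simp add: poly_evP poly_line hom)
  qed
  then show ?thesis using coeff_line(2)[of x x] coeff_pow_linear[of d] by (simp add: mult.commute)
qed

lemma D2_point: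
  assumes "D1 x u = 0" shows "D2 x x u = 0"
proof (rule D1_curve_derivative(2)[of 0])
  fix t :: 'k
  have "x \<oplus> t \<odot> x \<oplus> t\<^sup>2 \<odot> (\<lambda>_. 0) = (1 + t) \<odot> x" by (simp add: fun_eq_iff algebra_simps)
  then show "D1 (x \<oplus> t \<odot> x \<oplus> t\<^sup>2 \<odot> (\<lambda>_. 0)) u = 0" using assms by (simp add: D1_hom)
qed

lemma smooth_point_nonzero: "D1 x u \<noteq> 0 \<Longrightarrow> x \<noteq> (\<lambda>_. 0)"
proof
  assume *: "D1 x u \<noteq> 0" "x = (\<lambda>_. 0)"
  then have "x = 0 \<odot> x" by (simp add: fun_eq_iff)
  then have e: "D1 x u = 0 ^ (d - 1) * D1 x u" using D1_hom[of 0 x u] by simp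
  have z: "(0::'k) ^ (d - 1) = 0" using d2 by (simp add: power_0_left)
  show False using *(1) e[unfolded z] by simp
qed

text \<open>The \<open>(n-3)\<close>-plane through \<open>p\<close> in the section is recorded by a third linear equation \<open>\<mu>\<close>.\<close>

lemma section_lines:
  assumes sec: "\<And>a. hyperplane_coeffs n a \<Longrightarrow> section_covered n a F" and n: "n \<ge> 3"
    and p: "vec_in n p" "meval F p = 0" and j: "j \<le> n" "gr p j \<noteq> 0"
    and c: "c j = 0" "i \<le> n" "c i \<noteq> 0" "lin_form n c p = 0"
  shows "\<exists>\<mu>. \<forall>x. vec_in n x \<longrightarrow> lin_form n c x = 0 \<longrightarrow> D1 p x = 0 \<longrightarrow> lin_form n \<mu> x = 0 \<longrightarrow>
     (\<forall>t. meval F (p \<oplus> t \<odot> x) = 0)"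
proof -
  have "D1 p (unitv j) \<noteq> 0" using j by (simp add: D1_def lin_form_unitv)
  then have "proj_point n p" using p smooth_point_nonzero by (auto simp: proj_point_def)
  moreover have "hyperplane_coeffs n c" using c by (auto simp: hyperplane_coeffs_def)
  ultimately obtain m where m: "lin_frame n (n - 3) m" "in_span (n - 3) m p"
    "\<And>q. in_span (n - 3) m q \<Longrightarrow> lin_form n c q = 0 \<and> meval F q = 0"
    using sec[of c] p c unfolding section_covered_def by blast
  have closed: "in_span (n - 3) m (p \<oplus> t \<odot> x)" if x: "in_span (n - 3) m x" for t x
  proof -
    obtain s where "p = lincomb (n - 3) s m" using m(2) unfolding in_span_def by (elim exE)
    moreover obtain r where "x = lincomb (n - 3) r m" using x unfolding in_span_def by (elim exE)
    ultimately have "p \<oplus> t \<odot> x = lincomb (n - 3) (\<lambda>j. s j + t * r j) m"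
      by (simp add: lincomb_def fun_eq_iff algebra_simps sum.distrib sum_distrib_left)
    then show ?thesis by (auto simp: in_span_def)
  qed
  have ml: "in_span (n - 3) m (m l)" if "l \<le> n - 3" for l
  proof -
    have "m l = lincomb (n - 3) (\<lambda>j. if j = l then 1 else 0) m"
      using that by (simp add: lincomb_def fun_eq_iff if_distrib[where f = "\<lambda>x. x * _"] cong: if_cong)
    then show ?thesis by (auto simp: in_span_def)
  qed
  have wl: "lin_form n (gr p) (m l) = 0" if "l \<le> n - 3" for l
    using line_vanish(2)[of p "m l"] closed[OF ml[OF that]] m(3) by (simp add: D1_def)
  define R where "R = Some ` {..n - 3} \<union> {None :: nat option}"
  have "card R = Suc (n - 2)" unfolding R_def using n by (simp add: card_image)
  then have cR: "finite R" "card R < n" using n unfolding R_def by auto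
  obtain \<mu> where mu: "\<mu> i = 0" "\<exists>h\<le>n. \<mu> h \<noteq> 0"
     "\<And>r. r \<in> R \<Longrightarrow> lin_form n \<mu> (case r of Some l \<Rightarrow> m l | None \<Rightarrow> unitv j) = 0"
    using exists_form_vanishing[OF cR, of i "\<lambda>r. case r of Some l \<Rightarrow> m l | None \<Rightarrow> unitv j"] by blast
  have muj: "\<mu> j = 0" using mu(3)[of None] lin_form_unitv[OF j(1), of \<mu>] by (simp add: R_def)
  have mul: "lin_form n \<mu> (m l) = 0" if "l \<le> n - 3" for l using mu(3)[of "Some l"] that by (simp add: R_def)
  obtain h where h: "h \<le> n" "\<mu> h \<noteq> 0" using mu(2) by blast
  show ?thesis
  proof (intro exI[of _ \<mu>] allI impI)
    fix x t assume x: "vec_in n x" "lin_form n c x = 0" "D1 p x = 0" "lin_form n \<mu> x = 0"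
    have "in_span (n - 3) m x"
      by (rule span_of_three_forms[where w = "gr p" and c = c and \<mu> = \<mu> and i = i and j = j and h = h,
            OF n m(1) j(2) c(1,3) muj mu(1) h(2) c(2) j(1) h(1)])
         (use wl m(3) ml mul x in \<open>auto simp: D1_def\<close>)
    then show "meval F (p \<oplus> t \<odot> x) = 0" using closed m(3) by blast
  qed
qed

end

lemma alg_closed_sqrt:
  assumes "alg_closed_field TYPE('k::field)" shows "\<exists>y::'k. y * y = a"
proof -
  have "degree [:-a, 0, 1:] \<ge> 1" by simp
  then obtain y where "poly [:-a, 0, 1:] y = 0" using assms unfolding alg_closed_field_def by blast
  then show ?thesis by (auto simp: algebra_simps)
qed

lemma pderiv_evP: "F \<in> MP n \<Longrightarrow> pderiv (evP F c) = (\<Sum>i<n. evP (pd i F) c * pderiv (c i))"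
proof (induction rule: MP.induct)
  case (MP_X k)
  have "evP (if k = i then 1 else 0) c = (if k = i then 1 else 0)" for i
    using evP_simps(3)[of 1 c] by (auto simp: MC_simps one_pCons)
  then have "(\<Sum>i<n. evP (pd i (MX k)) c * pderiv (c i)) = (\<Sum>i<n. if k = i then pderiv (c i) else 0)"
    by (intro sum.cong) auto
  then show ?case using MP_X by simp
qed (auto simp: pderiv_pCons pderiv_add pderiv_mult algebra_simps sum.distrib sum_distrib_left)

context hform begin

definition tangent :: "(nat \<Rightarrow> 'k) \<Rightarrow> (nat \<Rightarrow> 'k) \<Rightarrow> bool" where
  "tangent p v \<longleftrightarrow> vec_in n v \<and> D1 p v = 0"

lemma tangent_simps [simp]: "tangent p u \<Longrightarrow> tangent p v \<Longrightarrow> tangent p (u \<oplus> v)" "tangent p v \<Longrightarrow> tangent p (c \<odot> v)"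
  by (auto simp: tangent_def)

definition otriple :: "(nat \<Rightarrow> 'k) \<Rightarrow> (nat \<Rightarrow> 'k) \<Rightarrow> (nat \<Rightarrow> 'k) \<Rightarrow> (nat \<Rightarrow> 'k) \<Rightarrow> bool" where
  "otriple p u v w \<longleftrightarrow> tangent p u \<and> tangent p v \<and> tangent p w \<and> D2 p u u = 1 \<and> D2 p v v = 1 \<and> D2 p w w = 1 \<and>
     D2 p u v = 0 \<and> D2 p u w = 0 \<and> D2 p v w = 0"

definition hf :: "(nat \<Rightarrow> 'k) \<Rightarrow> (nat \<Rightarrow> 'k) \<Rightarrow> nat \<Rightarrow> 'k" where
  "hf p w i = (\<Sum>j\<le>n. meval (pd j (pd i F)) p * w j)"

lemma lin_form_hf: "lin_form n (hf p w) x = D2 p x w"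
  by (simp add: lin_form_def hf_def D2_def sum_distrib_left sum_distrib_right ac_simps)

lemma D2_normalize:
  assumes ac: "alg_closed_field TYPE('k)" and "D2 p v v \<noteq> 0"
  shows "\<exists>s. D2 p (s \<odot> v) (s \<odot> v) = 1"
proof -
  obtain y where y: "y * y = D2 p v v" using alg_closed_sqrt[OF ac] by blast
  then have "D2 p (inverse y \<odot> v) (inverse y \<odot> v) = 1" using assms(2) by (auto simp: field_simps)
  then show ?thesis ..
qed

lemma quadric_rank_cases:
  assumes ac: "alg_closed_field TYPE('k)" and p: "D1 p p = 0" and nt: "\<not> (\<exists>u v w. otriple p u v w)"
  obtains (zero) "\<And>v. tangent p v \<Longrightarrow> D2 p v v = 0"
  | (one) \<alpha> v where "\<And>x y. tangent p x \<Longrightarrow> tangent p y \<Longrightarrow> D2 p x y = lin_form n \<alpha> x * lin_form n \<alpha> y"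
      "tangent p v" "lin_form n \<alpha> v \<noteq> 0" "lin_form n \<alpha> p = 0"
  | (two) \<alpha> \<beta> u v where
      "\<And>x y. tangent p x \<Longrightarrow> tangent p y \<Longrightarrow> 2 * D2 p x y = lin_form n \<alpha> x * lin_form n \<beta> y + lin_form n \<beta> x * lin_form n \<alpha> y"
      "tangent p u" "lin_form n \<alpha> u = 0" "lin_form n \<beta> u \<noteq> 0"
      "tangent p v" "lin_form n \<beta> v = 0" "lin_form n \<alpha> v \<noteq> 0" "lin_form n \<alpha> p = 0" "lin_form n \<beta> p = 0"
proof -
  have pt: "D2 p p v = 0" if "tangent p v" for v using that D2_point by (simp add: tangent_def)
  show thesis
  proof (cases "\<forall>v. tangent p v \<longrightarrow> D2 p v v = 0")
    case True then show ?thesis using zero by blast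
  next
    case False
    then obtain v0 where v0: "tangent p v0" "D2 p v0 v0 \<noteq> 0" by blast
    obtain s where "D2 p (s \<odot> v0) (s \<odot> v0) = 1" using D2_normalize[OF ac v0(2)] by blast
    then obtain v1 where v1: "tangent p v1" "D2 p v1 v1 = 1" using v0 by (metis tangent_simps(2))
    show ?thesis
    proof (cases "\<forall>x. tangent p x \<longrightarrow> D2 p x v1 = 0 \<longrightarrow> D2 p x x = 0")
      case True
      have diag: "D2 p x x = D2 p x v1 * D2 p x v1" if "tangent p x" for x
      proof -
        define y where "y = x \<oplus> (- D2 p x v1) \<odot> v1"
        have "tangent p y" "D2 p y v1 = 0" using that v1 by (auto simp: y_def)
        then have "D2 p y y = 0" using True by blast
        then show ?thesis using v1(2) D2_sym[of p v1 x] by (simp add: y_def algebra_simps)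
      qed
      have bil: "D2 p x y = D2 p x v1 * D2 p y v1" if "tangent p x" "tangent p y" for x y
      proof -
        have "2 * D2 p x y = 2 * (D2 p x v1 * D2 p y v1)"
          unfolding D2_polar using that diag[OF tangent_simps(1)[OF that]] by (simp add: diag algebra_simps)
        then show ?thesis by simp
      qed
      show ?thesis
      proof (rule one[of "hf p v1" v1])
        show "D2 p x y = lin_form n (hf p v1) x * lin_form n (hf p v1) y" if "tangent p x" "tangent p y" for x y
          unfolding lin_form_hf by (rule bil[OF that])
        show "lin_form n (hf p v1) v1 \<noteq> 0" "lin_form n (hf p v1) p = 0"
          unfolding lin_form_hf using v1 pt by simp_all
      qed (fact v1)
    next
      case False
      then obtain v0' where v0': "tangent p v0'" "D2 p v0' v1 = 0" "D2 p v0' v0' \<noteq> 0" by blast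
      obtain s where "D2 p (s \<odot> v0') (s \<odot> v0') = 1" using D2_normalize[OF ac v0'(3)] by blast
      then obtain v2 where v2: "tangent p v2" "D2 p v2 v1 = 0" "D2 p v2 v2 = 1"
        using v0' by (metis D2_simps(2) mult_zero_right tangent_simps(2))
      have v12: "D2 p v1 v2 = 0" using v2 D2_sym by metis
      have rest: "D2 p x x = 0" if x: "tangent p x" "D2 p x v1 = 0" "D2 p x v2 = 0" for x
      proof (rule ccontr)
        assume "D2 p x x \<noteq> 0"
        then obtain s where "D2 p (s \<odot> x) (s \<odot> x) = 1" using D2_normalize[OF ac] by blast
        then have "otriple p v1 v2 (s \<odot> x)"
          using v1 v2 v12 x unfolding otriple_def by (simp add: D2_sym[of p v1 x] D2_sym[of p v2 x])
        then show False using nt by blast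
      qed
      have diag: "D2 p x x = D2 p x v1 * D2 p x v1 + D2 p x v2 * D2 p x v2" if "tangent p x" for x
      proof -
        define y where "y = x \<oplus> (- D2 p x v1) \<odot> v1 \<oplus> (- D2 p x v2) \<odot> v2"
        have "tangent p y" "D2 p y v1 = 0" "D2 p y v2 = 0" using that v1 v2 v12 by (auto simp: y_def)
        then have "D2 p y y = 0" using rest by blast
        then show ?thesis using v1(2) v2 v12 D2_sym[of p v1 x] D2_sym[of p v2 x] by (simp add: y_def algebra_simps)
      qed
      have bil: "D2 p x y = D2 p x v1 * D2 p y v1 + D2 p x v2 * D2 p y v2" if "tangent p x" "tangent p y" for x y
      proof -
        have "2 * D2 p x y = 2 * (D2 p x v1 * D2 p y v1 + D2 p x v2 * D2 p y v2)"
          unfolding D2_polar using that diag[OF tangent_simps(1)[OF that]] by (simp add: diag algebra_simps)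
        then show ?thesis by (simp only: mult_cancel_left) simp
      qed
      obtain \<iota> :: 'k where i: "\<iota> * \<iota> = -1" using alg_closed_sqrt[OF ac] by blast
      have i2: "\<iota> * (\<iota> * c) = - c" for c using i by (simp add: mult.assoc[symmetric])
      define a where "a = v1 \<oplus> \<iota> \<odot> v2"
      define b where "b = v1 \<oplus> (- \<iota>) \<odot> v2"
      have t: "tangent p a" "tangent p b" using v1 v2 by (auto simp: a_def b_def)
      show ?thesis
      proof (rule two[of "hf p a" "hf p b" a b])
        show "2 * D2 p x y = lin_form n (hf p a) x * lin_form n (hf p b) y + lin_form n (hf p b) x * lin_form n (hf p a) y"
          if "tangent p x" "tangent p y" for x y
          using bil[OF that] unfolding lin_form_hf a_def b_def by (simp add: algebra_simps i2)
        show "lin_form n (hf p a) a = 0" "lin_form n (hf p b) b = 0"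
          "lin_form n (hf p b) a \<noteq> 0" "lin_form n (hf p a) b \<noteq> 0"
          unfolding lin_form_hf a_def b_def using v1 v2 v12 by (simp_all add: i)
        show "lin_form n (hf p a) p = 0" "lin_form n (hf p b) p = 0"
          unfolding lin_form_hf a_def b_def using pt v1 v2 by simp_all
      qed (use t in auto)
    qed
  qed
qed

definition ruling :: "(nat \<Rightarrow> 'k) \<Rightarrow> (nat \<Rightarrow> 'k) \<Rightarrow> bool" where
  "ruling p x \<longleftrightarrow> (\<forall>t. meval F (p \<oplus> t \<odot> x) = 0)"

lemma ruling_D2: "ruling p x \<Longrightarrow> D2 p x x = 0"
  using line_vanish(3)[of p x] by (simp add: ruling_def)

lemma ruling_direction:
  assumes "ruling p x" shows "meval F x = 0"
proof (rule line_vanish(1)[of x p])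
  fix t :: 'k assume t: "t \<noteq> 0"
  have "x \<oplus> t \<odot> p = t \<odot> (p \<oplus> inverse t \<odot> x)" using t by (simp add: fun_eq_iff algebra_simps)
  then show "meval F (x \<oplus> t \<odot> p) = 0" using assms by (simp add: hom ruling_def)
qed

lemma not_ruling_perturb:
  assumes "\<not> ruling p a"
  shows "\<exists>s. s \<noteq> 0 \<and> \<not> ruling p (a \<oplus> s \<odot> u)"
proof -
  obtain t where t: "meval F (p \<oplus> t \<odot> a) \<noteq> 0" using assms by (auto simp: ruling_def)
  then obtain s where s: "s \<noteq> 0" "meval F ((p \<oplus> t \<odot> a) \<oplus> s \<odot> (t \<odot> u)) \<noteq> 0"
    using line_vanish(1)[of "p \<oplus> t \<odot> a" "t \<odot> u"] by blast
  have "(p \<oplus> t \<odot> a) \<oplus> s \<odot> (t \<odot> u) = p \<oplus> t \<odot> (a \<oplus> s \<odot> u)" by (simp add: fun_eq_iff algebra_simps)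
  then show ?thesis using s unfolding ruling_def by metis
qed

lemma dvd_homogeneous_degree:
  assumes "F dvd Q" "Q \<noteq> 0" and Q: "\<And>c x. meval Q (c \<odot> x) = c ^ e * meval Q x"
  shows "d \<le> e"
proof (rule ccontr)
  assume "\<not> d \<le> e"
  obtain B where B: "Q = F * B" using assms(1) by blast
  obtain a where a: "meval Q a \<noteq> 0" using meval_nonzero[OF assms(2)] by blast
  have z: "(\<lambda>_. 0) \<oplus> t \<odot> a = t \<odot> a" for t by (simp add: fun_eq_iff)
  have "monom (meval Q a) e = monom 1 d * ([:meval F a:] * evP B (line (\<lambda>_. 0) a))"
  proof (rule poly_eqI_except)
    fix t
    have "poly (monom (meval Q a) e) t = meval Q (t \<odot> a)" by (simp add: poly_monom Q mult.commute)
    also have "\<dots> = t ^ d * meval F a * meval B (t \<odot> a)" by (simp add: B hom)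
    finally show "poly (monom (meval Q a) e) t = poly (monom 1 d * ([:meval F a:] * evP B (line (\<lambda>_. 0) a))) t"
      by (simp add: poly_monom poly_evP poly_line z)
  qed
  then have "meval Q a = coeff (monom 1 d * ([:meval F a:] * evP B (line (\<lambda>_. 0) a))) e"
    by (metis coeff_monom)
  also have "\<dots> = 0" using \<open>\<not> d \<le> e\<close> by (simp add: coeff_monom_mult)
  finally show False using a by simp
qed

end


locale covered_form = hform F n d for F :: "'k::field_char_0 mpoly" and n d +
  assumes ac: "alg_closed_field TYPE('k)" and n4: "n \<ge> 4"
    and sec: "\<And>a. hyperplane_coeffs n a \<Longrightarrow> section_covered n a F"
begin

lemma lines_in_section:
  assumes p: "vec_in n p" "meval F p = 0" and j: "j \<le> n" "gr p j \<noteq> 0"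
    and R: "finite R" "card R < n" and pR: "p \<in> R" and RT: "\<And>x. x \<in> R \<Longrightarrow> tangent p x"
  obtains N \<mu> where "R \<subseteq> N" "\<And>x. x \<in> N \<Longrightarrow> tangent p x" "\<And>x y. x \<in> N \<Longrightarrow> y \<in> N \<Longrightarrow> x \<oplus> y \<in> N"
     "\<And>x s. x \<in> N \<Longrightarrow> s \<odot> x \<in> N" "\<And>x. x \<in> N \<Longrightarrow> lin_form n \<mu> x = 0 \<Longrightarrow> ruling p x"
proof -
  obtain c i where c: "c j = 0" "i \<le> n" "c i \<noteq> 0" "\<And>r. r \<in> R \<Longrightarrow> lin_form n c r = 0"
    using exists_form_vanishing[OF R, of j "\<lambda>x. x"] by blast
  obtain \<mu> where mu: "\<And>x. vec_in n x \<Longrightarrow> lin_form n c x = 0 \<Longrightarrow> D1 p x = 0 \<Longrightarrow> lin_form n \<mu> x = 0 \<Longrightarrow>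
     (\<forall>t. meval F (p \<oplus> t \<odot> x) = 0)"
    using section_lines[OF sec _ p j c(1,2,3) c(4)[OF pR]] n4 by auto
  show ?thesis
  proof (rule that[of "{x. tangent p x \<and> lin_form n c x = 0}" \<mu>])
    show "R \<subseteq> {x. tangent p x \<and> lin_form n c x = 0}" using RT c by auto
    show "ruling p x" if "x \<in> {x. tangent p x \<and> lin_form n c x = 0}" "lin_form n \<mu> x = 0" for x
      using mu that by (auto simp: ruling_def tangent_def)
  qed auto
qed

lemma tangent_self: "vec_in n p \<Longrightarrow> meval F p = 0 \<Longrightarrow> tangent p p"
  by (simp add: tangent_def euler)

lemma no_otriple:
  assumes n5: "n \<ge> 5" and p: "vec_in n p" "meval F p = 0" and j: "j \<le> n" "gr p j \<noteq> 0"
  shows "\<not> otriple p v1 v2 v3"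
proof
  assume o: "otriple p v1 v2 v3"
  have cR: "card {p, v1, v2, v3} < n" using n5 by (simp add: card_insert_if)
  obtain N \<mu> where N: "{p, v1, v2, v3} \<subseteq> N" "\<And>x. x \<in> N \<Longrightarrow> tangent p x" "\<And>x y. x \<in> N \<Longrightarrow> y \<in> N \<Longrightarrow> x \<oplus> y \<in> N"
     "\<And>x s. x \<in> N \<Longrightarrow> s \<odot> x \<in> N" "\<And>x. x \<in> N \<Longrightarrow> lin_form n \<mu> x = 0 \<Longrightarrow> ruling p x"
    using lines_in_section[OF p j _ cR] tangent_self[OF p] o unfolding otriple_def by blast
  have iso: "lin_form n \<mu> y * lin_form n \<mu> y + lin_form n \<mu> x * lin_form n \<mu> x = 0"
    if "x \<in> N" "y \<in> N" "D2 p x x = 1" "D2 p y y = 1" "D2 p x y = 0" for x y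
  proof -
    define z where "z = lin_form n \<mu> y \<odot> x \<oplus> (- lin_form n \<mu> x) \<odot> y"
    have "z \<in> N" "lin_form n \<mu> z = 0" using N that by (auto simp: z_def)
    then have "D2 p z z = 0" using N(5) ruling_D2 by blast
    then show ?thesis using that D2_sym[of p y x] by (simp add: z_def)
  qed
  have "lin_form n \<mu> v2 * lin_form n \<mu> v2 + lin_form n \<mu> v1 * lin_form n \<mu> v1 = 0"
    "lin_form n \<mu> v3 * lin_form n \<mu> v3 + lin_form n \<mu> v1 * lin_form n \<mu> v1 = 0"
    "lin_form n \<mu> v3 * lin_form n \<mu> v3 + lin_form n \<mu> v2 * lin_form n \<mu> v2 = 0"
    using iso N(1) o unfolding otriple_def by auto
  then have "2 * (lin_form n \<mu> v1 * lin_form n \<mu> v1) = 0" by algebra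
  then have "lin_form n \<mu> v1 = 0" by simp
  then have "ruling p v1" using N(1) by (intro N(5)) auto
  then show False using o ruling_D2[of p v1] by (simp add: otriple_def)
qed

lemma pencil_of_lines:
  assumes p: "vec_in n p" "meval F p = 0" and j: "j \<le> n" "gr p j \<noteq> 0"
    and ab: "tangent p a" "tangent p b"
    and q: "\<And>x. tangent p x \<Longrightarrow> D2 p x x = 0 \<Longrightarrow> lin_form n \<alpha> x = 0 \<or> lin_form n \<beta> x = 0"
  shows "\<exists>\<gamma>\<in>{\<alpha>, \<beta>}. \<forall>x\<in>{a, b}. \<forall>y\<in>{a, b}. lin_form n \<gamma> x = 0 \<longrightarrow> lin_form n \<gamma> y \<noteq> 0 \<longrightarrow> ruling p x"
proof -
  have cR: "card {p, a, b} < n" using n4 by (simp add: card_insert_if)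
  obtain N \<mu> where N: "{p, a, b} \<subseteq> N" "\<And>x. x \<in> N \<Longrightarrow> tangent p x" "\<And>x y. x \<in> N \<Longrightarrow> y \<in> N \<Longrightarrow> x \<oplus> y \<in> N"
     "\<And>x s. x \<in> N \<Longrightarrow> s \<odot> x \<in> N" "\<And>x. x \<in> N \<Longrightarrow> lin_form n \<mu> x = 0 \<Longrightarrow> ruling p x"
    using lines_in_section[OF p j _ cR] tangent_self[OF p] ab by blast
  define M where "M = {x \<in> N. lin_form n \<mu> x = 0}"
  have M: "lin_form n \<alpha> x = 0 \<or> lin_form n \<beta> x = 0" if "x \<in> M" for x
    using that N(2,5) ruling_D2 q unfolding M_def by blast
  have Madd: "x \<oplus> y \<in> M" if "x \<in> M" "y \<in> M" for x y using that N(3) by (auto simp: M_def)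
  obtain \<gamma> where g: "\<gamma> \<in> {\<alpha>, \<beta>}" "\<And>x. x \<in> M \<Longrightarrow> lin_form n \<gamma> x = 0"
  proof (cases "\<forall>x\<in>M. lin_form n \<alpha> x = 0")
    case True then show ?thesis using that[of \<alpha>] by blast
  next
    case False
    then obtain x where x: "x \<in> M" "lin_form n \<alpha> x \<noteq> 0" by blast
    have "lin_form n \<beta> y = 0" if "y \<in> M" for y
    proof (rule ccontr)
      assume "lin_form n \<beta> y \<noteq> 0"
      then show False using M[OF that] M[OF x(1)] M[OF Madd[OF x(1) that]] x(2) by auto
    qed
    then show ?thesis using that[of \<beta>] by blast
  qed
  have "ruling p x" if xy: "x \<in> {a, b}" "y \<in> {a, b}" "lin_form n \<gamma> x = 0" "lin_form n \<gamma> y \<noteq> 0" for x y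
  proof (cases "lin_form n \<mu> x = 0")
    case True
    have "x \<in> N" using xy(1) N(1) by auto
    then show ?thesis using True by (rule N(5))
  next
    case False
    have xN: "x \<in> N" "y \<in> N" using xy(1,2) N(1) by auto
    have "y \<oplus> (- (lin_form n \<mu> y / lin_form n \<mu> x)) \<odot> x \<in> M"
      using False N(3)[OF xN(2) N(4)[OF xN(1)]] unfolding M_def by simp
    from g(2)[OF this] show ?thesis using xy(3,4) by simp
  qed
  then show ?thesis using g(1) by blast
qed

lemma plane_through_point:
  assumes p: "vec_in n p" "meval F p = 0" and j: "j \<le> n" "gr p j \<noteq> 0"
    and nt: "\<not> (\<exists>u v w. otriple p u v w)" and v0: "tangent p v0" "D2 p v0 v0 \<noteq> 0"
  shows "\<exists>\<alpha>. (\<exists>u. tangent p u \<and> lin_form n \<alpha> u \<noteq> 0) \<and> lin_form n \<alpha> p = 0 \<and>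
    (\<forall>x. tangent p x \<longrightarrow> lin_form n \<alpha> x = 0 \<longrightarrow> meval F x = 0)"
proof -
  have pp: "D1 p p = 0" using p euler by simp
  show ?thesis
  proof (cases rule: quadric_rank_cases[OF ac pp nt])
    case 1
    then show ?thesis using v0 by blast
  next
    case (2 \<alpha> v)
    have "meval F x = 0" if x: "tangent p x" "lin_form n \<alpha> x = 0" for x
    proof -
      have "\<exists>\<gamma>\<in>{\<alpha>, \<alpha>}. \<forall>y\<in>{x, v}. \<forall>z\<in>{x, v}. lin_form n \<gamma> y = 0 \<longrightarrow> lin_form n \<gamma> z \<noteq> 0 \<longrightarrow> ruling p y"
        by (rule pencil_of_lines[OF p j x(1) 2(2)]) (use 2(1) in auto)
      then have "ruling p x" using x 2 by blast
      then show ?thesis by (rule ruling_direction)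
    qed
    then show ?thesis using 2 by blast
  next
    case (3 \<alpha> \<beta> u v)
    have dg: "lin_form n \<alpha> x = 0 \<or> lin_form n \<beta> x = 0" if "tangent p x" "D2 p x x = 0" for x
      using 3(1)[OF that(1) that(1)] that(2) by (simp add: mult.commute)
    have "(\<forall>x. tangent p x \<longrightarrow> lin_form n \<alpha> x = 0 \<longrightarrow> ruling p x) \<or> (\<forall>x. tangent p x \<longrightarrow> lin_form n \<beta> x = 0 \<longrightarrow> ruling p x)"
    proof (rule ccontr)
      assume "\<not> ?thesis"
      then obtain a0 b0 where a0: "tangent p a0" "lin_form n \<alpha> a0 = 0" "\<not> ruling p a0"
        and b0: "tangent p b0" "lin_form n \<beta> b0 = 0" "\<not> ruling p b0" by blast
      obtain a where a: "tangent p a" "lin_form n \<alpha> a = 0" "\<not> ruling p a" "lin_form n \<beta> a \<noteq> 0"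
      proof (cases "lin_form n \<beta> a0 = 0")
        case True
        obtain s where "s \<noteq> 0" "\<not> ruling p (a0 \<oplus> s \<odot> u)" using not_ruling_perturb[OF a0(3)] by blast
        then show ?thesis using that[of "a0 \<oplus> s \<odot> u"] a0 3 True by auto
      qed (use that a0 in blast)
      obtain b where b: "tangent p b" "lin_form n \<beta> b = 0" "\<not> ruling p b" "lin_form n \<alpha> b \<noteq> 0"
      proof (cases "lin_form n \<alpha> b0 = 0")
        case True
        obtain s where "s \<noteq> 0" "\<not> ruling p (b0 \<oplus> s \<odot> v)" using not_ruling_perturb[OF b0(3)] by blast
        then show ?thesis using that[of "b0 \<oplus> s \<odot> v"] b0 3 True by auto
      qed (use that b0 in blast)
      have "\<exists>\<gamma>\<in>{\<alpha>, \<beta>}. \<forall>x\<in>{a, b}. \<forall>y\<in>{a, b}. lin_form n \<gamma> x = 0 \<longrightarrow> lin_form n \<gamma> y \<noteq> 0 \<longrightarrow> ruling p x"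
        by (rule pencil_of_lines[OF p j a(1) b(1) dg])
      then show False using a b by blast
    qed
    then show ?thesis using 3 ruling_direction by blast
  qed
qed

end

context hform begin

definition tangent_field :: "nat \<Rightarrow> (nat \<Rightarrow> 'k) \<Rightarrow> (nat \<Rightarrow> 'k) \<Rightarrow> nat \<Rightarrow> 'k" where
  "tangent_field j v x = gr x j \<odot> v \<oplus> (- D1 x v) \<odot> unitv j"

lemma tangent_field_tangent:
  assumes "j \<le> n" "vec_in n v" shows "tangent x (tangent_field j v x)"
proof -
  have "D1 x (unitv j) = gr x j" using assms by (simp add: D1_def lin_form_unitv)
  then show ?thesis using assms by (simp add: tangent_def tangent_field_def vec_in_unitv mult.commute)
qed

definition fieldM :: "nat \<Rightarrow> (nat \<Rightarrow> 'k) \<Rightarrow> nat \<Rightarrow> 'k mpoly" where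
  "fieldM j v i = pd j F * MC (v i) - (if i = j then (\<Sum>l\<le>n. pd l F * MC (v l)) else 0)"

lemma meval_fieldM: "meval (fieldM j v i) x = tangent_field j v x i"
  by (simp add: fieldM_def tangent_field_def gr_def D1_def lin_form_def unitv_def)

definition formM :: "nat \<Rightarrow> (nat \<Rightarrow> 'k) \<Rightarrow> (nat \<Rightarrow> 'k) \<Rightarrow> 'k mpoly" where
  "formM j u v = (\<Sum>i\<le>n. \<Sum>k\<le>n. pd k (pd i F) * fieldM j u i * fieldM j v k)"

lemma meval_formM: "meval (formM j u v) x = D2 x (tangent_field j u x) (tangent_field j v x)"
  by (simp add: formM_def D2_def meval_fieldM)

definition trunc :: "(nat \<Rightarrow> 'k) \<Rightarrow> nat \<Rightarrow> 'k" where "trunc x i = (if i \<le> n then x i else 0)"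

lemma trunc: "vec_in n (trunc x)" "G \<in> MP (Suc n) \<Longrightarrow> meval G (trunc x) = meval G x"
  by (auto simp: trunc_def vec_in_def intro: meval_cong)

lemma gr_trunc: "gr (trunc x) = gr x"
  by (auto simp: gr_def trunc pd_MP FM)

lemma D1_trunc: "D1 (trunc x) = D1 x"
  by (simp add: D1_def[abs_def] gr_trunc)

lemma D2_trunc: "D2 (trunc x) = D2 x"
  by (simp add: D2_def[abs_def] trunc pd_MP FM)

definition D2P :: "(nat \<Rightarrow> 'k poly) \<Rightarrow> (nat \<Rightarrow> 'k) \<Rightarrow> (nat \<Rightarrow> 'k) \<Rightarrow> 'k poly" where
  "D2P c u v = (\<Sum>i\<le>n. \<Sum>j\<le>n. evP (pd j (pd i F)) c * [:u i:] * [:v j:])"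

lemma poly_D2P: "poly (D2P c u v) t = D2 (\<lambda>i. poly (c i) t) u v"
  by (simp add: D2P_def poly_sum poly_evP D2_def ac_simps)

lemma pderiv_line: "pderiv (evP F (line p q)) = D1P (line p q) q"
  using pderiv_evP[OF FM, of "line p q"] by (simp add: D1P_def line_def[abs_def] lessThan_Suc_atMost pderiv_pCons)

lemma pderiv_sum: "pderiv (sum f A) = (\<Sum>a\<in>A. pderiv (f a))"
  by (induction A rule: infinite_finite_induct) (auto simp: pderiv_add)

lemma pderiv_D1P_line: "pderiv (D1P (line p q) u) = D2P (line p q) u q"
proof -
  have "pderiv (evP (pd i F) (line p q) * [:u i:]) = (\<Sum>j\<le>n. evP (pd j (pd i F)) (line p q) * [:u i:] * [:q j:])" for i
  proof -
    have "pderiv (evP (pd i F) (line p q)) = (\<Sum>j\<le>n. evP (pd j (pd i F)) (line p q) * [:q j:])"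
      using pderiv_evP[OF pd_MP[OF FM], of i "line p q"]
      by (simp add: line_def[abs_def] lessThan_Suc_atMost pderiv_pCons)
    moreover have "pderiv (A * [:a:]) = pderiv A * [:a:]" for A and a :: 'k by (simp add: pderiv_smult)
    ultimately show ?thesis by (simp only: sum_distrib_right mult.assoc mult.commute[of "[:q _:]"])
  qed
  then show ?thesis by (simp only: D1P_def D2P_def pderiv_sum)
qed

text \<open>If the second fundamental form vanishes, then the restriction \<open>f\<close> of \<open>F\<close> to a tangent line
  cannot have a finite order of vanishing \<open>m\<close>: the gradient is constant up to scaling to order \<open>m\<close>.\<close>

lemma flat_tangent_space:
  assumes ac: "alg_closed_field TYPE('k)" and irr: "irreducible F"
    and flat: "\<And>p v j. vec_in n p \<Longrightarrow> meval F p = 0 \<Longrightarrow> j \<le> n \<Longrightarrow> gr p j \<noteq> 0 \<Longrightarrow> tangent p v \<Longrightarrow> D2 p v v = 0"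
    and p: "vec_in n p" "meval F p = 0" and j: "j \<le> n" "gr p j \<noteq> 0" and q: "tangent p q"
  shows "ruling p q"
proof -
  have qv: "vec_in n q" using q by (simp add: tangent_def)
  have "F dvd formM j q q"
  proof (rule vanishing_imp_dvd[OF ac irr])
    fix x assume x: "meval F x = 0"
    show "meval (formM j q q) x = 0"
    proof (cases "\<exists>i\<le>n. gr x i \<noteq> 0")
      case True
      then obtain i where i: "i \<le> n" "gr x i \<noteq> 0" by blast
      have "tangent (trunc x) (tangent_field j q x)" using tangent_field_tangent[OF j(1) qv, of x] by (simp add: tangent_def D1_trunc)
      then have "D2 (trunc x) (tangent_field j q x) (tangent_field j q x) = 0"
        using flat[of "trunc x" i "tangent_field j q x"] trunc x i FM by (simp add: gr_trunc)
      then show ?thesis by (simp add: meval_formM D2_trunc)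
    next
      case False
      then have "tangent_field j q x = (\<lambda>_. 0)" using j by (simp add: tangent_field_def D1_def lin_form_def fun_eq_iff)
      then show ?thesis by (simp add: meval_formM D2_def)
    qed
  qed
  then obtain B where B: "formM j q q = F * B" by blast
  define c where "c = line p q"
  define f where "f = evP F c"
  define h where "h = D1P c q"
  define w where "w = evP (pd j F) c"
  have h: "pderiv f = h" unfolding f_def h_def c_def by (rule pderiv_line)
  have h': "pderiv h = D2P c q q" unfolding h_def c_def by (rule pderiv_D1P_line)
  have key: "w * w * pderiv h + h * (h * D2P c (unitv j) (unitv j) - 2 * (w * D2P c q (unitv j))) = f * evP B c"
  proof (rule poly_eqI_except)
    fix t
    define x where "x = (\<lambda>i. poly (c i) t)"
    have "poly (f * evP B c) t = D2 x (tangent_field j q x) (tangent_field j q x)"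
      unfolding f_def x_def by (simp add: poly_evP meval_formM[symmetric] B)
    also have "\<dots> = gr x j * gr x j * D2 x q q + D1 x q * (D1 x q * D2 x (unitv j) (unitv j) - 2 * (gr x j * D2 x q (unitv j)))"
      using D2_sym[of x "unitv j" q] by (simp add: tangent_field_def algebra_simps)
    finally show "poly (w * w * pderiv h + h * (h * D2P c (unitv j) (unitv j) - 2 * (w * D2P c q (unitv j)))) t = poly (f * evP B c) t"
      unfolding h' by (simp add: w_def h_def poly_evP poly_D1P poly_D2P x_def gr_def)
  qed
  have w0: "poly w 0 \<noteq> 0" using j unfolding w_def c_def by (simp add: poly_evP poly_line gr_def vadd_def smul_def)
  have "f = 0"
  proof (rule ccontr)
    assume f0: "f \<noteq> 0"
    define m where "m = order 0 f"
    obtain g where g: "f = [:0,1:] ^ m * g" "poly g 0 \<noteq> 0"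
      using order_decomp[OF f0, of 0] unfolding m_def by (auto simp: poly_eq_0_iff_dvd)
    have cf: "coeff f 0 = 0" "coeff f 1 = 0" using coeff_line(1,2)[of p q] p q unfolding f_def c_def tangent_def by auto
    have g0: "coeff g 0 \<noteq> 0" using g(2) by (simp add: poly_0_coeff_0)
    have "m \<noteq> 0"
    proof
      assume "m = 0"
      then have "f = g" using g(1) by simp
      then show False using cf(1) g0 by simp
    qed
    moreover have "m \<noteq> 1"
    proof
      assume "m = 1"
      then have "f = [:0,1:] * g" using g(1) by simp
      then show False using cf(2) g0 by simp
    qed
    ultimately obtain e where e: "m = Suc (Suc e)" by (metis One_nat_def not0_implies_Suc)
    define X where "X = [:0, 1::'k:]"
    define hh where "hh = of_nat m * g + X * pderiv g"
    have dX: "pderiv X = 1" by (simp add: X_def pderiv_pCons one_pCons)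
    have hX: "h = X ^ Suc e * hh"
      unfolding h[symmetric] g X_def[symmetric] pderiv_mult e pderiv_power_Suc dX hh_def
      by (simp add: algebra_simps of_nat_poly)
    have "of_nat m \<noteq> (0::'k)" unfolding e by (simp only: of_nat_eq_0_iff)
    then have hh0: "poly hh 0 \<noteq> 0" using g(2) by (simp add: hh_def X_def)
    have hX': "pderiv h = X ^ e * (of_nat (Suc e) * hh + X * pderiv hh)"
      unfolding hX pderiv_mult pderiv_power_Suc dX by (simp add: algebra_simps of_nat_poly)
    define Y where "Y = h * D2P c (unitv j) (unitv j) - 2 * (w * D2P c q (unitv j))"
    have "X ^ e * (w * w * (of_nat (Suc e) * hh + X * pderiv hh) + X * (hh * Y)) = X ^ e * (X * (X * (g * evP B c)))"
    proof -
      have "X ^ e * (w * w * (of_nat (Suc e) * hh + X * pderiv hh) + X * (hh * Y))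
        = w * w * (X ^ e * (of_nat (Suc e) * hh + X * pderiv hh)) + (X ^ Suc e * hh) * Y"
        by (simp only: distrib_left power_Suc ac_simps)
      also have "\<dots> = f * evP B c" unfolding hX'[symmetric] hX[symmetric] using key unfolding Y_def .
      also have "\<dots> = X ^ e * (X * (X * (g * evP B c)))"
        unfolding g X_def[symmetric] e by (simp only: power_Suc ac_simps)
      finally show ?thesis .
    qed
    moreover have "X ^ e \<noteq> 0" by (simp add: X_def)
    ultimately have "w * w * (of_nat (Suc e) * hh + X * pderiv hh) + X * (hh * Y) = X * (X * (g * evP B c))"
      using mult_left_cancel[of "X ^ e"] by blast
    then have "poly (w * w * (of_nat (Suc e) * hh + X * pderiv hh) + X * (hh * Y)) 0 = poly (X * (X * (g * evP B c))) 0" by simp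
    then show False using w0 hh0 by (simp add: X_def del: of_nat_Suc)
  qed
  then have "poly f t = 0" for t by simp
  then show ?thesis unfolding ruling_def f_def c_def by (simp add: poly_evP poly_line)
qed

definition linM :: "(nat \<Rightarrow> 'k) \<Rightarrow> 'k mpoly" where "linM a = (\<Sum>i\<le>n. MC (a i) * MX i)"

lemma meval_linM: "meval (linM a) x = lin_form n a x"
  by (simp add: linM_def lin_form_def)

lemma not_flat:
  assumes ac: "alg_closed_field TYPE('k)" and irr: "irreducible F"
    and p: "vec_in n p" "meval F p = 0" and j: "j \<le> n" "gr p j \<noteq> 0"
  shows "\<exists>x v i. vec_in n x \<and> meval F x = 0 \<and> i \<le> n \<and> gr x i \<noteq> 0 \<and> tangent x v \<and> D2 x v v \<noteq> 0"
proof (rule ccontr)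
  assume no: "\<not> ?thesis"
  have *: "D2 x v v = 0" if "vec_in n x" "meval F x = 0" "i \<le> n" "gr x i \<noteq> 0" "tangent x v" for x v i
    using no that by blast
  have van: "meval F x = 0" if "meval (linM (gr p)) x = 0" for x
  proof -
    have "tangent p (trunc x)" using that trunc(1)[of x]
      by (simp add: tangent_def meval_linM D1_def) (simp add: lin_form_def trunc_def)
    then have "ruling p (trunc x)" using flat_tangent_space[OF ac irr _ p j] * by blast
    then show ?thesis using ruling_direction trunc(2)[OF FM] by metis
  qed
  have nz: "linM (gr p) \<noteq> 0"
  proof
    assume "linM (gr p) = 0"
    then have "lin_form n (gr p) (unitv j) = 0" by (metis meval_linM meval_simps(5))
    then show False using j lin_form_unitv by metis
  qed
  have "F dvd linM (gr p)"
    by (rule irreducible_dvd_of_vanishing[OF ac irr nz, of "\<lambda>_. 0" 1])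
       (use van in \<open>auto simp: meval_linM lin_form_def\<close>)
  then have "d \<le> 1" by (rule dvd_homogeneous_degree[OF _ nz]) (simp add: meval_linM)
  then show False using d2 by simp
qed

end

section \<open>Threefolds with nondegenerate second fundamental form\<close>

context hform begin

definition cframe :: "(nat \<Rightarrow> 'k) \<Rightarrow> (nat \<Rightarrow> 'k) \<Rightarrow> (nat \<Rightarrow> 'k) \<Rightarrow> (nat \<Rightarrow> 'k) \<Rightarrow> bool" where
  "cframe x e1 e2 e3 \<longleftrightarrow> tangent x e1 \<and> tangent x e2 \<and> tangent x e3 \<and> D2 x e1 e1 = 0 \<and> D2 x e3 e3 = 0 \<and>
     D2 x e1 e3 = 2 \<and> D2 x e2 e2 = -4 \<and> D2 x e1 e2 = 0 \<and> D2 x e2 e3 = 0"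

lemma cframe_sym:
  assumes "cframe x e1 e2 e3"
  shows "D2 x e3 e1 = 2" "D2 x e2 e1 = 0" "D2 x e3 e2 = 0"
  using assms D2_sym unfolding cframe_def by metis+

definition gram :: "(nat \<Rightarrow> 'k) \<Rightarrow> (nat \<Rightarrow> 'k) \<Rightarrow> (nat \<Rightarrow> 'k) \<Rightarrow> (nat \<Rightarrow> 'k) \<Rightarrow> 'k" where
  "gram x u v w = D2 x u u * D2 x v v * D2 x w w + 2 * (D2 x u v * D2 x v w * D2 x u w)
     - D2 x u u * (D2 x v w)\<^sup>2 - D2 x v v * (D2 x u w)\<^sup>2 - D2 x w w * (D2 x u v)\<^sup>2"

definition nondeg :: "(nat \<Rightarrow> 'k) \<Rightarrow> bool" where
  "nondeg x \<longleftrightarrow> vec_in n x \<and> meval F x = 0 \<and> (\<exists>j\<le>n. gr x j \<noteq> 0) \<and>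
     (\<exists>u v w. tangent x u \<and> tangent x v \<and> tangent x w \<and> gram x u v w \<noteq> 0)"

lemma otriple_cframe:
  assumes ac: "alg_closed_field TYPE('k)" and o: "otriple x u v w"
  shows "\<exists>e1 e2 e3. cframe x e1 e2 e3"
proof -
  obtain \<iota> :: 'k where i: "\<iota> * \<iota> = -1" using alg_closed_sqrt[OF ac] by blast
  have i2: "\<iota> * (\<iota> * c) = - c" for c using i by (simp add: mult.assoc[symmetric])
  have "cframe x (u \<oplus> \<iota> \<odot> w) ((2 * \<iota>) \<odot> v) (u \<oplus> (- \<iota>) \<odot> w)"
    using o D2_sym[of x v u] D2_sym[of x w u] D2_sym[of x w v] unfolding cframe_def otriple_def
    by (simp add: i i2 algebra_simps)
  then show ?thesis by blast
qed

lemma nondeg_otriple: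
  assumes ac: "alg_closed_field TYPE('k)" and x: "nondeg x"
  shows "\<exists>u v w. otriple x u v w"
proof (rule ccontr)
  assume nt: "\<not> ?thesis"
  have xx: "D1 x x = 0" using x euler by (simp add: nondeg_def)
  obtain u v w where t: "tangent x u" "tangent x v" "tangent x w" and g: "gram x u v w \<noteq> 0"
    using x by (auto simp: nondeg_def)
  show False
  proof (cases rule: quadric_rank_cases[OF ac xx nt])
    case 1
    have "2 * D2 x a b = 0" if "tangent x a" "tangent x b" for a b
      using D2_polar[of x a b] 1[OF tangent_simps(1)[OF that]] 1[OF that(1)] 1[OF that(2)] by simp
    then have "D2 x a b = 0" if "tangent x a" "tangent x b" for a b using that by simp
    then show ?thesis using g t by (simp add: gram_def)
  next
    case (2 \<alpha> a)
    have "gram x u v w = 0" unfolding gram_def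
      by (simp only: 2(1)[OF t(1) t(1)] 2(1)[OF t(2) t(2)] 2(1)[OF t(3) t(3)] 2(1)[OF t(1) t(2)] 2(1)[OF t(1) t(3)] 2(1)[OF t(2) t(3)])
         (simp add: power2_eq_square algebra_simps)
    then show ?thesis using g by simp
  next
    case (3 \<alpha> \<beta> a b)
    have bil: "D2 x y z = (lin_form n \<alpha> y * lin_form n \<beta> z + lin_form n \<beta> y * lin_form n \<alpha> z) / 2"
      if "tangent x y" "tangent x z" for y z
      using 3(1)[OF that] by (simp add: field_simps)
    have "gram x u v w = 0" unfolding gram_def
      by (simp only: bil[OF t(1) t(1)] bil[OF t(2) t(2)] bil[OF t(3) t(3)] bil[OF t(1) t(2)] bil[OF t(1) t(3)] bil[OF t(2) t(3)])
         (simp add: field_simps power2_eq_square)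
    then show ?thesis using g by simp
  qed
qed

lemma nondeg_scale: assumes "nondeg x" "c \<noteq> 0" shows "nondeg (c \<odot> x)"
proof -
  obtain j where j: "j \<le> n" "gr x j \<noteq> 0" using assms by (auto simp: nondeg_def)
  obtain u v w where t: "tangent x u" "tangent x v" "tangent x w" and g: "gram x u v w \<noteq> 0"
    using assms by (auto simp: nondeg_def)
  have "D1 (c \<odot> x) (unitv j) = c ^ (d - 1) * D1 x (unitv j)" by (rule D1_hom)
  then have gj: "gr (c \<odot> x) j \<noteq> 0" using j assms(2) by (simp add: D1_def lin_form_unitv)
  have t': "tangent (c \<odot> x) y" if "tangent x y" for y using that by (simp add: tangent_def D1_hom)
  have "gram (c \<odot> x) u v w = (c ^ (d - 2)) ^ 3 * gram x u v w"
    unfolding gram_def D2_hom[OF assms(2)] by (simp add: power2_eq_square power3_eq_cube algebra_simps)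
  then have "gram (c \<odot> x) u v w \<noteq> 0" using g assms(2) by simp
  then show ?thesis using gj j t t' assms(1) unfolding nondeg_def by (auto simp: hom)
qed

lemma nondeg_open:
  assumes p: "nondeg p" and q: "vec_in n q"
  shows "\<exists>G. G \<noteq> 0 \<and> (\<forall>s. poly G s \<noteq> 0 \<longrightarrow> meval F (p \<oplus> s \<odot> q) = 0 \<longrightarrow> nondeg (p \<oplus> s \<odot> q))"
proof -
  obtain j where j: "j \<le> n" "gr p j \<noteq> 0" using assms by (auto simp: nondeg_def)
  obtain u v w where t: "tangent p u" "tangent p v" "tangent p w" and g: "gram p u v w \<noteq> 0"
    using assms by (auto simp: nondeg_def)
  have vi: "vec_in n u" "vec_in n v" "vec_in n w" "vec_in n p" using t p by (auto simp: tangent_def nondeg_def)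
  define M where "M = formM j u u * formM j v v * formM j w w + MC 2 * (formM j u v * formM j v w * formM j u w)
     - formM j u u * (formM j v w * formM j v w) - formM j v v * (formM j u w * formM j u w) - formM j w w * (formM j u v * formM j u v)"
  have M: "meval M x = gram x (tangent_field j u x) (tangent_field j v x) (tangent_field j w x)" for x
    by (simp add: M_def meval_formM gram_def power2_eq_square)
  define G where "G = evP (pd j F * M) (line p q)"
  have G: "poly G s = gr (p \<oplus> s \<odot> q) j * gram (p \<oplus> s \<odot> q) (tangent_field j u (p \<oplus> s \<odot> q)) (tangent_field j v (p \<oplus> s \<odot> q)) (tangent_field j w (p \<oplus> s \<odot> q))" for s
    by (simp add: G_def poly_evP poly_line M gr_def)
  have p0: "p \<oplus> 0 \<odot> q = p" by (simp add: fun_eq_iff)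
  have f: "tangent_field j y p = gr p j \<odot> y" if "tangent p y" for y using that by (simp add: tangent_field_def tangent_def fun_eq_iff)
  have "gram p (tangent_field j u p) (tangent_field j v p) (tangent_field j w p) = (gr p j) ^ 6 * gram p u v w"
    unfolding f[OF t(1)] f[OF t(2)] f[OF t(3)] gram_def by (simp add: power2_eq_square eval_nat_numeral algebra_simps)
  then have "poly G 0 \<noteq> 0" using G[of 0] j g by (simp add: p0)
  then have "G \<noteq> 0" by auto
  moreover have "nondeg (p \<oplus> s \<odot> q)" if "poly G s \<noteq> 0" "meval F (p \<oplus> s \<odot> q) = 0" for s
  proof -
    have "gr (p \<oplus> s \<odot> q) j \<noteq> 0" "gram (p \<oplus> s \<odot> q) (tangent_field j u (p \<oplus> s \<odot> q)) (tangent_field j v (p \<oplus> s \<odot> q)) (tangent_field j w (p \<oplus> s \<odot> q)) \<noteq> 0"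
      using that(1) unfolding G by auto
    then show ?thesis
      unfolding nondeg_def
      by (intro conjI exI[of _ j] exI[of _ "tangent_field j u (p \<oplus> s \<odot> q)"] exI[of _ "tangent_field j v (p \<oplus> s \<odot> q)"]
          exI[of _ "tangent_field j w (p \<oplus> s \<odot> q)"] tangent_field_tangent j(1) vi vec_in_simps q that(2)) auto
  qed
  ultimately show ?thesis by blast
qed

lemma ruling_smul: "ruling x v \<Longrightarrow> ruling x (c \<odot> v)"
proof -
  assume r: "ruling x v"
  have "x \<oplus> t \<odot> c \<odot> v = x \<oplus> (t * c) \<odot> v" for t by (simp add: fun_eq_iff)
  then show ?thesis using r by (simp add: ruling_def)
qed

lemma ruling_cone:
  assumes r: "ruling x v" shows "meval F (a \<odot> x \<oplus> b \<odot> v) = 0"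
proof (cases "a = 0")
  case True
  then have "a \<odot> x \<oplus> b \<odot> v = b \<odot> v" by (simp add: fun_eq_iff)
  then show ?thesis using ruling_direction[OF r] by (simp add: hom)
next
  case False
  then have "a \<odot> x \<oplus> b \<odot> v = a \<odot> (x \<oplus> (b / a) \<odot> v)" by (simp add: fun_eq_iff algebra_simps)
  then show ?thesis using r by (simp add: ruling_def hom)
qed

lemma ruling_add_point: assumes "ruling x v" shows "ruling x (a \<odot> x \<oplus> v)"
  unfolding ruling_def
proof
  fix t
  have "x \<oplus> t \<odot> (a \<odot> x \<oplus> v) = (1 + t * a) \<odot> x \<oplus> t \<odot> v" by (simp add: fun_eq_iff algebra_simps)
  then show "meval F (x \<oplus> t \<odot> (a \<odot> x \<oplus> v)) = 0" using ruling_cone[OF assms] by simp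
qed

definition eb :: "(nat \<Rightarrow> 'k) \<Rightarrow> (nat \<Rightarrow> 'k) \<Rightarrow> (nat \<Rightarrow> 'k) \<Rightarrow> 'k \<Rightarrow> nat \<Rightarrow> 'k" where
  "eb e1 e2 e3 b = e1 \<oplus> b \<odot> e2 \<oplus> b\<^sup>2 \<odot> e3"

lemma cframe_conic:
  assumes "cframe x e1 e2 e3"
  shows "tangent x (eb e1 e2 e3 b)" "D2 x (eb e1 e2 e3 b) (eb e1 e2 e3 c) = 2 * (b - c)\<^sup>2"
  using assms cframe_sym[OF assms] unfolding cframe_def eb_def
  by (simp_all add: power2_eq_square algebra_simps)

end

lemma (in hform) span_cframe:
  assumes n: "n = 4" and x: "vec_in n x" "meval F x = 0" and f: "vec_in n f" "D1 x f \<noteq> 0"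
    and e: "cframe x e1 e2 e3" and u: "vec_in n u"
  shows "\<exists>a0 a1 a2 a3 a4. u = a0 \<odot> x \<oplus> a1 \<odot> e1 \<oplus> a2 \<odot> e2 \<oplus> a3 \<odot> e3 \<oplus> a4 \<odot> f"
proof -
  have t: "tangent x e1" "tangent x e2" "tangent x e3" "D1 x e1 = 0" "D1 x e2 = 0" "D1 x e3 = 0"
    using e by (auto simp: cframe_def tangent_def)
  have x0: "D1 x x = 0" "x \<noteq> (\<lambda>_. 0)" using x euler smooth_point_nonzero[OF f(2)] by auto
  define U where "U = (\<lambda>l::nat. [x, e1, e2, e3, f, u] ! l)"
  have "card {..4::nat} < card {..5::nat}" by simp
  from homogeneous_system[OF _ _ this, of "\<lambda>r l. U l r"] obtain s where
    s: "\<exists>l\<le>5. s l \<noteq> 0" "\<And>r. r \<le> 4 \<Longrightarrow> (\<Sum>l\<le>5. U l r * s l) = 0" by auto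
  have vv: "vec_in n e1" "vec_in n e2" "vec_in n e3" using t by (auto simp: tangent_def)
  have vin: "x r = 0 \<and> e1 r = 0 \<and> e2 r = 0 \<and> e3 r = 0 \<and> f r = 0 \<and> u r = 0" if "r > 4" for r
    using that n x(1) f(1) u vv by (simp add: vec_in_def)
  have eq: "s 0 \<odot> x \<oplus> s 1 \<odot> e1 \<oplus> s 2 \<odot> e2 \<oplus> s 3 \<odot> e3 \<oplus> s 4 \<odot> f \<oplus> s 5 \<odot> u = (\<lambda>_. 0)"
  proof
    fix r
    show "(s 0 \<odot> x \<oplus> s 1 \<odot> e1 \<oplus> s 2 \<odot> e2 \<oplus> s 3 \<odot> e3 \<oplus> s 4 \<odot> f \<oplus> s 5 \<odot> u) r = 0"
    proof (cases "r \<le> 4")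
      case True
      have "{..5::nat} = {0,1,2,3,4,5}" by auto
      then show ?thesis using s(2)[OF True] by (simp add: U_def mult.commute add.assoc)
    qed (use vin in auto)
  qed
  have D2z: "D2 x (\<lambda>_. 0) v = 0" for v by (simp add: D2_def)
  have "s 5 \<noteq> 0"
  proof
    assume s5: "s 5 = 0"
    have "D1 x (s 0 \<odot> x \<oplus> s 1 \<odot> e1 \<oplus> s 2 \<odot> e2 \<oplus> s 3 \<odot> e3 \<oplus> s 4 \<odot> f \<oplus> s 5 \<odot> u) = 0" unfolding eq by simp
    then have s4: "s 4 = 0" using t x0 f s5 by simp
    have d: "D2 x (s 0 \<odot> x \<oplus> s 1 \<odot> e1 \<oplus> s 2 \<odot> e2 \<oplus> s 3 \<odot> e3 \<oplus> s 4 \<odot> f \<oplus> s 5 \<odot> u) v = 0" for v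
      unfolding eq by (rule D2z)
    note pt = D2_point[OF t(4)] D2_point[OF t(5)] D2_point[OF t(6)]
    have s1: "s 1 = 0" "s 2 = 0" "s 3 = 0"
      using d[of e3] d[of e2] d[of e1] e cframe_sym[OF e] s4 s5 pt by (simp_all add: cframe_def)
    then have "s 0 * x r = 0" for r using fun_cong[OF eq, of r] s4 s5 by simp
    then have "s 0 = 0" using x0(2) by (auto simp: fun_eq_iff)
    then have "\<forall>l\<le>5. s l = 0" using s1 s4 s5 by (auto simp: numeral_eq_Suc le_Suc_eq)
    then show False using s(1) by blast
  qed
  have "u = (- s 0 / s 5) \<odot> x \<oplus> (- s 1 / s 5) \<odot> e1 \<oplus> (- s 2 / s 5) \<odot> e2 \<oplus> (- s 3 / s 5) \<odot> e3 \<oplus> (- s 4 / s 5) \<odot> f"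
  proof
    fix r
    define S where "S = s 0 * x r + s 1 * e1 r + s 2 * e2 r + s 3 * e3 r + s 4 * f r"
    have "S + s 5 * u r = 0" using fun_cong[OF eq, of r] by (simp add: S_def)
    then have "u r = - S / s 5" using \<open>s 5 \<noteq> 0\<close> by (simp add: field_simps eq_neg_iff_add_eq_0)
    then show "u r = ((- s 0 / s 5) \<odot> x \<oplus> (- s 1 / s 5) \<odot> e1 \<oplus> (- s 2 / s 5) \<odot> e2 \<oplus> (- s 3 / s 5) \<odot> e3 \<oplus> (- s 4 / s 5) \<odot> f) r"
      unfolding S_def by (simp add: add_divide_distrib diff_divide_distrib)
  qed
  then show ?thesis by blast
qed

lemma (in hform) cframe_radical:
  assumes n: "n = 4" and x: "vec_in n x" "meval F x = 0" and j: "j \<le> n" "gr x j \<noteq> 0"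
    and e: "cframe x e1 e2 e3" and v: "tangent x v" "\<And>u. tangent x u \<Longrightarrow> D2 x v u = 0"
  shows "\<exists>c. v = c \<odot> x"
proof -
  have fj: "vec_in n (unitv j)" "D1 x (unitv j) \<noteq> 0" using j by (auto simp: vec_in_unitv D1_def lin_form_unitv)
  have t: "tangent x e1" "tangent x e2" "tangent x e3" "D1 x e1 = 0" "D1 x e2 = 0" "D1 x e3 = 0"
    using e by (auto simp: cframe_def tangent_def)
  obtain a0 a1 a2 a3 a4 where a: "v = a0 \<odot> x \<oplus> a1 \<odot> e1 \<oplus> a2 \<odot> e2 \<oplus> a3 \<odot> e3 \<oplus> a4 \<odot> unitv j"
    using span_cframe[OF n x fj e] v(1) unfolding tangent_def by blast
  have "D1 x v = a4 * D1 x (unitv j)" unfolding a using t euler x by simp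
  then have a4: "a4 = 0" using v(1) fj by (simp add: tangent_def)
  note pt = D2_point[OF t(4)] D2_point[OF t(5)] D2_point[OF t(6)]
  have "a1 = 0" "a2 = 0" "a3 = 0"
    using v(2)[OF t(3)] v(2)[OF t(2)] v(2)[OF t(1)] e cframe_sym[OF e] a4 pt unfolding a by (simp_all add: cframe_def)
  then show ?thesis using a a4 by (intro exI[of _ a0]) (simp add: fun_eq_iff)
qed

lemma (in covered_form) isotropic_lines:
  assumes n: "n = 4" and x: "nondeg x" and v: "tangent x v" "D2 x v v = 0"
  shows "ruling x v"
proof -
  obtain e1 e2 e3 where e: "cframe x e1 e2 e3" using nondeg_otriple[OF ac x] otriple_cframe[OF ac] by blast
  obtain j where j: "j \<le> n" "gr x j \<noteq> 0" using x by (auto simp: nondeg_def)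
  have xv: "vec_in n x" "meval F x = 0" using x by (auto simp: nondeg_def)
  have fj: "vec_in n (unitv j)" "D1 x (unitv j) \<noteq> 0" using j by (auto simp: vec_in_unitv D1_def lin_form_unitv)
  define g where "g = eb e1 e2 e3"
  have gt: "tangent x (g b)" for b unfolding g_def by (rule cframe_conic(1)[OF e])
  have gD: "D2 x (g b) (g c) = 2 * (b - c)\<^sup>2" for b c unfolding g_def by (rule cframe_conic(2)[OF e])
  have pair: "ruling x (g b) \<or> ruling x (g c)" if bc: "b \<noteq> c" for b c
  proof -
    have cR: "card {x, g b, g c} < n" using n by (simp add: card_insert_if)
    obtain N \<mu> where N: "{x, g b, g c} \<subseteq> N" "\<And>x'. x' \<in> N \<Longrightarrow> tangent x x'" "\<And>y z. y \<in> N \<Longrightarrow> z \<in> N \<Longrightarrow> y \<oplus> z \<in> N"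
       "\<And>y s. y \<in> N \<Longrightarrow> s \<odot> y \<in> N" "\<And>y. y \<in> N \<Longrightarrow> lin_form n \<mu> y = 0 \<Longrightarrow> ruling x y"
      using lines_in_section[OF xv j _ cR] tangent_self[OF xv] gt by blast
    have gN: "g b \<in> N" "g c \<in> N" using N(1) by auto
    define z where "z = lin_form n \<mu> (g c) \<odot> g b \<oplus> (- lin_form n \<mu> (g b)) \<odot> g c"
    have "z \<in> N" unfolding z_def by (intro N(3,4) gN)
    moreover have "lin_form n \<mu> z = 0" by (simp add: z_def mult.commute)
    ultimately have "D2 x z z = 0" using N(5) ruling_D2 by blast
    then have "lin_form n \<mu> (g c) * lin_form n \<mu> (g b) * (b - c)\<^sup>2 = 0"
      unfolding z_def by (auto simp: gD power2_commute[of c b])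
    then have "lin_form n \<mu> (g c) = 0 \<or> lin_form n \<mu> (g b) = 0" using bc by auto
    then show ?thesis using N(5) gN by blast
  qed
  have rg: "ruling x (g b)" for b
  proof (rule ccontr)
    assume nr: "\<not> ruling x (g b)"
    then obtain t where t: "meval F (x \<oplus> t \<odot> g b) \<noteq> 0" by (auto simp: ruling_def)
    have eq: "(x \<oplus> t \<odot> e1) \<oplus> c \<odot> (t \<odot> e2) \<oplus> c\<^sup>2 \<odot> (t \<odot> e3) = x \<oplus> t \<odot> g c" for c
      by (simp add: fun_eq_iff g_def eb_def algebra_simps)
    have "evP F (curve (x \<oplus> t \<odot> e1) (t \<odot> e2) (t \<odot> e3)) = 0"
    proof (rule poly_eq_0I[of b])
      fix c assume "c \<noteq> b"
      then have "ruling x (g c)" using pair[of b c] nr by blast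
      then show "poly (evP F (curve (x \<oplus> t \<odot> e1) (t \<odot> e2) (t \<odot> e3))) c = 0"
        by (simp only: poly_evP poly_curve eq ruling_def)
    qed
    then have "poly (evP F (curve (x \<oplus> t \<odot> e1) (t \<odot> e2) (t \<odot> e3))) b = 0" by simp
    then show False using t by (simp only: poly_evP poly_curve eq)
  qed
  have r3: "ruling x e3" unfolding ruling_def
  proof
    fix t
    show "meval F (x \<oplus> t \<odot> e3) = 0"
    proof (rule curve_vanish(1)[of "x \<oplus> t \<odot> e3" "t \<odot> e2" "t \<odot> e1"])
      fix a :: 'k assume "a \<noteq> 0"
      then have "(x \<oplus> t \<odot> e3) \<oplus> a \<odot> (t \<odot> e2) \<oplus> a\<^sup>2 \<odot> (t \<odot> e1) = x \<oplus> (t * a\<^sup>2) \<odot> g (inverse a)"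
        by (simp add: fun_eq_iff g_def eb_def field_simps power2_eq_square)
      then show "meval F ((x \<oplus> t \<odot> e3) \<oplus> a \<odot> (t \<odot> e2) \<oplus> a\<^sup>2 \<odot> (t \<odot> e1)) = 0"
        using rg by (simp add: ruling_def)
    qed
  qed
  have t: "D1 x e1 = 0" "D1 x e2 = 0" "D1 x e3 = 0" using e by (auto simp: cframe_def tangent_def)
  obtain a0 z1 z2 z3 a4 where a: "v = a0 \<odot> x \<oplus> z1 \<odot> e1 \<oplus> z2 \<odot> e2 \<oplus> z3 \<odot> e3 \<oplus> a4 \<odot> unitv j"
    using span_cframe[OF n xv fj e] v(1) unfolding tangent_def by blast
  have "D1 x v = a4 * D1 x (unitv j)" unfolding a using t euler xv by simp
  then have a4: "a4 = 0" using v(1) fj by (simp add: tangent_def)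
  note pt = D2_point[OF t(1)] D2_point[OF t(2)] D2_point[OF t(3)]
  have pt': "D2 x e1 x = 0" "D2 x e2 x = 0" "D2 x e3 x = 0" "D2 x x x = 0"
    using pt D2_sym D2_point[of x x] euler xv by (metis, metis, metis, simp)
  have "D2 x v v = 4 * (z1 * z3 - z2 * z2)"
    unfolding a using a4 pt pt' e cframe_sym[OF e] by (simp add: cframe_def algebra_simps)
  then have q: "z1 * z3 = z2 * z2" using v(2) by simp
  have "ruling x (z1 \<odot> e1 \<oplus> z2 \<odot> e2 \<oplus> z3 \<odot> e3)"
  proof (cases "z1 = 0")
    case True
    then have "z1 \<odot> e1 \<oplus> z2 \<odot> e2 \<oplus> z3 \<odot> e3 = z3 \<odot> e3" using q by (simp add: fun_eq_iff)
    then show ?thesis using ruling_smul[OF r3] by simp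
  next
    case False
    have "z1 \<odot> e1 \<oplus> z2 \<odot> e2 \<oplus> z3 \<odot> e3 = z1 \<odot> g (z2 / z1)"
    proof
      fix r
      have "z1 * (z2 / z1)\<^sup>2 = z3" using q False by (simp add: power2_eq_square field_simps)
      then show "(z1 \<odot> e1 \<oplus> z2 \<odot> e2 \<oplus> z3 \<odot> e3) r = (z1 \<odot> g (z2 / z1)) r"
        using False by (simp add: g_def eb_def distrib_left mult.assoc[symmetric])
    qed
    then show ?thesis using ruling_smul[OF rg] by simp
  qed
  then have "ruling x (a0 \<odot> x \<oplus> (z1 \<odot> e1 \<oplus> z2 \<odot> e2 \<oplus> z3 \<odot> e3))" by (rule ruling_add_point)
  moreover have "a0 \<odot> x \<oplus> (z1 \<odot> e1 \<oplus> z2 \<odot> e2 \<oplus> z3 \<odot> e3) = v" unfolding a using a4 by (simp add: fun_eq_iff add.assoc)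
  ultimately show ?thesis by simp
qed

context hform begin

definition ed :: "(nat \<Rightarrow> 'k) \<Rightarrow> (nat \<Rightarrow> 'k) \<Rightarrow> 'k \<Rightarrow> nat \<Rightarrow> 'k" where
  "ed e2 e3 b = e2 \<oplus> (2 * b) \<odot> e3"

definition xb :: "(nat \<Rightarrow> 'k) \<Rightarrow> (nat \<Rightarrow> 'k) \<Rightarrow> (nat \<Rightarrow> 'k) \<Rightarrow> (nat \<Rightarrow> 'k) \<Rightarrow> 'k \<Rightarrow> 'k \<Rightarrow> nat \<Rightarrow> 'k" where
  "xb p e1 e2 e3 \<xi> b = \<xi> \<odot> p \<oplus> eb e1 e2 e3 b"

lemma xb_curve: "xb p e1 e2 e3 \<xi> b \<oplus> t \<odot> (s \<odot> p \<oplus> r \<odot> ed e2 e3 b) \<oplus> t\<^sup>2 \<odot> (r\<^sup>2 \<odot> e3) = xb p e1 e2 e3 (\<xi> + t * s) (b + t * r)"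
  by (simp add: fun_eq_iff xb_def eb_def ed_def algebra_simps power2_eq_square)

lemma xb_curve1: "xb p e1 e2 e3 \<xi> b \<oplus> t \<odot> ed e2 e3 b \<oplus> t\<^sup>2 \<odot> e3 = xb p e1 e2 e3 \<xi> (b + t)"
  by (simp add: fun_eq_iff xb_def eb_def ed_def algebra_simps power2_eq_square)

lemma xb_scale: "\<xi> \<noteq> 0 \<Longrightarrow> xb p e1 e2 e3 \<xi> b = \<xi> \<odot> (p \<oplus> inverse \<xi> \<odot> eb e1 e2 e3 b)"
  by (simp add: fun_eq_iff xb_def algebra_simps)

end

text \<open>An adapted frame at a nondegenerate point \<open>p\<close>: the \<open>e\<^sub>i\<close> span the tangent space modulo \<open>p\<close>, the
  lines through \<open>p\<close> in \<open>X\<close> point in the directions \<open>e\<^sub>1 + b e\<^sub>2 + b\<^sup>2 e\<^sub>3\<close>, and \<open>f\<close> is transversal.\<close>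

locale adapted = covered_form F n d for F :: "'k::field_char_0 mpoly" and n d +
  fixes p e1 e2 e3 f :: "nat \<Rightarrow> 'k"
  assumes n_eq: "n = 4" and ndp: "nondeg p" and cf: "cframe p e1 e2 e3" and fv: "vec_in n f" and f2: "D1 p f = 2"
begin

abbreviation "ebb \<equiv> eb e1 e2 e3"
abbreviation "edd \<equiv> ed e2 e3"
abbreviation "x \<equiv> xb p e1 e2 e3"

lemma pv: "vec_in n p" "meval F p = 0" using ndp by (auto simp: nondeg_def)

lemma e_facts: "vec_in n e1" "vec_in n e2" "vec_in n e3" "D1 p e1 = 0" "D1 p e2 = 0" "D1 p e3 = 0" "D1 p p = 0"
  using cf euler pv by (auto simp: cframe_def tangent_def)

lemma vec_eb: "vec_in n (ebb b)" "vec_in n (edd b)" "vec_in n (x \<xi> b)"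
  using e_facts pv by (auto simp: eb_def ed_def xb_def)

lemma X_x: "meval F (x \<xi> b) = 0"
proof -
  have "ruling p (ebb b)"
    by (rule isotropic_lines[OF n_eq ndp cframe_conic(1)[OF cf]]) (simp add: cframe_conic(2)[OF cf])
  then have "meval F (\<xi> \<odot> p \<oplus> 1 \<odot> ebb b) = 0" by (rule ruling_cone)
  then show ?thesis by (simp add: xb_def vadd_def smul_def)
qed

lemma x_facts:
  "D1 (x \<xi> b) p = 0" "D1 (x \<xi> b) (edd b) = 0" "D2 (x \<xi> b) p p = 0" "D2 (x \<xi> b) p (edd b) = 0"
  "D2 (x \<xi> b) (edd b) (edd b) = - 2 * D1 (x \<xi> b) e3"
proof -
  have 1: "D1 (x \<xi> b) (s \<odot> p \<oplus> r \<odot> edd b) = 0"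
    "D1 (x \<xi> b) (r\<^sup>2 \<odot> e3) + D2 (x \<xi> b) (s \<odot> p \<oplus> r \<odot> edd b) (s \<odot> p \<oplus> r \<odot> edd b) / 2 = 0" for s r
    using curve_vanish[of "x \<xi> b" "s \<odot> p \<oplus> r \<odot> edd b" "r\<^sup>2 \<odot> e3"] by (simp_all only: xb_curve X_x)
  show "D1 (x \<xi> b) p = 0" "D1 (x \<xi> b) (edd b) = 0" using 1(1)[of 1 0] 1(1)[of 0 1] by auto
  show a: "D2 (x \<xi> b) p p = 0" using 1(2)[of 0 1] by simp
  show c: "D2 (x \<xi> b) (edd b) (edd b) = - 2 * D1 (x \<xi> b) e3"
    using 1(2)[of 1 0] by (simp add: field_simps eq_neg_iff_add_eq_0)
  show "D2 (x \<xi> b) p (edd b) = 0"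
    using 1(2)[of 1 1] a c D2_sym[of "x \<xi> b" "edd b" p] by (simp add: field_simps)
qed

lemma x_eb: "D1 (x \<xi> b) (ebb b) = 0" "D2 (x \<xi> b) p (ebb b) = 0"
proof -
  have e: "ebb b = x \<xi> b \<oplus> (- \<xi>) \<odot> p" by (simp add: xb_def fun_eq_iff)
  have "D1 (x \<xi> b) (x \<xi> b) = 0" using euler X_x by simp
  then show "D1 (x \<xi> b) (ebb b) = 0" unfolding e using x_facts by simp
  have "D2 (x \<xi> b) p (x \<xi> b) = 0" using D2_point[OF x_facts(1)] D2_sym by metis
  then show "D2 (x \<xi> b) p (ebb b) = 0" unfolding e using x_facts by simp
qed

definition good :: "'k \<Rightarrow> 'k \<Rightarrow> bool" where
  "good \<xi> b \<longleftrightarrow> nondeg (x \<xi> b) \<and> D1 (x \<xi> b) e3 \<noteq> 0"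

lemma D2_eb_e3: "D2 p (ebb b) e3 = 2" using cf by (simp add: eb_def cframe_def)

lemma finite_bad: "finite {\<xi>. \<not> good \<xi> b}"
proof -
  obtain G where G: "G \<noteq> 0" "\<And>s. poly G s \<noteq> 0 \<Longrightarrow> meval F (p \<oplus> s \<odot> ebb b) = 0 \<Longrightarrow> nondeg (p \<oplus> s \<odot> ebb b)"
    using nondeg_open[OF ndp vec_eb(1)] by blast
  define H where "H = D1P (line p (ebb b)) e3"
  have "coeff H 1 = 2" unfolding H_def line_curve coeff_D1P by (rule D2_eb_e3)
  then have "G * H \<noteq> 0" using G(1) by auto
  then have fin: "finite {s. poly (G * H) s = 0}" by (rule poly_roots_finite)
  have "{\<xi>. \<not> good \<xi> b} \<subseteq> insert 0 (inverse ` {s. poly (G * H) s = 0})"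
  proof
    fix \<xi> assume "\<xi> \<in> {\<xi>. \<not> good \<xi> b}"
    then have ng: "\<not> good \<xi> b" by simp
    show "\<xi> \<in> insert 0 (inverse ` {s. poly (G * H) s = 0})"
    proof (rule ccontr)
      assume n: "\<xi> \<notin> insert 0 (inverse ` {s. poly (G * H) s = 0})"
      then have x0: "\<xi> \<noteq> 0" by auto
      have "poly (G * H) (inverse \<xi>) \<noteq> 0"
      proof
        assume "poly (G * H) (inverse \<xi>) = 0"
        then have "inverse (inverse \<xi>) \<in> inverse ` {s. poly (G * H) s = 0}" by blast
        then show False using n by simp
      qed
      then have g: "poly G (inverse \<xi>) \<noteq> 0" "poly H (inverse \<xi>) \<noteq> 0" by auto
      define y where "y = p \<oplus> inverse \<xi> \<odot> ebb b"
      have xs: "x \<xi> b = \<xi> \<odot> y" unfolding y_def by (rule xb_scale[OF x0])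
      have "meval F y = 0" using X_x[of \<xi> b] x0 unfolding xs by (simp add: hom)
      then have "nondeg y" using G(2) g(1) unfolding y_def by blast
      then have "nondeg (x \<xi> b)" unfolding xs using x0 by (rule nondeg_scale)
      moreover have "D1 (x \<xi> b) e3 \<noteq> 0"
        using g(2) x0 unfolding xs H_def by (simp add: D1_hom poly_D1P poly_line y_def)
      ultimately show False using ng by (simp add: good_def)
    qed
  qed
  then show ?thesis using fin by (meson finite_imageI finite.insertI finite_subset)
qed

lemma good_exists: "finite A \<Longrightarrow> \<exists>\<xi>. \<xi> \<notin> A \<and> good \<xi> b"
proof (rule ccontr)
  assume "finite A" "\<not> ?thesis"
  then have "finite (A \<union> {\<xi>. \<not> good \<xi> b})" "UNIV = A \<union> {\<xi>. \<not> good \<xi> b}" using finite_bad by auto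
  then show False using infinite_UNIV_char_0 by metis
qed

lemma span_p: "vec_in n u \<Longrightarrow> \<exists>a0 a1 a2 a3 a4. u = a0 \<odot> p \<oplus> a1 \<odot> e1 \<oplus> a2 \<odot> e2 \<oplus> a3 \<odot> e3 \<oplus> a4 \<odot> f"
  using span_cframe[OF n_eq pv fv _ cf] f2 by simp

lemma transversal_nonzero:
  assumes g: "good \<xi> b" and w: "D1 (x \<xi> b) (w \<odot> e3 \<oplus> f) = 0"
  shows "D2 (x \<xi> b) p (w \<odot> e3 \<oplus> f) \<noteq> 0"
proof
  assume D: "D2 (x \<xi> b) p (w \<odot> e3 \<oplus> f) = 0"
  define y where "y = x \<xi> b"
  have nd: "nondeg y" and A: "D1 y e3 \<noteq> 0" using g by (auto simp: good_def y_def)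
  obtain u1 u2 u3 where c: "cframe y u1 u2 u3" using nondeg_otriple[OF ac nd] otriple_cframe[OF ac] by blast
  obtain j where j: "j \<le> n" "gr y j \<noteq> 0" using nd by (auto simp: nondeg_def)
  have yv: "vec_in n y" "meval F y = 0" using nd by (auto simp: nondeg_def)
  have tp: "tangent y p" using pv x_facts by (simp add: tangent_def y_def)
  have rad: "D2 y p u = 0" if u: "tangent y u" for u
  proof -
    obtain a0 a1 a2 a3 a4 where a: "u = a0 \<odot> p \<oplus> a1 \<odot> e1 \<oplus> a2 \<odot> e2 \<oplus> a3 \<odot> e3 \<oplus> a4 \<odot> f"
      using span_p u unfolding tangent_def by blast
    define c3 where "c3 = a3 - a1 * b\<^sup>2 - 2 * b * (a2 - a1 * b) - a4 * w"
    have a': "u = a0 \<odot> p \<oplus> a1 \<odot> ebb b \<oplus> (a2 - a1 * b) \<odot> edd b \<oplus> c3 \<odot> e3 \<oplus> a4 \<odot> (w \<odot> e3 \<oplus> f)"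
      unfolding a c3_def by (simp add: fun_eq_iff eb_def ed_def algebra_simps power2_eq_square)
    have "D1 y u = c3 * D1 y e3" unfolding a' y_def using x_facts x_eb w by simp
    then have "c3 = 0" using u A by (simp add: tangent_def)
    then show ?thesis unfolding a' y_def using x_facts x_eb D by simp
  qed
  obtain c where c: "p = c \<odot> y" using cframe_radical[OF n_eq yv j c tp rad] by blast
  have "D2 p p e3 = 0" using D2_point[OF e_facts(6)] .
  then have "D2 p (c \<odot> y) e3 = 0" using c by simp
  then have "c * (\<xi> * D2 p p e3 + D2 p (ebb b) e3) = 0" by (simp add: y_def xb_def)
  then have "c = 0" using D2_eb_e3 D2_point[OF e_facts(6)] by simp
  then have "p = (\<lambda>_. 0)" using c by (simp add: fun_eq_iff)
  then show False using smooth_point_nonzero[of p f] f2 by simp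
qed

text \<open>Along each ruling of the tangent cone at \<open>p\<close>, the tangent hyperplane moves linearly.\<close>

lemma gauss_map_linear:
  "\<exists>\<alpha> B. \<forall>\<xi>. D1 (x \<xi> b) f = (\<alpha> * \<xi> + B) * D1 (x \<xi> b) e3"
proof -
  obtain \<xi> where g: "good \<xi> b" using good_exists[of "{}"] by auto
  define A where "A = D1 (x \<xi> b) e3"
  have A: "A \<noteq> 0" using g by (simp add: good_def A_def)
  define w where "w = - D1 (x \<xi> b) f / A"
  define m where "m = w \<odot> e3 \<oplus> f"
  have m0: "D1 (x \<xi> b) m = 0" using A by (simp add: m_def w_def A_def)
  define D where "D = D2 (x \<xi> b) p m"
  have D: "D \<noteq> 0" unfolding D_def m_def by (rule transversal_nonzero[OF g]) (use m0 in \<open>simp add: m_def\<close>)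
  define E where "E = D2 (x \<xi> b) (edd b) m"
  define E' where "E' = D2 (x \<xi> b) m m"
  have mv: "vec_in n m" using e_facts fv by (simp add: m_def)
  have nd: "nondeg (x \<xi> b)" using g by (simp add: good_def)
  have key: "w * D1 (x \<xi>' b) e3 + D1 (x \<xi>' b) f = \<sigma> * D1 (x \<xi>' b) e3"
    if s: "\<sigma> \<noteq> 0" and xi': "\<xi>' = \<xi> + \<sigma> * A / D" for \<sigma> \<xi>'
  proof -
    define u where "u = (- \<sigma> * E / D) \<odot> p \<oplus> \<sigma> \<odot> edd b"
    define v where "v = (- \<sigma> * E' / (2 * D)) \<odot> p \<oplus> \<sigma> \<odot> m"
    have "meval F (x \<xi>' b \<oplus> t \<odot> u \<oplus> t\<^sup>2 \<odot> v) = 0" if t: "t \<noteq> 0" for t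
    proof -
      define v0 where "v0 = (A / t\<^sup>2 - E / t - E' / 2) / D"
      define z where "z = v0 \<odot> p \<oplus> inverse t \<odot> edd b \<oplus> m"
      have tz: "tangent (x \<xi> b) z" using x_facts m0 pv vec_eb mv by (simp add: z_def tangent_def)
      have "D2 (x \<xi> b) z z = 2 * v0 * D + 2 * inverse t * E + E' - 2 * A * (inverse t * inverse t)"
        unfolding z_def using x_facts[of \<xi> b] D2_sym[of "x \<xi> b" m p] D2_sym[of "x \<xi> b" "edd b" p] D2_sym[of "x \<xi> b" m "edd b"]
        by (simp add: D_def E_def E'_def A_def algebra_simps)
      also have "\<dots> = 0" using D t by (simp add: v0_def field_simps power2_eq_square)
      finally have "ruling (x \<xi> b) z" using isotropic_lines[OF n_eq nd tz] by blast
      then have "meval F (x \<xi> b \<oplus> (\<sigma> * t\<^sup>2) \<odot> z) = 0" by (simp add: ruling_def)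
      moreover have "x \<xi> b \<oplus> (\<sigma> * t\<^sup>2) \<odot> z = x \<xi>' b \<oplus> t \<odot> u \<oplus> t\<^sup>2 \<odot> v"
      proof -
        have a: "\<sigma> * t\<^sup>2 * v0 = \<sigma> * A / D - t * (\<sigma> * E / D) - t\<^sup>2 * (\<sigma> * E' / (2 * D))"
          using D t by (simp add: v0_def field_simps power2_eq_square)
        have c: "\<sigma> * t\<^sup>2 * inverse t = \<sigma> * t" using t by (simp add: power2_eq_square)
        have "x \<xi> b \<oplus> (\<sigma> * t\<^sup>2) \<odot> z = x \<xi> b \<oplus> (\<sigma> * t\<^sup>2 * v0) \<odot> p \<oplus> (\<sigma> * t\<^sup>2 * inverse t) \<odot> edd b \<oplus> (\<sigma> * t\<^sup>2) \<odot> m"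
          by (simp add: z_def fun_eq_iff algebra_simps)
        also have "\<dots> = x \<xi>' b \<oplus> t \<odot> u \<oplus> t\<^sup>2 \<odot> v"
          unfolding a c by (simp add: xi' u_def v_def xb_def fun_eq_iff algebra_simps)
        finally show ?thesis .
      qed
      ultimately show ?thesis by simp
    qed
    then have "D1 (x \<xi>' b) v + D2 (x \<xi>' b) u u / 2 = 0" by (rule curve_vanish(3))
    moreover have "D1 (x \<xi>' b) v = \<sigma> * (w * D1 (x \<xi>' b) e3 + D1 (x \<xi>' b) f)"
      using x_facts by (simp add: v_def m_def)
    moreover have "D2 (x \<xi>' b) u u = - 2 * (\<sigma> * (\<sigma> * D1 (x \<xi>' b) e3))"
      using x_facts[of \<xi>' b] D2_sym[of "x \<xi>' b" "edd b" p] by (simp add: u_def)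
    ultimately have "\<sigma> * (w * D1 (x \<xi>' b) e3 + D1 (x \<xi>' b) f) = \<sigma> * (\<sigma> * D1 (x \<xi>' b) e3)" by simp
    then show ?thesis using s mult_left_cancel by blast
  qed
  have "D1 (x \<xi>' b) f = (D / A * \<xi>' + (- w - \<xi> * D / A)) * D1 (x \<xi>' b) e3" for \<xi>'
  proof (cases "\<xi>' = \<xi>")
    case True
    then show ?thesis using A by (simp add: w_def A_def[symmetric] field_simps)
  next
    case False
    define \<sigma> where "\<sigma> = (\<xi>' - \<xi>) * D / A"
    have "\<sigma> \<noteq> 0" "\<xi>' = \<xi> + \<sigma> * A / D" using False A D by (auto simp: \<sigma>_def field_simps)
    from key[OF this] have "D1 (x \<xi>' b) f = (\<sigma> - w) * D1 (x \<xi>' b) e3" by (simp add: algebra_simps)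
    moreover have "\<sigma> - w = D / A * \<xi>' + (- w - \<xi> * D / A)" by (simp add: \<sigma>_def diff_divide_distrib algebra_simps)
    ultimately show ?thesis by simp
  qed
  then show ?thesis by blast
qed

end

lemma wronskian_zero:
  fixes S A :: "'k::field_char_0 poly"
  assumes A: "A \<noteq> 0" and w: "S * pderiv A = pderiv S * A"
  shows "\<exists>k. S = smult k A"
proof -
  obtain b where b: "poly A b \<noteq> 0" using A poly_all_0_iff_0 by blast
  define k where "k = poly S b / poly A b"
  define h where "h = S - smult k A"
  have hw: "h * pderiv A = pderiv h * A"
    using w by (simp add: h_def pderiv_diff pderiv_smult algebra_simps)
  have h0: "poly h b = 0" using b by (simp add: h_def k_def)
  have "h = 0"
  proof (rule ccontr)
    assume hn: "h \<noteq> 0"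
    define m where "m = order b h"
    define X where "X = [:-b, 1:]"
    obtain g where g: "h = X ^ m * g" "\<not> X dvd g" using order_decomp[OF hn, of b] unfolding m_def X_def by blast
    have gb: "poly g b \<noteq> 0" using g(2) by (simp add: X_def poly_eq_0_iff_dvd)
    have "m \<noteq> 0" using hn h0 by (simp add: m_def order_root)
    then obtain e where e: "m = Suc e" by (cases m) auto
    have dX: "pderiv X = 1" by (simp add: X_def pderiv_pCons one_pCons)
    have d: "pderiv h = X ^ e * (of_nat m * g + X * pderiv g)"
      unfolding g(1) pderiv_mult e pderiv_power_Suc dX by (simp add: algebra_simps of_nat_poly)
    have "X ^ e * ((of_nat m * g + X * pderiv g) * A) = pderiv h * A" unfolding d by (simp only: mult.assoc)
    also have "\<dots> = (X ^ Suc e * g) * pderiv A" using hw g(1) e by simp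
    also have "\<dots> = X ^ e * (X * (g * pderiv A))" by (simp only: power_Suc ac_simps)
    finally have "X ^ e * ((of_nat m * g + X * pderiv g) * A) = X ^ e * (X * (g * pderiv A))" .
    moreover have "X ^ e \<noteq> 0" by (simp add: X_def)
    ultimately have "(of_nat m * g + X * pderiv g) * A = X * (g * pderiv A)" using mult_left_cancel by blast
    then have "poly ((of_nat m * g + X * pderiv g) * A) b = poly (X * (g * pderiv A)) b" by simp
    then have "of_nat m * poly g b * poly A b = 0" by (simp add: X_def)
    then show False using gb b e by (simp del: of_nat_Suc)
  qed
  then show ?thesis by (auto simp: h_def)
qed

context hform begin

lemma K2_sym: "K2 q v a b = K2 q v b a"
proof -
  have "(\<Sum>i\<le>n. \<Sum>j\<le>n. meval (pd j (pd i (pd l F))) q * a i * b j) = (\<Sum>i\<le>n. \<Sum>j\<le>n. meval (pd j (pd i (pd l F))) q * b i * a j)" for l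
    by (subst sum.swap) (simp add: pd_commute[of _ _ "pd l F"] ac_simps)
  then show ?thesis by (simp only: K2_def)
qed

lemma K2_simps1: "K2 q v (a \<oplus> a') b = K2 q v a b + K2 q v a' b" "K2 q v (c \<odot> a) b = c * K2 q v a b"
  by (simp_all add: K2_def algebra_simps sum.distrib sum_distrib_left add_divide_distrib)

lemma K2_simps [simp]:
  "K2 q v (a \<oplus> a') b = K2 q v a b + K2 q v a' b" "K2 q v (c \<odot> a) b = c * K2 q v a b"
  "K2 q v b (a \<oplus> a') = K2 q v b a + K2 q v b a'" "K2 q v b (c \<odot> a) = c * K2 q v b a"
  using K2_simps1 K2_sym by metis+

end

context adapted begin

lemma scale_line: "s \<noteq> 0 \<Longrightarrow> D1 (x (inverse s) b) v = inverse s ^ (d - 1) * D1 (p \<oplus> s \<odot> ebb b) v"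
  using xb_scale[of "inverse s" p e1 e2 e3 b] by (simp add: D1_hom)

lemma D1_e1: "D1 (x \<xi> b) e1 = b\<^sup>2 * D1 (x \<xi> b) e3"
proof -
  have "D1 (x \<xi> b) e2 = - 2 * b * D1 (x \<xi> b) e3"
    using x_facts(2)[of \<xi> b] by (simp add: ed_def eq_neg_iff_add_eq_0)
  then show ?thesis using x_eb(1)[of \<xi> b] by (simp add: eb_def power2_eq_square algebra_simps)
qed

definition kpol :: "(nat \<Rightarrow> 'k) \<Rightarrow> 'k poly" where
  "kpol v = [:K2 p v e1 e1, 2 * K2 p v e1 e2, K2 p v e2 e2 + 2 * K2 p v e1 e3, 2 * K2 p v e2 e3, K2 p v e3 e3:]"

lemma poly_kpol: "poly (kpol v) b = K2 p v (ebb b) (ebb b)"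
  using K2_sym[of p v e2 e1] K2_sym[of p v e3 e1] K2_sym[of p v e3 e2]
  by (simp add: kpol_def eb_def algebra_simps power2_eq_square)

text \<open>The constants \<open>\<alpha>\<close> and \<open>B\<close> are read off at \<open>p\<close>, where \<open>\<xi> = \<infinity>\<close>. A priori \<open>B\<close> has degree four in \<open>b\<close>;
  exchanging the roles of \<open>e\<^sub>1\<close> and \<open>e\<^sub>3\<close> bounds its degree by two.\<close>

lemma gauss_map_quadratic:
  "\<exists>\<beta>0 \<beta>1 \<beta>2. \<forall>\<xi> b. D1 (x \<xi> b) f = (\<xi> + (\<beta>0 + \<beta>1 * b + \<beta>2 * b\<^sup>2)) * D1 (x \<xi> b) e3"
proof -
  have K: "b\<^sup>2 * K2 p e3 (ebb b) (ebb b) = K2 p e1 (ebb b) (ebb b)" for b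
  proof -
    have "D1P (curve p (ebb b) (\<lambda>_. 0)) e1 = smult (b\<^sup>2) (D1P (curve p (ebb b) (\<lambda>_. 0)) e3)"
    proof (rule poly_eqI_except)
      fix s :: 'k assume s: "s \<noteq> 0"
      show "poly (D1P (curve p (ebb b) (\<lambda>_. 0)) e1) s = poly (smult (b\<^sup>2) (D1P (curve p (ebb b) (\<lambda>_. 0)) e3)) s"
        using D1_e1[of "inverse s" b] s
        unfolding scale_line[OF s] by (simp add: poly_D1P line_curve[symmetric] poly_line mult.left_commute)
    qed
    then have "coeff (D1P (curve p (ebb b) (\<lambda>_. 0)) e1) 2 = b\<^sup>2 * coeff (D1P (curve p (ebb b) (\<lambda>_. 0)) e3) 2" by simp
    then show ?thesis unfolding coeff_D1P by simp
  qed
  have "[:0,0,1:] * kpol e3 = kpol e1"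
    by (rule poly_eqI_except) (simp add: poly_kpol K[symmetric] power2_eq_square)
  then have "coeff ([:0,0,1:] * kpol e3) 5 = coeff (kpol e1) 5" "coeff ([:0,0,1:] * kpol e3) 6 = coeff (kpol e1) 6" by auto
  then have k34: "K2 p e2 e3 e3 = K2 p e2 e3 e3" "K2 p e3 e2 e3 = 0" "K2 p e3 e3 e3 = 0"
    by (simp_all add: kpol_def eval_nat_numeral)
  have *: "D1 (x \<xi> b) f = (\<xi> + (D2 p (ebb b) f - K2 p e3 (ebb b) (ebb b)) / 2) * D1 (x \<xi> b) e3" for \<xi> b
  proof -
    obtain \<alpha> B where aB: "\<And>\<xi>. D1 (x \<xi> b) f = (\<alpha> * \<xi> + B) * D1 (x \<xi> b) e3" using gauss_map_linear by blast
    define rf where "rf = D1P (curve p (ebb b) (\<lambda>_. 0)) f"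
    define r3 where "r3 = D1P (curve p (ebb b) (\<lambda>_. 0)) e3"
    have "[:0,1:] * rf = [:\<alpha>, B:] * r3"
    proof (rule poly_eqI_except)
      fix s :: 'k assume s: "s \<noteq> 0"
      have "D1 (p \<oplus> s \<odot> ebb b) f = (\<alpha> * inverse s + B) * D1 (p \<oplus> s \<odot> ebb b) e3"
        using aB[of "inverse s"] s unfolding scale_line[OF s] by simp
      then have "s * D1 (p \<oplus> s \<odot> ebb b) f = (\<alpha> + B * s) * D1 (p \<oplus> s \<odot> ebb b) e3"
        using s by (simp add: field_simps)
      then show "poly ([:0,1:] * rf) s = poly ([:\<alpha>, B:] * r3) s"
        by (simp add: rf_def r3_def poly_D1P line_curve[symmetric] poly_line algebra_simps)
    qed
    then have c: "coeff ([:0,1:] * rf) 1 = coeff ([:\<alpha>, B:] * r3) 1" "coeff ([:0,1:] * rf) 2 = coeff ([:\<alpha>, B:] * r3) 2" by auto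
    have co: "coeff rf 0 = 2" "coeff rf 1 = D2 p (ebb b) f" "coeff r3 0 = 0" "coeff r3 1 = 2" "coeff r3 2 = K2 p e3 (ebb b) (ebb b)"
      unfolding rf_def r3_def coeff_D1P using f2 e_facts D2_eb_e3 by auto
    have a: "\<alpha> = 1" using c(1) co by simp
    then have "D2 p (ebb b) f = K2 p e3 (ebb b) (ebb b) + 2 * B" using c(2) co by (auto simp: numeral_2_eq_2 mult.commute)
    then have "B = (D2 p (ebb b) f - K2 p e3 (ebb b) (ebb b)) / 2" by simp
    then show ?thesis using aB a by simp
  qed
  have "(D2 p (ebb b) f - K2 p e3 (ebb b) (ebb b)) / 2 = (D2 p e1 f - K2 p e3 e1 e1) / 2 + (D2 p e2 f - 2 * K2 p e3 e1 e2) / 2 * b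
     + (D2 p e3 f - (K2 p e3 e2 e2 + 2 * K2 p e3 e1 e3)) / 2 * b\<^sup>2" for b
    unfolding poly_kpol[symmetric] kpol_def by (simp add: k34 eb_def power2_eq_square field_simps)
  then show ?thesis using * by metis
qed

lemma adapted_shift: "adapted F n d p (e1 \<oplus> c1 \<odot> p) (e2 \<oplus> c2 \<odot> p) (e3 \<oplus> c3 \<odot> p) f"
proof unfold_locales
  have pt: "D2 p p v = 0" "D2 p v p = 0" if "D1 p v = 0" for v
    using D2_point[OF that] D2_sym by metis+
  show "cframe p (e1 \<oplus> c1 \<odot> p) (e2 \<oplus> c2 \<odot> p) (e3 \<oplus> c3 \<odot> p)"
    using cf tangent_self[OF pv] pt[OF e_facts(4)] pt[OF e_facts(5)] pt[OF e_facts(6)] pt[OF e_facts(7)]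
    unfolding cframe_def by simp
qed (fact n_eq ndp fv f2)+

lemma adapted_f: "adapted F n d p e1 e2 e3 (f \<oplus> c \<odot> p)"
proof unfold_locales
  show "vec_in n (f \<oplus> c \<odot> p)" "D1 p (f \<oplus> c \<odot> p) = 2" using fv f2 pv e_facts by auto
qed (fact n_eq ndp cf)+

lemma xb_shift: "xb p (e1 \<oplus> c1 \<odot> p) (e2 \<oplus> c2 \<odot> p) (e3 \<oplus> c3 \<odot> p) \<xi> b = x (\<xi> + (c1 + c2 * b + c3 * b\<^sup>2)) b"
  by (simp add: fun_eq_iff xb_def eb_def algebra_simps)

end

locale normal_frame = adapted F n d p e1 e2 e3 f
  for F :: "'k::field_char_0 mpoly" and n d p e1 e2 e3 f +
  assumes normal: "\<And>\<xi> b. D1 (x \<xi> b) f = \<xi> * D1 (x \<xi> b) e3"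
begin

definition nn :: "'k \<Rightarrow> nat \<Rightarrow> 'k" where "nn \<xi> = f \<oplus> (- \<xi>) \<odot> e3"

lemma nn_tangent: "D1 (x \<xi> b) (nn \<xi>) = 0" "vec_in n (nn \<xi>)"
  using normal e_facts fv by (auto simp: nn_def)

lemma nn_facts: "D2 (x \<xi> b) p (nn \<xi>) = D1 (x \<xi> b) e3" "D2 (x \<xi> b) (edd b) (nn \<xi>) = 0"
proof -
  have l: "x \<xi> b \<oplus> t \<odot> p = x (\<xi> + t) b" for t by (simp add: fun_eq_iff xb_def algebra_simps)
  have "D1P (curve (x \<xi> b) p (\<lambda>_. 0)) (nn \<xi>) = [:0,1:] * D1P (curve (x \<xi> b) p (\<lambda>_. 0)) e3"
    by (rule poly_eqI_except) (simp add: poly_D1P line_curve[symmetric] poly_line l nn_def normal algebra_simps)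
  then have "coeff (D1P (curve (x \<xi> b) p (\<lambda>_. 0)) (nn \<xi>)) 1 = coeff ([:0,1:] * D1P (curve (x \<xi> b) p (\<lambda>_. 0)) e3) 1" by simp
  also have "\<dots> = coeff (D1P (curve (x \<xi> b) p (\<lambda>_. 0)) e3) 0" by simp
  finally show "D2 (x \<xi> b) p (nn \<xi>) = D1 (x \<xi> b) e3" unfolding coeff_D1P .
  show "D2 (x \<xi> b) (edd b) (nn \<xi>) = 0"
    by (rule D1_curve_derivative(2)[where w = e3 and a = 0]) (simp add: xb_curve1 nn_tangent)
qed

definition xcurve :: "'k \<Rightarrow> nat \<Rightarrow> 'k poly" where "xcurve \<xi> = curve (x \<xi> 0) (edd 0) e3"

lemma poly_xcurve: "(\<lambda>i. poly (xcurve \<xi> i) b) = x \<xi> b"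
  unfolding xcurve_def poly_curve xb_curve1 by simp

definition Ap :: "'k \<Rightarrow> 'k poly" where "Ap \<xi> = D1P (xcurve \<xi>) e3"
definition Sp :: "'k \<Rightarrow> 'k poly" where "Sp \<xi> = D2P (xcurve \<xi>) (nn \<xi>) (nn \<xi>)"

lemma poly_Ap: "poly (Ap \<xi>) b = D1 (x \<xi> b) e3" by (simp add: Ap_def poly_D1P poly_xcurve)
lemma poly_Sp: "poly (Sp \<xi>) b = D2 (x \<xi> b) (nn \<xi>) (nn \<xi>)" by (simp add: Sp_def poly_D2P poly_xcurve)

text \<open>The isotropic directions at a good point form a conic which meets the ruling through \<open>p\<close>; letting the
  direction tend to that of the ruling along the conic compares the curvatures at the two points to first order in \<open>b\<close>.\<close>

lemma double_zero:
  assumes g: "good \<xi> b"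
  shows "\<exists>c. \<forall>\<xi>'. \<xi>' \<noteq> \<xi> \<longrightarrow> poly (Sp \<xi>' - smult (2 * c) (Ap \<xi>')) b = 0 \<and> poly (pderiv (Sp \<xi>' - smult (2 * c) (Ap \<xi>'))) b = 0"
proof -
  define A where "A = D1 (x \<xi> b) e3"
  have A: "A \<noteq> 0" using g by (simp add: good_def A_def)
  have nd: "nondeg (x \<xi> b)" using g by (simp add: good_def)
  define c where "c = D2 (x \<xi> b) (nn \<xi>) (nn \<xi>) / (2 * A)"
  have cA: "D2 (x \<xi> b) (nn \<xi>) (nn \<xi>) = 2 * c * A" using A by (simp add: c_def)
  show ?thesis
  proof (rule exI[of _ c], rule allI, rule impI)
    fix \<xi>' assume ne: "\<xi>' \<noteq> \<xi>"
    define \<sigma> where "\<sigma> = \<xi>' - \<xi>"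
    have s: "\<sigma> \<noteq> 0" using ne by (simp add: \<sigma>_def)
    define m where "m = nn \<xi>' \<oplus> (- c) \<odot> p"
    have van: "meval F (x \<xi>' (b + t) \<oplus> (t\<^sup>2 / \<sigma>) \<odot> m) = 0" if t: "t \<noteq> 0" for t
    proof -
      define z where "z = (\<sigma>\<^sup>2 / t\<^sup>2 - c) \<odot> p \<oplus> (\<sigma> / t) \<odot> edd b \<oplus> nn \<xi>"
      have tz: "tangent (x \<xi> b) z" using x_facts nn_tangent pv vec_eb by (simp add: z_def tangent_def)
      have "D2 (x \<xi> b) z z = 2 * (\<sigma>\<^sup>2 / t\<^sup>2 - c) * A + 2 * c * A - 2 * A * ((\<sigma> / t) * (\<sigma> / t))"
        unfolding z_def using x_facts[of \<xi> b] nn_facts[of \<xi> b] D2_sym[of "x \<xi> b" "nn \<xi>" p] D2_sym[of "x \<xi> b" "edd b" p]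
          D2_sym[of "x \<xi> b" "nn \<xi>" "edd b"] cA
        by (simp add: A_def[symmetric] algebra_simps)
      also have "\<dots> = 0" using t by (simp add: field_simps power2_eq_square)
      finally have "ruling (x \<xi> b) z" using isotropic_lines[OF n_eq nd tz] by blast
      then have "meval F (x \<xi> b \<oplus> (t\<^sup>2 / \<sigma>) \<odot> z) = 0" by (simp add: ruling_def)
      moreover have "x \<xi> b \<oplus> (t\<^sup>2 / \<sigma>) \<odot> z = x \<xi>' (b + t) \<oplus> (t\<^sup>2 / \<sigma>) \<odot> m"
      proof -
        have a: "t\<^sup>2 / \<sigma> * (\<sigma>\<^sup>2 / t\<^sup>2 - c) = \<sigma> - t\<^sup>2 / \<sigma> * c" "t\<^sup>2 / \<sigma> * (\<sigma> / t) = t" "t\<^sup>2 / \<sigma> * \<xi>' = t\<^sup>2 / \<sigma> * \<xi> + t\<^sup>2"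
          using t s by (simp_all add: field_simps power2_eq_square \<sigma>_def)
        have "x \<xi> b \<oplus> (t\<^sup>2 / \<sigma>) \<odot> z = x \<xi> b \<oplus> (t\<^sup>2 / \<sigma> * (\<sigma>\<^sup>2 / t\<^sup>2 - c)) \<odot> p \<oplus> (t\<^sup>2 / \<sigma> * (\<sigma> / t)) \<odot> edd b
            \<oplus> (t\<^sup>2 / \<sigma>) \<odot> f \<oplus> (- (t\<^sup>2 / \<sigma> * \<xi>)) \<odot> e3"
          by (simp add: z_def nn_def fun_eq_iff algebra_simps)
        also have "\<dots> = x (\<xi> + \<sigma>) b \<oplus> t \<odot> edd b \<oplus> t\<^sup>2 \<odot> e3 \<oplus> (t\<^sup>2 / \<sigma>) \<odot> f \<oplus> (- (t\<^sup>2 / \<sigma> * \<xi> + t\<^sup>2)) \<odot> e3 \<oplus> (- (t\<^sup>2 / \<sigma> * c)) \<odot> p"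
          unfolding a(1,2) by (simp add: xb_def fun_eq_iff algebra_simps)
        also have "\<dots> = x \<xi>' (b + t) \<oplus> (t\<^sup>2 / \<sigma>) \<odot> m"
        proof -
          have "X \<oplus> r \<odot> f \<oplus> (- (r * \<xi>')) \<odot> e3 \<oplus> (- (r * c)) \<odot> p = X \<oplus> r \<odot> m" for r X
            by (simp add: m_def nn_def fun_eq_iff algebra_simps)
          moreover have "\<xi> + \<sigma> = \<xi>'" by (simp add: \<sigma>_def)
          ultimately show ?thesis unfolding a(3)[symmetric] xb_curve1 by (simp only:)
        qed
        finally show ?thesis .
      qed
      ultimately show ?thesis by simp
    qed
    define a where "a = curve (x \<xi>' b) (edd b) e3"
    define y where "y = [:0, 0, 1 / \<sigma>:]"
    have pa: "(\<lambda>i. poly (a i) t) = x \<xi>' (b + t)" for t unfolding a_def poly_curve xb_curve1 ..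
    obtain R where R: "evP F (\<lambda>i. a i + y * [:m i:] + y\<^sup>2 * 0) = evP F a + y * (\<Sum>i<Suc n. evP (pd i F) a * [:m i:])
      + y\<^sup>2 * ((\<Sum>i<Suc n. evP (pd i F) a * 0) + smult (1/2) (\<Sum>i<Suc n. \<Sum>j<Suc n. evP (pd j (pd i F)) a * [:m i:] * [:m j:])) + y ^ 3 * R"
      using taylor2[OF FM, of a y "\<lambda>i. [:m i:]" "\<lambda>_. 0"] by blast
    have 1: "evP F (\<lambda>i. a i + y * [:m i:] + y\<^sup>2 * 0) = 0"
    proof (rule poly_eq_0I[of 0])
      fix t :: 'k assume t: "t \<noteq> 0"
      have "(\<lambda>i. poly (a i + y * [:m i:] + y\<^sup>2 * 0) t) = x \<xi>' (b + t) \<oplus> (t\<^sup>2 / \<sigma>) \<odot> m"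
        unfolding pa[symmetric] by (simp add: fun_eq_iff y_def power2_eq_square)
      then show "poly (evP F (\<lambda>i. a i + y * [:m i:] + y\<^sup>2 * 0)) t = 0" unfolding poly_evP using van[OF t] by simp
    qed
    have 2: "evP F a = 0" by (rule poly_eq_0I[of 0]) (simp add: poly_evP pa X_x)
    have 3: "(\<Sum>i<Suc n. evP (pd i F) a * [:m i:]) = 0"
    proof -
      have "D1P a m = 0" by (rule poly_eq_0I[of 0]) (simp add: poly_D1P pa m_def nn_tangent x_facts)
      then show ?thesis by (simp only: D1P_def lessThan_Suc_atMost)
    qed
    define h where "h = D2P a m m"
    have 4: "(\<Sum>i<Suc n. \<Sum>j<Suc n. evP (pd j (pd i F)) a * [:m i:] * [:m j:]) = h"
      by (simp only: h_def D2P_def lessThan_Suc_atMost)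
    have y0: "y\<^sup>2 \<noteq> 0" using s by (simp add: y_def)
    have "y\<^sup>2 * (smult (1/2) h + y * R) = 0"
      using R unfolding 1 2 3 4 by (simp add: power2_eq_square power3_eq_cube algebra_simps)
    then have "smult (1/2) h + y * R = 0" using y0 by simp
    then have hy: "smult (1/2) h = y * (- R)" by (simp add: eq_neg_iff_add_eq_0)
    have "coeff (smult (1/2) h) 0 = 0" "coeff (smult (1/2) h) 1 = 0" unfolding hy by (simp_all add: y_def)
    then have hc: "coeff h 0 = 0" "coeff h 1 = 0" by auto
    define q where "q = Sp \<xi>' - smult (2 * c) (Ap \<xi>')"
    have hq: "h = pcompose q [:b, 1:]"
    proof (rule poly_eqI_except)
      fix t :: 'k
      have "poly h t = D2 (x \<xi>' (b + t)) m m" unfolding h_def poly_D2P pa ..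
      also have "\<dots> = poly q (b + t)"
        unfolding m_def q_def using x_facts[of \<xi>' "b + t"] nn_facts[of \<xi>' "b + t"] D2_sym[of "x \<xi>' (b + t)" "nn \<xi>'" p]
        by (simp add: poly_Sp poly_Ap algebra_simps)
      finally show "poly h t = poly (pcompose q [:b, 1:]) t" by (simp add: poly_pcompose)
    qed
    have "poly q b = poly h 0" by (simp add: hq poly_pcompose)
    then have "poly q b = 0" using hc by (simp add: poly_0_coeff_0)
    moreover have "poly (pderiv q) b = poly (pderiv h) 0" by (simp add: hq pderiv_pcompose poly_pcompose pderiv_pCons)
    then have "poly (pderiv q) b = 0" using hc by (simp add: poly_0_coeff_0 coeff_pderiv)
    ultimately show "poly (Sp \<xi>' - smult (2 * c) (Ap \<xi>')) b = 0 \<and> poly (pderiv (Sp \<xi>' - smult (2 * c) (Ap \<xi>'))) b = 0"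
      by (simp add: q_def)
  qed
qed

lemma normal_curvature_constant: "\<exists>k. \<forall>\<xi> b. D2 (x \<xi> b) (nn \<xi>) (nn \<xi>) = k * D1 (x \<xi> b) e3"
proof -
  have pro: "\<exists>k. Sp \<xi> = smult k (Ap \<xi>)" for \<xi>
  proof (cases "Ap \<xi> = 0")
    case True
    have "Sp \<xi> = 0"
    proof (rule poly_eq_0I)
      fix b
      obtain \<xi>1 where "good \<xi>1 b" "\<xi> \<noteq> \<xi>1" using good_exists[of "{\<xi>}" b] by auto
      then obtain c where "poly (Sp \<xi> - smult (2 * c) (Ap \<xi>)) b = 0" using double_zero by blast
      then show "poly (Sp \<xi>) b = 0" using True by simp
    qed
    then show ?thesis by (intro exI[of _ 0]) simp
  next
    case False
    have "Sp \<xi> * pderiv (Ap \<xi>) = pderiv (Sp \<xi>) * Ap \<xi>"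
    proof (rule poly_eqI_except)
      fix b
      obtain \<xi>1 where "good \<xi>1 b" "\<xi> \<noteq> \<xi>1" using good_exists[of "{\<xi>}" b] by auto
      then obtain c where "poly (Sp \<xi> - smult (2 * c) (Ap \<xi>)) b = 0" "poly (pderiv (Sp \<xi> - smult (2 * c) (Ap \<xi>))) b = 0"
        using double_zero by blast
      then have "poly (Sp \<xi>) b = 2 * c * poly (Ap \<xi>) b" "poly (pderiv (Sp \<xi>)) b = 2 * c * poly (pderiv (Ap \<xi>)) b"
        by (simp_all add: pderiv_diff pderiv_smult)
      then show "poly (Sp \<xi> * pderiv (Ap \<xi>)) b = poly (pderiv (Sp \<xi>) * Ap \<xi>) b" by simp
    qed
    then show ?thesis by (rule wronskian_zero[OF False])
  qed
  obtain \<xi>0 where "good \<xi>0 0" using good_exists[of "{}"] by auto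
  then have A0: "Ap \<xi>0 \<noteq> 0" using poly_Ap[of \<xi>0 0] by (auto simp: good_def)
  obtain k where k: "Sp \<xi>0 = smult k (Ap \<xi>0)" using pro by blast
  have "Sp \<xi> = smult k (Ap \<xi>)" for \<xi>
  proof (cases "Ap \<xi> = 0")
    case True then show ?thesis using pro[of \<xi>] by auto
  next
    case False
    obtain k' where k': "Sp \<xi> = smult k' (Ap \<xi>)" using pro by blast
    have "Ap \<xi> * Ap \<xi>0 \<noteq> 0" using False A0 by simp
    then obtain b where "poly (Ap \<xi> * Ap \<xi>0) b \<noteq> 0" using poly_all_0_iff_0 by blast
    then have b: "poly (Ap \<xi>) b \<noteq> 0" "poly (Ap \<xi>0) b \<noteq> 0" by auto
    obtain \<xi>1 where x1: "good \<xi>1 b" "\<xi> \<noteq> \<xi>1" "\<xi>0 \<noteq> \<xi>1" using good_exists[of "{\<xi>, \<xi>0}" b] by auto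
    then obtain c where "poly (Sp \<xi> - smult (2 * c) (Ap \<xi>)) b = 0" "poly (Sp \<xi>0 - smult (2 * c) (Ap \<xi>0)) b = 0"
      using double_zero[OF x1(1)] by blast
    then have "k' = 2 * c" "k = 2 * c" using b by (simp_all add: k k')
    then show ?thesis using k' by simp
  qed
  then have "poly (Sp \<xi>) b = k * poly (Ap \<xi>) b" for \<xi> b by simp
  then show ?thesis unfolding poly_Sp poly_Ap by blast
qed

end

locale ruled_quadric = normal_frame F n d p e1 e2 e3 f
  for F :: "'k::field_char_0 mpoly" and n d p e1 e2 e3 f +
  assumes flat: "\<And>\<xi> b. D2 (x \<xi> b) (nn \<xi>) (nn \<xi>) = 0"
begin

lemma quadric_chart: "meval F (x \<xi> b \<oplus> y \<odot> nn \<xi>) = 0"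
proof -
  define P where "P = evP F (line (ebb b \<oplus> y \<odot> f) (p \<oplus> (- y) \<odot> e3))"
  have P: "poly P t = meval F (x t b \<oplus> y \<odot> nn t)" for t
  proof -
    have "(ebb b \<oplus> y \<odot> f) \<oplus> t \<odot> (p \<oplus> (- y) \<odot> e3) = x t b \<oplus> y \<odot> nn t"
      by (simp add: fun_eq_iff xb_def nn_def algebra_simps)
    then show ?thesis by (simp add: P_def poly_evP poly_line)
  qed
  have "{t. poly P t \<noteq> 0} \<subseteq> {\<xi>. \<not> good \<xi> b}"
  proof
    fix t assume "t \<in> {t. poly P t \<noteq> 0}"
    then have "\<not> ruling (x t b) (nn t)" by (auto simp: P ruling_def)
    moreover have "tangent (x t b) (nn t)" using nn_tangent by (simp add: tangent_def)
    ultimately have "\<not> nondeg (x t b)" using isotropic_lines[OF n_eq] flat by blast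
    then show "t \<in> {\<xi>. \<not> good \<xi> b}" by (simp add: good_def)
  qed
  then have fin: "finite {t. poly P t \<noteq> 0}" using finite_bad finite_subset by blast
  have "P = 0"
  proof (rule ccontr)
    assume "P \<noteq> 0"
    then have "finite ({t. poly P t = 0} \<union> {t. poly P t \<noteq> 0})" using poly_roots_finite fin by blast
    moreover have "{t. poly P t = 0} \<union> {t. poly P t \<noteq> 0} = UNIV" by auto
    ultimately show False using infinite_UNIV_char_0[where 'a = 'k] by simp
  qed
  then show ?thesis using P[of \<xi>] by simp
qed

definition yM :: "'k mpoly" where "yM = MC (1/2) * linM (gr p)"

definition zM :: "(nat \<Rightarrow> 'k) \<Rightarrow> 'k \<Rightarrow> 'k mpoly" where
  "zM e c = MC c * (linM (hf p e) - MC (D2 p f e) * yM)"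

definition x0M :: "nat \<Rightarrow> 'k mpoly" where
  "x0M i = MC (1 / p i) * (MX i - zM e3 (1/2) * MC (e1 i) - zM e2 (-1/4) * MC (e2 i) - zM e1 (1/2) * MC (e3 i) - yM * MC (f i))"

definition QM :: "nat \<Rightarrow> 'k mpoly" where
  "QM i = zM e3 (1/2) * zM e1 (1/2) - zM e2 (-1/4) * zM e2 (-1/4) + yM * x0M i"

lemma coords_scale:
  "meval yM (c \<odot> u) = c * meval yM u" "meval (zM e a) (c \<odot> u) = c * meval (zM e a) u"
  "meval (x0M i) (c \<odot> u) = c * meval (x0M i) u"
  by (simp_all add: yM_def zM_def x0M_def meval_linM algebra_simps)

lemma QM_scale: "meval (QM i) (c \<odot> u) = c\<^sup>2 * meval (QM i) u"
  by (simp add: QM_def coords_scale power2_eq_square algebra_simps)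

lemma coords:
  assumes i: "p i \<noteq> 0" and u: "u = a0 \<odot> p \<oplus> a1 \<odot> e1 \<oplus> a2 \<odot> e2 \<oplus> a3 \<odot> e3 \<oplus> a4 \<odot> f"
  shows "meval yM u = a4" "meval (zM e3 (1/2)) u = a1" "meval (zM e2 (-1/4)) u = a2" "meval (zM e1 (1/2)) u = a3"
    "meval (x0M i) u = a0"
proof -
  note t = D2_point[OF e_facts(4)] D2_point[OF e_facts(5)] D2_point[OF e_facts(6)]
  have "lin_form n (gr p) u = D1 p u" by (simp add: D1_def)
  then show y: "meval yM u = a4" unfolding yM_def u using e_facts f2 by (simp add: meval_linM)
  have h: "lin_form n (hf p e) u = D2 p u e" for e by (rule lin_form_hf)
  show z1: "meval (zM e3 (1/2)) u = a1" unfolding zM_def meval_simps meval_diff y meval_linM h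
    unfolding u using cf cframe_sym[OF cf] t by (simp add: cframe_def)
  show z2: "meval (zM e2 (-1/4)) u = a2" unfolding zM_def meval_simps meval_diff y meval_linM h
    unfolding u using cf cframe_sym[OF cf] t by (simp add: cframe_def)
  show z3: "meval (zM e1 (1/2)) u = a3" unfolding zM_def meval_simps meval_diff y meval_linM h
    unfolding u using cf cframe_sym[OF cf] t by (simp add: cframe_def)
  show "meval (x0M i) u = a0" unfolding x0M_def meval_simps meval_diff y z1 z2 z3
    unfolding u using i by (simp add: field_simps)
qed

lemma meval_trunc_coords:
  assumes "i \<le> n"
  shows "meval (zM e a) (trunc u) = meval (zM e a) u" "meval (QM i) (trunc u) = meval (QM i) u"
proof -
  have l: "lin_form n v (trunc u) = lin_form n v u" for v by (simp add: lin_form_def trunc_def)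
  have 1: "meval yM (trunc u) = meval yM u" by (simp add: yM_def meval_linM l)
  show 2: "meval (zM e a) (trunc u) = meval (zM e a) u" for e a by (simp add: zM_def meval_linM l 1)
  show "meval (QM i) (trunc u) = meval (QM i) u" using assms by (simp add: QM_def x0M_def 1 2 trunc_def)
qed

lemma quadric_degree:
  assumes irr: "irreducible F" shows "d \<le> 2"
proof -
  have "p \<noteq> (\<lambda>_. 0)" using smooth_point_nonzero[of p f] f2 by simp
  then obtain i where i: "p i \<noteq> 0" by auto
  then have ile: "i \<le> n" using pv by (auto simp: vec_in_def not_le[symmetric])
  have q1: "meval (QM i) e1 = 0" "meval (zM e3 (1/2)) e1 = 1"
  proof -
    have "e1 = 0 \<odot> p \<oplus> 1 \<odot> e1 \<oplus> 0 \<odot> e2 \<oplus> 0 \<odot> e3 \<oplus> 0 \<odot> f" by (simp add: fun_eq_iff)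
    from coords[OF i this] show "meval (QM i) e1 = 0" "meval (zM e3 (1/2)) e1 = 1" by (simp_all add: QM_def)
  qed
  have q2: "meval (QM i) e2 = -1"
  proof -
    have "e2 = 0 \<odot> p \<oplus> 0 \<odot> e1 \<oplus> 1 \<odot> e2 \<oplus> 0 \<odot> e3 \<oplus> 0 \<odot> f" by (simp add: fun_eq_iff)
    from coords[OF i this] show ?thesis by (simp add: QM_def)
  qed
  have van: "meval F u = 0" if u0: "meval (QM i) u = 0" "meval (zM e3 (1/2)) u \<noteq> 0" for u
  proof -
    define v where "v = trunc u"
    obtain a0 a1 a2 a3 a4 where a: "v = a0 \<odot> p \<oplus> a1 \<odot> e1 \<oplus> a2 \<odot> e2 \<oplus> a3 \<odot> e3 \<oplus> a4 \<odot> f"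
      using span_p[of v] trunc(1)[of u] unfolding v_def by blast
    note c = coords[OF i a]
    have a1: "a1 \<noteq> 0" using u0(2) c(2) meval_trunc_coords(1)[OF ile] by (simp add: v_def)
    have "meval (QM i) v = 0" using u0(1) meval_trunc_coords(2)[OF ile] by (simp add: v_def)
    then have q: "a1 * a3 = a2 * a2 - a4 * a0"
      unfolding QM_def meval_simps meval_diff c by (simp add: algebra_simps)
    have "v = a1 \<odot> (x (a0 / a1) (a2 / a1) \<oplus> (a4 / a1) \<odot> nn (a0 / a1))"
    proof
      fix r
      have "a1 * (a1 * ((a2 / a1)\<^sup>2 - a4 / a1 * (a0 / a1))) = a2 * a2 - a4 * a0"
        using a1 by (simp add: field_simps power2_eq_square)
      then have e: "a3 = a1 * ((a2 / a1)\<^sup>2 - a4 / a1 * (a0 / a1))" using q a1 mult_left_cancel by metis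
      show "v r = (a1 \<odot> (x (a0 / a1) (a2 / a1) \<oplus> (a4 / a1) \<odot> nn (a0 / a1))) r"
        unfolding a vapp e xb_def eb_def nn_def using a1 by (simp add: algebra_simps)
    qed
    then have "meval F v = 0" using quadric_chart by (simp add: hom)
    then show ?thesis using trunc(2)[OF FM] by (simp add: v_def)
  qed
  have nz: "QM i \<noteq> 0" using q2 by auto
  have "F dvd QM i"
    by (rule irreducible_dvd_of_vanishing[OF ac irr nz q1(1), of "zM e3 (1/2)"]) (use q1 van in auto)
  then show ?thesis by (rule dvd_homogeneous_degree[OF _ nz QM_scale])
qed

end

lemma (in normal_frame) ruled_quadric_exists: "\<exists>k. ruled_quadric F n d p e1 e2 e3 (f \<oplus> k \<odot> p)"
proof -
  obtain k where k: "\<And>\<xi> b. D2 (x \<xi> b) (nn \<xi>) (nn \<xi>) = k * D1 (x \<xi> b) e3"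
    using normal_curvature_constant by blast
  interpret a: adapted F n d p e1 e2 e3 "f \<oplus> (- (k / 2)) \<odot> p" by (rule adapted_f)
  interpret b: normal_frame F n d p e1 e2 e3 "f \<oplus> (- (k / 2)) \<odot> p"
    by unfold_locales (simp add: x_facts normal)
  have "b.nn \<xi> = nn \<xi> \<oplus> (- (k / 2)) \<odot> p" for \<xi> by (simp add: b.nn_def nn_def fun_eq_iff)
  then have "D2 (x \<xi> b) (b.nn \<xi>) (b.nn \<xi>) = 0" for \<xi> b
    using k[of \<xi> b] nn_facts[of \<xi> b] x_facts[of \<xi> b] D2_sym[of "x \<xi> b" "nn \<xi>" p] by simp
  then have "ruled_quadric F n d p e1 e2 e3 (f \<oplus> (- (k / 2)) \<odot> p)" by unfold_locales
  then show ?thesis by blast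
qed

lemma (in adapted) normal_frame_exists: "\<exists>c1 c2 c3. normal_frame F n d p (e1 \<oplus> c1 \<odot> p) (e2 \<oplus> c2 \<odot> p) (e3 \<oplus> c3 \<odot> p) f"
proof -
  obtain c1 c2 c3 where c: "\<And>\<xi> b. D1 (x \<xi> b) f = (\<xi> + (c1 + c2 * b + c3 * b\<^sup>2)) * D1 (x \<xi> b) e3"
    using gauss_map_quadratic by blast
  interpret a: adapted F n d p "e1 \<oplus> (- c1) \<odot> p" "e2 \<oplus> (- c2) \<odot> p" "e3 \<oplus> (- c3) \<odot> p" f by (rule adapted_shift)
  have "normal_frame F n d p (e1 \<oplus> (- c1) \<odot> p) (e2 \<oplus> (- c2) \<odot> p) (e3 \<oplus> (- c3) \<odot> p) f"
  proof unfold_locales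
    fix \<xi> b
    have "\<xi> + (- c1 + - c2 * b + - c3 * b\<^sup>2) + (c1 + c2 * b + c3 * b\<^sup>2) = \<xi>" by simp
    then show "D1 (a.x \<xi> b) f = \<xi> * D1 (a.x \<xi> b) (e3 \<oplus> (- c3) \<odot> p)"
      unfolding xb_shift using c x_facts by simp
  qed
  then show ?thesis by blast
qed

lemma (in covered_form) nondeg_threefold_degree:
  assumes irr: "irreducible F" and n: "n = 4" and p: "nondeg p" shows "d \<le> 2"
proof -
  obtain e1 e2 e3 where e: "cframe p e1 e2 e3" using nondeg_otriple[OF ac p] otriple_cframe[OF ac] by blast
  obtain j where j: "j \<le> n" "gr p j \<noteq> 0" using p by (auto simp: nondeg_def)
  have "D1 p ((2 / gr p j) \<odot> unitv j) = 2" using j by (simp add: D1_def lin_form_unitv)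
  then interpret adapted F n d p e1 e2 e3 "(2 / gr p j) \<odot> unitv j"
    using n p e j by unfold_locales (auto simp: vec_in_unitv)
  obtain c1 c2 c3 where "normal_frame F n d p (e1 \<oplus> c1 \<odot> p) (e2 \<oplus> c2 \<odot> p) (e3 \<oplus> c3 \<odot> p) ((2 / gr p j) \<odot> unitv j)"
    using normal_frame_exists by blast
  then interpret b: normal_frame F n d p "e1 \<oplus> c1 \<odot> p" "e2 \<oplus> c2 \<odot> p" "e3 \<oplus> c3 \<odot> p" "(2 / gr p j) \<odot> unitv j" .
  obtain k where "ruled_quadric F n d p (e1 \<oplus> c1 \<odot> p) (e2 \<oplus> c2 \<odot> p) (e3 \<oplus> c3 \<odot> p) ((2 / gr p j) \<odot> unitv j \<oplus> k \<odot> p)"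
    using b.ruled_quadric_exists by blast
  then show ?thesis by (rule ruled_quadric.quadric_degree[OF _ irr])
qed

section \<open>Places and limits of linear subspaces\<close>

definition fun_alg :: "('u \<Rightarrow> 'k::field) set \<Rightarrow> bool" where
  "fun_alg G \<longleftrightarrow> (\<forall>c. (\<lambda>_. c) \<in> G) \<and> (\<forall>f\<in>G. \<forall>g\<in>G. (\<lambda>u. f u + g u) \<in> G \<and> (\<lambda>u. f u * g u) \<in> G)"

definition determines :: "'u set \<Rightarrow> 'u \<Rightarrow> ('u \<Rightarrow> 'k::field) set \<Rightarrow> bool" where
  "determines U z G \<longleftrightarrow> (\<forall>f\<in>G. (\<forall>u\<in>U. f u = 0) \<longrightarrow> f z = 0)"

lemma fun_algD:
  assumes "fun_alg G"
  shows "(\<lambda>_. c) \<in> G" "f \<in> G \<Longrightarrow> g \<in> G \<Longrightarrow> (\<lambda>u. f u + g u) \<in> G" "f \<in> G \<Longrightarrow> g \<in> G \<Longrightarrow> (\<lambda>u. f u * g u) \<in> G"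
    "f \<in> G \<Longrightarrow> (\<lambda>u. - f u) \<in> G" "f \<in> G \<Longrightarrow> g \<in> G \<Longrightarrow> (\<lambda>u. f u - g u) \<in> G"
proof -
  show 1: "(\<lambda>_. c) \<in> G" "f \<in> G \<Longrightarrow> g \<in> G \<Longrightarrow> (\<lambda>u. f u + g u) \<in> G" "f \<in> G \<Longrightarrow> g \<in> G \<Longrightarrow> (\<lambda>u. f u * g u) \<in> G" for c f g
    using assms by (auto simp: fun_alg_def)
  show 2: "f \<in> G \<Longrightarrow> (\<lambda>u. - f u) \<in> G" for f using 1(3)[OF 1(1)[of "-1"], of f] by simp
  show "f \<in> G \<Longrightarrow> g \<in> G \<Longrightarrow> (\<lambda>u. f u - g u) \<in> G" using 1(2)[OF _ 2, of f g] by simp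
qed

lemma fun_alg_sum: "fun_alg G \<Longrightarrow> (\<And>i. i \<in> I \<Longrightarrow> f i \<in> G) \<Longrightarrow> (\<lambda>u. \<Sum>i\<in>I. f i u) \<in> G"
  by (induction I rule: infinite_finite_induct) (auto intro: fun_algD)

lemma maximal_fun_alg:
  assumes "fun_alg G0" "determines U z G0"
  shows "\<exists>G. G0 \<subseteq> G \<and> fun_alg G \<and> determines U z G \<and>
    (\<forall>H. fun_alg H \<longrightarrow> determines U z H \<longrightarrow> G \<subseteq> H \<longrightarrow> H = G)"
proof -
  define \<A> where "\<A> = {G. G0 \<subseteq> G \<and> fun_alg G \<and> determines U z G}"
  have "\<exists>M\<in>\<A>. \<forall>X\<in>\<A>. M \<subseteq> X \<longrightarrow> X = M"
  proof (rule subset_Zorn_nonempty)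
    show "\<A> \<noteq> {}" using assms by (auto simp: \<A>_def)
    fix C assume C: "C \<noteq> {}" "subset.chain \<A> C"
    have CA: "c \<in> C \<Longrightarrow> c \<in> \<A>" for c using C(2) by (auto simp: subset.chain_def)
    have two: "\<exists>c\<in>C. f \<in> c \<and> g \<in> c" if "f \<in> \<Union>C" "g \<in> \<Union>C" for f g
    proof -
      obtain a b where ab: "a \<in> C" "b \<in> C" "f \<in> a" "g \<in> b" using \<open>f \<in> \<Union>C\<close> \<open>g \<in> \<Union>C\<close> by blast
      then have "a \<subseteq> b \<or> b \<subseteq> a" using C(2) unfolding subset_chain_def by blast
      then show ?thesis using ab by blast
    qed
    have "fun_alg (\<Union>C)" unfolding fun_alg_def
    proof (intro conjI allI ballI)
      fix c :: 'b
      obtain A where "A \<in> C" using C(1) by blast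
      then show "(\<lambda>_. c) \<in> \<Union>C" using CA fun_algD(1) unfolding \<A>_def by blast
    next
      fix f g assume "f \<in> \<Union>C" "g \<in> \<Union>C"
      then obtain c where c: "c \<in> C" "f \<in> c" "g \<in> c" using two by blast
      then have "fun_alg c" using CA by (auto simp: \<A>_def)
      then show "(\<lambda>u. f u + g u) \<in> \<Union>C" "(\<lambda>u. f u * g u) \<in> \<Union>C" using c fun_algD(2,3)[of c f g] by blast+
    qed
    moreover have "determines U z (\<Union>C)" using CA unfolding determines_def \<A>_def by blast
    moreover have "G0 \<subseteq> \<Union>C" using C(1) CA unfolding \<A>_def by blast
    ultimately show "\<Union>C \<in> \<A>" by (simp add: \<A>_def)
  qed
  then obtain M where M: "M \<in> \<A>" "\<And>X. X \<in> \<A> \<Longrightarrow> M \<subseteq> X \<Longrightarrow> X = M" by blast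
  then show ?thesis by (intro exI[of _ M]) (auto simp: \<A>_def)
qed

locale place =
  fixes U :: "'u set" and z :: 'u and G :: "('u \<Rightarrow> 'k::field) set"
  assumes acl: "alg_closed_field TYPE('k)" and zU: "z \<notin> U" and alg: "fun_alg G" and det: "determines U z G"
    and maxG: "\<And>H. fun_alg H \<Longrightarrow> determines U z H \<Longrightarrow> G \<subseteq> H \<Longrightarrow> H = G"
begin

definition GP :: "('u \<Rightarrow> 'k poly) set" where "GP = {q. \<forall>i. (\<lambda>u. coeff (q u) i) \<in> G}"

lemma GP_const: "f \<in> G \<Longrightarrow> (\<lambda>u. [:f u:]) \<in> GP"
  unfolding GP_def
proof (intro CollectI allI)
  fix i assume "f \<in> G"
  then show "(\<lambda>u. coeff [:f u:] i) \<in> G" by (cases i) (auto intro: fun_algD[OF alg])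
qed

lemma GP_add: "p \<in> GP \<Longrightarrow> q \<in> GP \<Longrightarrow> (\<lambda>u. p u + q u) \<in> GP"
  by (auto simp: GP_def intro: fun_algD[OF alg])

lemma GP_diff: "p \<in> GP \<Longrightarrow> q \<in> GP \<Longrightarrow> (\<lambda>u. p u - q u) \<in> GP"
  by (auto simp: GP_def intro: fun_algD[OF alg])

lemma GP_mult: "p \<in> GP \<Longrightarrow> q \<in> GP \<Longrightarrow> (\<lambda>u. p u * q u) \<in> GP"
  by (auto simp: GP_def coeff_mult intro!: fun_alg_sum[OF alg] fun_algD(3)[OF alg])

lemma GP_poly: "(\<lambda>u. r) \<in> GP" for r :: "'k poly"
  by (auto simp: GP_def intro: fun_algD[OF alg])

text \<open>An algebraic obstruction of degree \<open>m\<close> to extending the place to \<open>\<phi>\<close>: an equation over \<open>G\<close>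
  satisfied by \<open>\<phi>\<close> on \<open>U\<close> which specializes to \<open>1 = 0\<close> at \<open>z\<close>.\<close>

definition obstruction :: "('u \<Rightarrow> 'k) \<Rightarrow> nat \<Rightarrow> bool" where
  "obstruction \<phi> m \<longleftrightarrow> (\<exists>q\<in>GP. q z = 1 \<and> (\<forall>u. degree (q u) \<le> m) \<and> (\<forall>u\<in>U. poly (q u) (\<phi> u) = 0))"

definition GP_bounded :: "('u \<Rightarrow> 'k poly) set" where "GP_bounded = {q\<in>GP. \<exists>m. \<forall>u. degree (q u) \<le> m}"

lemma bounded_add: "p \<in> GP_bounded \<Longrightarrow> q \<in> GP_bounded \<Longrightarrow> (\<lambda>u. p u + q u) \<in> GP_bounded"
proof -
  assume a: "p \<in> GP_bounded" "q \<in> GP_bounded"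
  then obtain m k where "\<forall>u. degree (p u) \<le> m" "\<forall>u. degree (q u) \<le> k" by (auto simp: GP_bounded_def)
  then have "\<forall>u. degree (p u + q u) \<le> max m k" by (meson degree_add_le max.coboundedI1 max.coboundedI2)
  then show ?thesis using a GP_add by (auto simp: GP_bounded_def)
qed

lemma bounded_mult: "p \<in> GP_bounded \<Longrightarrow> q \<in> GP_bounded \<Longrightarrow> (\<lambda>u. p u * q u) \<in> GP_bounded"
proof -
  assume a: "p \<in> GP_bounded" "q \<in> GP_bounded"
  then obtain m k where "\<forall>u. degree (p u) \<le> m" "\<forall>u. degree (q u) \<le> k" by (auto simp: GP_bounded_def)
  then have "\<forall>u. degree (p u * q u) \<le> m + k" by (meson add_mono degree_mult_le order_trans)
  then show ?thesis using a GP_mult by (auto simp: GP_bounded_def)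
qed

lemma bounded_const: "f \<in> G \<Longrightarrow> (\<lambda>u. [:f u:]) \<in> GP_bounded" "(\<lambda>u. r) \<in> GP_bounded" for r :: "'k poly"
  using GP_const GP_poly by (auto simp: GP_bounded_def)

lemma extend_or_obstruction:
  "(\<exists>f\<in>G. \<forall>u\<in>U. f u = \<phi> u) \<or> (\<exists>m. obstruction \<phi> m)"
proof (cases "\<exists>c. \<forall>q\<in>GP_bounded. (\<forall>u\<in>U. poly (q u) (\<phi> u) = 0) \<longrightarrow> poly (q z) c = 0")
  case True
  then obtain c where c: "\<And>q. q \<in> GP_bounded \<Longrightarrow> (\<forall>u\<in>U. poly (q u) (\<phi> u) = 0) \<Longrightarrow> poly (q z) c = 0" by blast
  define \<psi> where "\<psi> = \<phi>(z := c)"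
  have psi: "\<psi> z = c" "u \<in> U \<Longrightarrow> \<psi> u = \<phi> u" for u using zU by (auto simp: \<psi>_def)
  define H where "H = (\<lambda>q u. poly (q u) (\<psi> u)) ` GP_bounded"
  have mem: "(\<lambda>u. poly (q u) (\<psi> u)) \<in> H" if "q \<in> GP_bounded" for q using that by (auto simp: H_def)
  have GH: "G \<subseteq> H" using mem[OF bounded_const(1)] by auto
  have "fun_alg H" unfolding fun_alg_def
  proof (intro conjI allI ballI)
    show "(\<lambda>_. a) \<in> H" for a using GH fun_algD(1)[OF alg] by blast
    fix f g assume "f \<in> H" "g \<in> H"
    then obtain p q where pq: "p \<in> GP_bounded" "f = (\<lambda>u. poly (p u) (\<psi> u))" "q \<in> GP_bounded" "g = (\<lambda>u. poly (q u) (\<psi> u))"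
      by (auto simp: H_def)
    show "(\<lambda>u. f u + g u) \<in> H" "(\<lambda>u. f u * g u) \<in> H"
      using mem[OF bounded_add[OF pq(1,3)]] mem[OF bounded_mult[OF pq(1,3)]] by (simp_all add: pq)
  qed
  moreover have "determines U z H" unfolding determines_def
  proof (intro ballI impI)
    fix f assume "f \<in> H" "\<forall>u\<in>U. f u = 0"
    then obtain q where q: "q \<in> GP_bounded" "f = (\<lambda>u. poly (q u) (\<psi> u))" by (auto simp: H_def)
    then have "\<forall>u\<in>U. poly (q u) (\<phi> u) = 0" using \<open>\<forall>u\<in>U. f u = 0\<close> psi by auto
    then show "f z = 0" using c[OF q(1)] q psi by simp
  qed
  ultimately have "H = G" using maxG GH by blast
  moreover have "(\<lambda>u. poly [:0,1:] (\<psi> u)) \<in> H" using mem[OF bounded_const(2)[of "[:0,1:]"]] .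
  ultimately have "\<psi> \<in> G" by simp
  then show ?thesis using psi by blast
next
  case False
  define I where "I = {q z | q. q \<in> GP_bounded \<and> (\<forall>u\<in>U. poly (q u) (\<phi> u) = 0)}"
  have noroot: "\<exists>r\<in>I. poly r c \<noteq> 0" for c 
  proof -
    obtain q where "q \<in> GP_bounded" "\<forall>u\<in>U. poly (q u) (\<phi> u) = 0" "poly (q z) c \<noteq> 0" using False by blast
    then have "q z \<in> I" unfolding I_def by blast
    then show ?thesis using \<open>poly (q z) c \<noteq> 0\<close> by blast
  qed
  have Iadd: "r + s \<in> I" if rs: "r \<in> I" "s \<in> I" for r s
  proof -
    obtain p q where "p \<in> GP_bounded" "\<forall>u\<in>U. poly (p u) (\<phi> u) = 0" "r = p z" "q \<in> GP_bounded" "\<forall>u\<in>U. poly (q u) (\<phi> u) = 0" "s = q z"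
      using rs by (auto simp: I_def)
    then show ?thesis unfolding I_def using bounded_add[of p q] by (auto intro!: exI[of _ "\<lambda>u. p u + q u"])
  qed
  have Imult: "t * r \<in> I" if r: "r \<in> I" for r t
  proof -
    obtain p where "p \<in> GP_bounded" "\<forall>u\<in>U. poly (p u) (\<phi> u) = 0" "r = p z" using r by (auto simp: I_def)
    then show ?thesis unfolding I_def using bounded_mult[OF bounded_const(2)[of t], of p]
      by (auto intro!: exI[of _ "\<lambda>u. t * p u"])
  qed
  have "\<exists>r. r \<in> I \<and> r \<noteq> 0" using noroot[of 0] by force
  then obtain r where r: "r \<in> I" "r \<noteq> 0" and min: "\<And>s. s \<in> I \<Longrightarrow> s \<noteq> 0 \<Longrightarrow> degree r \<le> degree s"
    using ex_has_least_nat[of "\<lambda>r. r \<in> I \<and> r \<noteq> 0" _ degree] by blast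
  have dvd: "r dvd s" if s: "s \<in> I" for s
  proof -
    have "s mod r = s + (- (s div r)) * r" by (simp add: minus_div_mult_eq_mod[symmetric])
    then have "s mod r \<in> I" using Iadd[OF s Imult[OF r(1)]] by metis
    then have "s mod r = 0" using min[of "s mod r"] degree_mod_less'[of r s] r(2) by fastforce
    then show ?thesis by auto
  qed
  have "degree r = 0"
  proof (rule ccontr)
    assume "degree r \<noteq> 0"
    then have "degree r \<ge> 1" by simp
    then obtain c where c: "poly r c = 0" using acl unfolding alg_closed_field_def by blast
    then have "poly s c = 0" if "s \<in> I" for s using dvd[OF that] by (auto elim!: dvdE)
    then show False using noroot[of c] by blast
  qed
  then obtain e where e: "r = [:e:]" by (metis degree_0_id)
  then have "[:inverse e:] * r = 1" using r(2) by (simp add: one_pCons)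
  then have "1 \<in> I" using Imult[OF r(1), of "[:inverse e:]"] by simp
  then show ?thesis unfolding obstruction_def I_def GP_bounded_def by (auto, metis)
qed

lemma obstruction_reduce:
  assumes w: "obstruction \<phi> (Suc m)" "obstruction \<psi> l" and le: "l \<le> Suc m" and inv: "\<And>u. u \<in> U \<Longrightarrow> \<phi> u * \<psi> u = 1"
  shows "obstruction \<phi> m"
proof -
  obtain p where p: "p \<in> GP" "p z = 1" "\<And>u. degree (p u) \<le> Suc m" "\<And>u. u \<in> U \<Longrightarrow> poly (p u) (\<phi> u) = 0"
    using w(1) by (auto simp: obstruction_def)
  obtain q where q: "q \<in> GP" "q z = 1" "\<And>u. degree (q u) \<le> l" "\<And>u. u \<in> U \<Longrightarrow> poly (q u) (\<psi> u) = 0"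
    using w(2) by (auto simp: obstruction_def)
  define r where "r u = (\<Sum>i\<le>l. monom (coeff (q u) i) (l - i))" for u
  have cr: "coeff (r u) k = (if k \<le> l then coeff (q u) (l - k) else 0)" for u k
  proof -
    have "coeff (r u) k = (\<Sum>i\<le>l. if l - i = k then coeff (q u) i else 0)"
      unfolding r_def coeff_sum coeff_monom by (rule sum.cong) auto
    also have "\<dots> = (\<Sum>i\<le>l. if i = l - k \<and> k \<le> l then coeff (q u) i else 0)" by (rule sum.cong) auto
    finally show ?thesis by (cases "k \<le> l") auto
  qed
  have rGP: "r \<in> GP" unfolding GP_def
  proof (intro CollectI allI)
    fix i
    have "(\<lambda>u. coeff (q u) (l - i)) \<in> G" using q(1) by (simp add: GP_def)
    then show "(\<lambda>u. coeff (r u) i) \<in> G" unfolding cr by (cases "i \<le> l") (auto intro: fun_algD[OF alg])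
  qed
  have rv: "poly (r u) (\<phi> u) = 0" if u: "u \<in> U" for u
  proof -
    have "poly (r u) (\<phi> u) = (\<Sum>i\<le>l. coeff (q u) i * \<phi> u ^ (l - i))" by (simp add: r_def poly_sum poly_monom)
    also have "\<dots> = (\<Sum>i\<le>l. \<phi> u ^ l * (coeff (q u) i * \<psi> u ^ i))"
    proof (rule sum.cong)
      fix i assume "i \<in> {..l}"
      then have "\<phi> u ^ l = \<phi> u ^ (l - i) * \<phi> u ^ i" by (simp flip: power_add)
      moreover have "\<phi> u ^ i * \<psi> u ^ i = 1" using inv[OF u] by (simp flip: power_mult_distrib)
      ultimately show "coeff (q u) i * \<phi> u ^ (l - i) = \<phi> u ^ l * (coeff (q u) i * \<psi> u ^ i)"
        by (metis (no_types, lifting) mult.assoc mult.commute mult.right_neutral)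
    qed simp
    also have "\<dots> = \<phi> u ^ l * poly (q u) (\<psi> u)"
    proof -
      have "(\<Sum>i\<le>l. coeff (q u) i * \<psi> u ^ i) = poly (q u) (\<psi> u)"
        unfolding poly_altdef using q(3)[of u] by (intro sum.mono_neutral_right) (auto simp: coeff_eq_0)
      then show ?thesis by (simp add: sum_distrib_left[symmetric])
    qed
    finally show ?thesis using q(4)[OF u] by simp
  qed
  define s where "s u = [:coeff (q u) 0:] * p u - [:coeff (p u) (Suc m):] * (monom 1 (Suc m - l) * r u)" for u
  have cG: "(\<lambda>u. coeff (q u) 0) \<in> G" "(\<lambda>u. coeff (p u) (Suc m)) \<in> G" using p q by (auto simp: GP_def)
  have "s \<in> GP" unfolding s_def[abs_def]
    by (intro GP_diff GP_mult GP_const GP_poly cG p rGP)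
  moreover have "s z = 1" by (simp add: s_def p q)
  moreover have "poly (s u) (\<phi> u) = 0" if "u \<in> U" for u using that by (simp add: s_def p rv)
  moreover have "degree (s u) \<le> m" for u
  proof (rule degree_le, intro allI impI)
    fix i assume i: "m < i"
    have "coeff (s u) i = coeff (q u) 0 * coeff (p u) i - coeff (p u) (Suc m) * (if i < Suc m - l then 0 else coeff (r u) (i - (Suc m - l)))"
      by (simp add: s_def coeff_monom_mult)
    also have "\<dots> = 0"
    proof (cases "i = Suc m")
      case True then show ?thesis using le by (simp add: cr)
    next
      case False
      then have "coeff (p u) i = 0" using i p(3)[of u] by (intro coeff_eq_0) simp
      moreover have "\<not> i - (Suc m - l) \<le> l" using False i le by simp
      ultimately show ?thesis by (simp add: cr)
    qed
    finally show "coeff (s u) i = 0" .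
  qed
  ultimately show ?thesis unfolding obstruction_def by blast
qed

lemma no_obstruction_0: "\<not> obstruction \<phi> 0"
proof
  assume "obstruction \<phi> 0"
  then obtain q where q: "q \<in> GP" "q z = 1" "\<And>u. degree (q u) = 0" "\<And>u. u \<in> U \<Longrightarrow> poly (q u) (\<phi> u) = 0"
    by (auto simp: obstruction_def)
  have "coeff (q u) 0 = poly (q u) (\<phi> u)" for u 
    using arg_cong[OF degree_0_id[OF q(3)[of u]], of "\<lambda>p. poly p (\<phi> u)"] by simp
  then have "\<forall>u\<in>U. coeff (q u) 0 = 0" using q(4) by simp
  moreover have "(\<lambda>u. coeff (q u) 0) \<in> G" using q(1) by (simp add: GP_def)
  ultimately have "coeff (q z) 0 = 0" using det by (auto simp: determines_def)
  then show False using q(2) by simp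
qed

lemma dichotomy:
  assumes nz: "\<And>u. u \<in> U \<Longrightarrow> \<phi> u \<noteq> 0"
  shows "(\<exists>f\<in>G. \<forall>u\<in>U. f u = \<phi> u) \<or> (\<exists>f\<in>G. \<forall>u\<in>U. f u = 1 / \<phi> u)"
proof (rule ccontr)
  assume no: "\<not> ?thesis"
  define \<psi> where "\<psi> u = 1 / \<phi> u" for u
  have inv: "\<phi> u * \<psi> u = 1" "\<psi> u * \<phi> u = 1" if "u \<in> U" for u using nz[OF that] by (auto simp: \<psi>_def)
  have ex: "\<exists>m. obstruction \<phi> m" "\<exists>l. obstruction \<psi> l"
    using extend_or_obstruction[of \<phi>] extend_or_obstruction[of \<psi>] no by (auto simp: \<psi>_def)
  define m where "m = (LEAST m. obstruction \<phi> m)"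
  define l where "l = (LEAST l. obstruction \<psi> l)"
  have m: "obstruction \<phi> m" "k < m \<Longrightarrow> \<not> obstruction \<phi> k" for k
    unfolding m_def using LeastI_ex[OF ex(1)] not_less_Least by blast+
  have l: "obstruction \<psi> l" "k < l \<Longrightarrow> \<not> obstruction \<psi> k" for k
    unfolding l_def using LeastI_ex[OF ex(2)] not_less_Least by blast+
  obtain m' where m': "m = Suc m'" using m(1) no_obstruction_0 by (cases m) auto
  obtain l' where l': "l = Suc l'" using l(1) no_obstruction_0 by (cases l) auto
  show False
  proof (cases "l \<le> m")
    case True
    then have "obstruction \<phi> m'" using obstruction_reduce[of \<phi> m' \<psi> l] m(1) l(1) m' inv by auto
    then show False using m(2)[of m'] m' by simp
  next
    case False
    then have "obstruction \<psi> l'" using obstruction_reduce[of \<psi> l' \<phi> m] m(1) l(1) l' inv by auto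
    then show False using l(2)[of l'] l' by simp
  qed
qed

lemma dominant_function:
  assumes "finite K" "K \<noteq> {}" "\<And>k u. k \<in> K \<Longrightarrow> u \<in> U \<Longrightarrow> \<phi> k u \<noteq> 0"
  shows "\<exists>i\<in>K. \<forall>k\<in>K. \<exists>f\<in>G. \<forall>u\<in>U. f u = \<phi> k u / \<phi> i u"
  using assms
proof (induction K rule: finite_ne_induct)
  case (singleton k)
  have "(\<lambda>_. 1) \<in> G" by (rule fun_algD[OF alg])
  then show ?case using singleton by (intro bexI[of _ k] ballI) (auto intro!: bexI[of _ "\<lambda>_. 1"])
next
  case (insert x K)
  have one: "(\<lambda>_. 1) \<in> G" by (rule fun_algD[OF alg])
  have "\<exists>i\<in>K. \<forall>k\<in>K. \<exists>f\<in>G. \<forall>u\<in>U. f u = \<phi> k u / \<phi> i u" by (rule insert.IH) (use insert.prems in auto)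
  then obtain i where i: "i \<in> K" "\<And>k. k \<in> K \<Longrightarrow> \<exists>f\<in>G. \<forall>u\<in>U. f u = \<phi> k u / \<phi> i u" by blast
  have nz: "\<phi> x u \<noteq> 0" "\<phi> i u \<noteq> 0" if "u \<in> U" for u using insert(5) that i(1) by auto
  have "(\<exists>f\<in>G. \<forall>u\<in>U. f u = \<phi> x u / \<phi> i u) \<or> (\<exists>f\<in>G. \<forall>u\<in>U. f u = 1 / (\<phi> x u / \<phi> i u))"
    by (rule dichotomy) (use nz in auto)
  then show ?case
  proof
    assume "\<exists>f\<in>G. \<forall>u\<in>U. f u = \<phi> x u / \<phi> i u"
    then show ?thesis using i by (intro bexI[of _ i]) auto
  next
    assume "\<exists>f\<in>G. \<forall>u\<in>U. f u = 1 / (\<phi> x u / \<phi> i u)"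
    then obtain h where h: "h \<in> G" "\<And>u. u \<in> U \<Longrightarrow> h u = \<phi> i u / \<phi> x u" by auto
    have "\<exists>f\<in>G. \<forall>u\<in>U. f u = \<phi> k u / \<phi> x u" if k: "k \<in> insert x K" for k
    proof (cases "k = x")
      case True then show ?thesis using one nz by (auto intro!: bexI[of _ "\<lambda>_. 1"])
    next
      case False
      then obtain f where f: "f \<in> G" "\<And>u. u \<in> U \<Longrightarrow> f u = \<phi> k u / \<phi> i u" using i(2) k by blast
      have "(\<lambda>u. f u * h u) \<in> G" by (rule fun_algD(3)[OF alg f(1) h(1)])
      moreover have "f u * h u = \<phi> k u / \<phi> x u" if "u \<in> U" for u using f(2)[OF that] h(2)[OF that] nz[OF that] by simp
      ultimately show ?thesis by (intro bexI[of _ "\<lambda>u. f u * h u"]) auto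
    qed
    then show ?thesis by blast
  qed
qed

lemma specialize_eq: "f \<in> G \<Longrightarrow> g \<in> G \<Longrightarrow> (\<And>u. u \<in> U \<Longrightarrow> f u = g u) \<Longrightarrow> f z = g z"
  using det fun_algD(5)[OF alg, of f g] by (auto simp: determines_def)

lemma meval_in_G: "A \<in> MP n \<Longrightarrow> (\<And>l. l < n \<Longrightarrow> q l \<in> G) \<Longrightarrow> (\<lambda>u. meval A (\<lambda>l. q l u)) \<in> G"
  by (induction rule: MP.induct) (auto intro: fun_algD[OF alg])

end

lemma MP_prod: "(\<And>a. a \<in> A \<Longrightarrow> f a \<in> MP n) \<Longrightarrow> prod f A \<in> MP n"
  by (induction A rule: infinite_finite_induct) (auto simp: MP_1 intro: MP_mult)

lemma meval_prod: "meval (prod f A) x = (\<Prod>a\<in>A. meval (f a) x)"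
  by (induction A rule: infinite_finite_induct) auto

definition zdense :: "nat \<Rightarrow> (nat \<Rightarrow> 'k::comm_ring_1) set \<Rightarrow> (nat \<Rightarrow> 'k) \<Rightarrow> bool" where
  "zdense n U z \<longleftrightarrow> (\<forall>h\<in>MP (Suc n). (\<forall>u\<in>U. meval h u = 0) \<longrightarrow> meval h z = 0)"

lemma zdense_partition:
  fixes U :: "(nat \<Rightarrow> 'k::field) set"
  assumes "zdense n U z" "finite K" "\<And>u. u \<in> U \<Longrightarrow> g u \<in> K"
  shows "\<exists>s\<in>K. zdense n {u\<in>U. g u = s} z"
proof (rule ccontr)
  assume "\<not> ?thesis"
  then have "\<forall>s\<in>K. \<exists>h\<in>MP (Suc n). (\<forall>u\<in>{u\<in>U. g u = s}. meval h u = 0) \<and> meval h z \<noteq> 0"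
    by (auto simp: zdense_def)
  then obtain h where h: "\<And>s. s \<in> K \<Longrightarrow> h s \<in> MP (Suc n)" "\<And>s u. s \<in> K \<Longrightarrow> u \<in> U \<Longrightarrow> g u = s \<Longrightarrow> meval (h s) u = 0"
    "\<And>s. s \<in> K \<Longrightarrow> meval (h s) z \<noteq> 0"
    by (metis (mono_tags, lifting) mem_Collect_eq)
  have "meval (prod h K) u = 0" if "u \<in> U" for u
    using h(2)[OF assms(3)[OF that] that refl] assms(2,3) that by (auto simp: meval_prod)
  then have "meval (prod h K) z = 0" using assms(1) MP_prod[of K h] h(1) by (auto simp: zdense_def)
  then show False using h(3) assms(2) by (auto simp: meval_prod)
qed

lemma limit_of_planes:
  fixes F :: "'k::field mpoly"
  assumes acl: "alg_closed_field TYPE('k)" and FM: "F \<in> MP (Suc n)" and dense: "zdense n U z" and zv: "vec_in n z"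
    and planes: "\<And>u. u \<in> U \<Longrightarrow> \<exists>a b. (\<exists>i\<le>n. \<exists>j\<le>n. a i * b j - a j * b i \<noteq> 0) \<and> lin_form n a u = 0 \<and> lin_form n b u = 0 \<and>
      (\<forall>x. vec_in n x \<longrightarrow> lin_form n a x = 0 \<longrightarrow> lin_form n b x = 0 \<longrightarrow> meval F x = 0)"
  shows "\<exists>a b i j. i \<le> n \<and> j \<le> n \<and> i \<noteq> j \<and> a i = 1 \<and> a j = 0 \<and> b i = 0 \<and> b j = 1 \<and> lin_form n a z = 0 \<and> lin_form n b z = 0 \<and>
      (\<forall>x. vec_in n x \<longrightarrow> lin_form n a x = 0 \<longrightarrow> lin_form n b x = 0 \<longrightarrow> meval F x = 0)"
proof -
  obtain A B where AB: "\<And>u. u \<in> U \<Longrightarrow> (\<exists>i\<le>n. \<exists>j\<le>n. A u i * B u j - A u j * B u i \<noteq> 0)"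
    "\<And>u. u \<in> U \<Longrightarrow> lin_form n (A u) u = 0" "\<And>u. u \<in> U \<Longrightarrow> lin_form n (B u) u = 0"
    "\<And>u x. u \<in> U \<Longrightarrow> vec_in n x \<Longrightarrow> lin_form n (A u) x = 0 \<Longrightarrow> lin_form n (B u) x = 0 \<Longrightarrow> meval F x = 0"
    using planes by metis
  define \<pi> where "\<pi> k u = A u (fst k) * B u (snd k) - A u (snd k) * B u (fst k)" for k u
  define pat where "pat u = {k \<in> {..n} \<times> {..n}. \<pi> k u \<noteq> 0}" for u
  have "\<exists>s\<in>Pow ({..n} \<times> {..n}). zdense n {u\<in>U. pat u = s} z"
    by (rule zdense_partition[OF dense]) (auto simp: pat_def)
  then obtain s where s: "s \<subseteq> {..n} \<times> {..n}" and sd: "zdense n {u\<in>U. pat u = s} z" by blast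
  define V where "V = {u\<in>U. pat u = s}"
  have Vd: "zdense n V z" using sd by (simp add: V_def)
  have VU: "u \<in> V \<Longrightarrow> u \<in> U" for u by (simp add: V_def)
  have Vnz: "\<pi> k u \<noteq> 0 \<longleftrightarrow> k \<in> s" if "u \<in> V" "k \<in> {..n} \<times> {..n}" for k u using that by (auto simp: V_def pat_def)
  have "V \<noteq> {}"
  proof
    assume "V = {}"
    then have "meval 1 z = 0" using Vd MP_1 unfolding zdense_def by blast
    then show False by simp
  qed
  then obtain u0 where u0: "u0 \<in> V" by blast
  obtain i0 j0 where "i0 \<le> n" "j0 \<le> n" "\<pi> (i0, j0) u0 \<noteq> 0" using AB(1)[OF VU[OF u0]] by (auto simp: \<pi>_def)
  then have sne: "s \<noteq> {}" using Vnz[OF u0, of "(i0, j0)"] by auto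
  have sfin: "finite s" using s finite_subset by blast
  define lift where "lift h = (\<lambda>w. case w of None \<Rightarrow> meval h z | Some u \<Rightarrow> meval h u)" for h :: "'k mpoly"
  define G0 where "G0 = lift ` MP (Suc n)"
  have alg0: "fun_alg G0" unfolding fun_alg_def
  proof (intro conjI allI ballI)
    fix c
    have "(\<lambda>_. c) = lift (MC c)" by (auto simp: lift_def fun_eq_iff split: option.splits)
    then show "(\<lambda>_. c) \<in> G0" unfolding G0_def using MP_C by blast
  next
    fix f g assume "f \<in> G0" "g \<in> G0"
    then obtain a b where ab: "a \<in> MP (Suc n)" "b \<in> MP (Suc n)" "f = lift a" "g = lift b" by (auto simp: G0_def)
    have "(\<lambda>u. f u + g u) = lift (a + b)" "(\<lambda>u. f u * g u) = lift (a * b)"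
      using ab by (auto simp: lift_def fun_eq_iff split: option.splits)
    then show "(\<lambda>u. f u + g u) \<in> G0" "(\<lambda>u. f u * g u) \<in> G0" unfolding G0_def using ab MP_add MP_mult by blast+
  qed
  have det0: "determines (Some ` V) None G0"
    using Vd unfolding determines_def G0_def zdense_def by (auto simp: lift_def)
  obtain G where G': "G0 \<subseteq> G \<and> fun_alg G \<and> determines (Some ` V) None G \<and>
      (\<forall>H. fun_alg H \<longrightarrow> determines (Some ` V) None H \<longrightarrow> G \<subseteq> H \<longrightarrow> H = G)"
    using maximal_fun_alg[OF alg0 det0] by (elim exE)
  then have G: "G0 \<subseteq> G" "fun_alg G" by auto
  interpret place "Some ` V" None G by unfold_locales (use acl G' in auto)
  have "\<exists>k\<in>s. \<forall>k'\<in>s. \<exists>f\<in>G. \<forall>w\<in>Some ` V. f w = \<pi> k' (the w) / \<pi> k (the w)"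
  proof (rule dominant_function[OF sfin sne])
    fix k w assume "k \<in> s" "w \<in> Some ` V"
    then show "\<pi> k (the w) \<noteq> 0" using Vnz[of "the w" k] s by auto
  qed
  then obtain k where k: "k \<in> s" "\<And>k'. k' \<in> s \<Longrightarrow> \<exists>f\<in>G. \<forall>w\<in>Some ` V. f w = \<pi> k' (the w) / \<pi> k (the w)" by blast
  obtain i j where ij: "k = (i, j)" by (cases k)
  have ijn: "i \<le> n" "j \<le> n" using k(1) s ij by auto
  have knz: "\<pi> (i, j) u \<noteq> 0" if "u \<in> V" for u using Vnz[OF that, of k] k(1) s ij by auto
  have ne: "i \<noteq> j" using knz[OF u0] by (auto simp: \<pi>_def)
  have ratio: "\<exists>f\<in>G. \<forall>u\<in>V. f (Some u) = \<pi> k' u / \<pi> (i, j) u" if "k' \<in> {..n} \<times> {..n}" for k'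
  proof (cases "k' \<in> s")
    case True then show ?thesis using k(2)[OF True] ij by auto
  next
    case False
    then have "\<forall>u\<in>V. \<pi> k' u = 0" using Vnz that by blast
    then show ?thesis using fun_algD(1)[OF G(2), of 0] by (intro bexI[of _ "\<lambda>_. 0"]) auto
  qed
  have "\<forall>l. \<exists>f. l \<le> n \<longrightarrow> f \<in> G \<and> (\<forall>u\<in>V. f (Some u) = \<pi> (l, j) u / \<pi> (i, j) u)" using ratio ijn by fastforce
  then obtain fa where fa: "\<And>l. l \<le> n \<Longrightarrow> fa l \<in> G" "\<And>l u. l \<le> n \<Longrightarrow> u \<in> V \<Longrightarrow> fa l (Some u) = \<pi> (l, j) u / \<pi> (i, j) u" by metis
  have "\<forall>l. \<exists>f. l \<le> n \<longrightarrow> f \<in> G \<and> (\<forall>u\<in>V. f (Some u) = \<pi> (i, l) u / \<pi> (i, j) u)" using ratio ijn by fastforce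
  then obtain fb where fb: "\<And>l. l \<le> n \<Longrightarrow> fb l \<in> G" "\<And>l u. l \<le> n \<Longrightarrow> u \<in> V \<Longrightarrow> fb l (Some u) = \<pi> (i, l) u / \<pi> (i, j) u" by metis
  have cG: "(\<lambda>_. c) \<in> G" for c by (rule fun_algD[OF G(2)])
  have spec: "f None = c" if "f \<in> G" "\<And>u. u \<in> V \<Longrightarrow> f (Some u) = c" for f c
    using specialize_eq[OF that(1) cG[of c]] that(2) by auto
  have norm: "fa i None = 1" "fa j None = 0" "fb i None = 0" "fb j None = 1"
    by (rule spec; use fa fb ijn knz in \<open>auto simp: \<pi>_def\<close>)+
  have normV: "fa i (Some u) = 1" "fa j (Some u) = 0" "fb i (Some u) = 0" "fb j (Some u) = 1" if "u \<in> V" for u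
    using that fa fb ijn knz by (auto simp: \<pi>_def)
  have la: "\<pi> (i, j) u * lin_form n (\<lambda>l. fa l (Some u)) x = B u j * lin_form n (A u) x - A u j * lin_form n (B u) x"
    and lb: "\<pi> (i, j) u * lin_form n (\<lambda>l. fb l (Some u)) x = A u i * lin_form n (B u) x - B u i * lin_form n (A u) x"
    if "u \<in> V" for u x
  proof -
    have "\<pi> (i, j) u * (fa l (Some u) * x l) = B u j * (A u l * x l) - A u j * (B u l * x l)" if "l \<le> n" for l
    proof -
      have "\<pi> (i, j) u * fa l (Some u) = \<pi> (l, j) u" using fa(2)[OF that \<open>u \<in> V\<close>] knz[OF \<open>u \<in> V\<close>] by simp
      then show ?thesis by (simp add: mult.assoc[symmetric]) (simp add: \<pi>_def algebra_simps)
    qed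
    then show "\<pi> (i, j) u * lin_form n (\<lambda>l. fa l (Some u)) x = B u j * lin_form n (A u) x - A u j * lin_form n (B u) x"
      by (simp add: lin_form_def sum_distrib_left sum_subtractf[symmetric])
    have "\<pi> (i, j) u * (fb l (Some u) * x l) = A u i * (B u l * x l) - B u i * (A u l * x l)" if "l \<le> n" for l
    proof -
      have "\<pi> (i, j) u * fb l (Some u) = \<pi> (i, l) u" using fb(2)[OF that \<open>u \<in> V\<close>] knz[OF \<open>u \<in> V\<close>] by simp
      then show ?thesis by (simp add: mult.assoc[symmetric]) (simp add: \<pi>_def algebra_simps)
    qed
    then show "\<pi> (i, j) u * lin_form n (\<lambda>l. fb l (Some u)) x = A u i * lin_form n (B u) x - B u i * lin_form n (A u) x"
      by (simp add: lin_form_def sum_distrib_left sum_subtractf[symmetric])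
  qed
  have ker: "lin_form n (A u) x = 0 \<and> lin_form n (B u) x = 0"
    if u: "u \<in> V" and x: "lin_form n (\<lambda>l. fa l (Some u)) x = 0" "lin_form n (\<lambda>l. fb l (Some u)) x = 0" for u x
  proof -
    have 1: "B u j * lin_form n (A u) x = A u j * lin_form n (B u) x" "A u i * lin_form n (B u) x = B u i * lin_form n (A u) x"
      using la[OF u, of x] lb[OF u, of x] x by auto
    have "\<pi> (i, j) u * lin_form n (A u) x = A u i * (B u j * lin_form n (A u) x) - A u j * (B u i * lin_form n (A u) x)"
      by (simp add: \<pi>_def algebra_simps)
    also have "\<dots> = 0" unfolding 1(1) 1(2)[symmetric] by (simp add: mult.left_commute)
    finally have a: "lin_form n (A u) x = 0" using knz[OF u] by simp
    have "\<pi> (i, j) u * lin_form n (B u) x = B u j * (A u i * lin_form n (B u) x) - B u i * (A u j * lin_form n (B u) x)"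
      by (simp add: \<pi>_def algebra_simps)
    also have "\<dots> = 0" unfolding 1(2) 1(1)[symmetric] by (simp add: mult.left_commute)
    finally show ?thesis using a knz[OF u] by simp
  qed
  have coordG: "lift (MX l) \<in> G" if "l \<le> n" for l
  proof -
    have "(MX l :: 'k mpoly) \<in> MP (Suc n)" using that by (intro MP_X) simp
    then show ?thesis using G(1) by (auto simp: G0_def)
  qed
  have point: "lin_form n (\<lambda>l. f l None) z = 0"
    if f: "\<And>l. l \<le> n \<Longrightarrow> f l \<in> G" and van: "\<And>u. u \<in> V \<Longrightarrow> lin_form n (\<lambda>l. f l (Some u)) u = 0" for f
  proof -
    have "(\<lambda>w. \<Sum>l\<le>n. f l w * lift (MX l) w) \<in> G" by (intro fun_alg_sum[OF G(2)] fun_algD(3)[OF G(2)] f coordG) auto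
    from spec[OF this, of 0] van show ?thesis by (simp add: lin_form_def lift_def)
  qed
  have za: "lin_form n (\<lambda>l. fa l None) z = 0"
  proof (rule point[OF fa(1)])
    fix u assume u: "u \<in> V"
    show "lin_form n (\<lambda>l. fa l (Some u)) u = 0" using la[OF u, of u] AB(2,3)[OF VU[OF u]] knz[OF u] by simp
  qed
  have zb: "lin_form n (\<lambda>l. fb l None) z = 0"
  proof (rule point[OF fb(1)])
    fix u assume u: "u \<in> V"
    show "lin_form n (\<lambda>l. fb l (Some u)) u = 0" using lb[OF u, of u] AB(2,3)[OF VU[OF u]] knz[OF u] by simp
  qed
  have plane: "meval F x = 0"
    if x: "vec_in n x" "lin_form n (\<lambda>l. fa l None) x = 0" "lin_form n (\<lambda>l. fb l None) x = 0" for x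
  proof -
    define R where "R = {..n} - {i, j}"
    define q where "q l w = (if l = i then - (\<Sum>m\<in>R. fa m w * x m) else if l = j then - (\<Sum>m\<in>R. fb m w * x m) else x l)" for l w
    have qG: "q l \<in> G" for l
    proof -
      have "(\<lambda>w. \<Sum>m\<in>R. fa m w * x m) \<in> G" "(\<lambda>w. \<Sum>m\<in>R. fb m w * x m) \<in> G"
        by (intro fun_alg_sum[OF G(2)] fun_algD(3)[OF G(2)] fa fb cG; simp add: R_def)+
      then have "(\<lambda>w. - (\<Sum>m\<in>R. fa m w * x m)) \<in> G" "(\<lambda>w. - (\<Sum>m\<in>R. fb m w * x m)) \<in> G"
        by (auto intro: fun_algD(4)[OF G(2)])
      then show ?thesis unfolding q_def[abs_def] using cG[of "x l"] by (cases "l = i"; cases "l = j") simp_all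
    qed
    have split: "lin_form n g y = g i * y i + g j * y j + (\<Sum>m\<in>R. g m * y m)" for g y :: "nat \<Rightarrow> 'k"
    proof -
      have "{..n} = insert i (insert j R)" using ijn by (auto simp: R_def)
      moreover have "finite R" "j \<notin> R" "i \<notin> insert j R" using ne by (auto simp: R_def)
      ultimately show ?thesis by (simp only: lin_form_def sum.insert finite_insert add.assoc not_False_eq_True)
    qed
    have qR: "(\<Sum>m\<in>R. g m * q m w) = (\<Sum>m\<in>R. g m * x m)" for g w by (rule sum.cong) (auto simp: q_def R_def)
    have qV: "meval F (\<lambda>l. q l (Some u)) = 0" if u: "u \<in> V" for u
    proof -
      have v: "vec_in n (\<lambda>l. q l (Some u))" using x(1) ijn by (auto simp: vec_in_def q_def)
      have "lin_form n (\<lambda>l. fa l (Some u)) (\<lambda>l. q l (Some u)) = 0" "lin_form n (\<lambda>l. fb l (Some u)) (\<lambda>l. q l (Some u)) = 0"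
        unfolding split qR normV[OF u] using ne by (simp_all add: q_def)
      then show ?thesis using ker[OF u] AB(4)[OF VU[OF u] v] by blast
    qed
    have "(\<lambda>w. meval F (\<lambda>l. q l w)) \<in> G" by (rule meval_in_G[OF FM qG])
    then have "meval F (\<lambda>l. q l None) = 0" using spec[of "\<lambda>w. meval F (\<lambda>l. q l w)" 0] qV by simp
    moreover have "(\<lambda>l. q l None) = x"
    proof
      fix l
      have "x i + (\<Sum>m\<in>R. fa m None * x m) = 0" "x j + (\<Sum>m\<in>R. fb m None * x m) = 0"
        using x(2,3) unfolding split norm by simp_all
      then show "q l None = x l" by (simp add: q_def eq_neg_iff_add_eq_0) (metis eq_neg_iff_add_eq_0)
    qed
    ultimately show ?thesis by simp
  qed
  show ?thesis
    by (intro exI[of _ "\<lambda>l. fa l None"] exI[of _ "\<lambda>l. fb l None"] exI[of _ i] exI[of _ j])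
       (use ijn ne norm za zb plane in auto)
qed

section \<open>Hypersurfaces covered by linear divisors\<close>

lemma homog_form_meval:
  fixes F :: "'k::field mpoly"
  assumes "homog_form n d F" shows "meval F (c \<odot> x) = c ^ d * meval F x"
proof -
  have "(\<Prod>i\<in>Poly_Mapping.keys m. (c \<odot> x) i ^ Poly_Mapping.lookup m i)
      = c ^ d * (\<Prod>i\<in>Poly_Mapping.keys m. x i ^ Poly_Mapping.lookup m i)" if m: "m \<in> Poly_Mapping.keys F" for m
  proof -
    have "c ^ d = (\<Prod>i\<in>Poly_Mapping.keys m. c ^ Poly_Mapping.lookup m i)"
      using assms m by (auto simp: homog_form_def mon_deg_def power_sum)
    then show ?thesis by (simp only: vapp power_mult_distrib prod.distrib)
  qed
  then show ?thesis unfolding meval_def by (simp add: sum_distrib_left mult.left_commute)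
qed

lemma homog_form_MP: "homog_form n d F \<Longrightarrow> F \<in> MP (Suc n)" for F :: "'k::field mpoly"
  by (rule MP_I) (auto simp: homog_form_def atLeast0AtMost lessThan_Suc_atMost)

context hform begin

lemma smooth_point_exists:
  assumes ac: "alg_closed_field TYPE('k)" and irr: "irreducible F"
  shows "\<exists>x j. vec_in n x \<and> meval F x = 0 \<and> j \<le> n \<and> gr x j \<noteq> 0"
proof (rule ccontr)
  assume no: "\<not> ?thesis"
  have z: "pd j F = 0" if j: "j \<le> n" for j
  proof (rule ccontr)
    assume nz: "pd j F \<noteq> 0"
    have "F dvd pd j F"
    proof (rule vanishing_imp_dvd[OF ac irr])
      fix x assume "meval F x = 0"
      then have "meval F (trunc x) = 0" using trunc(2)[OF FM] by simp
      then have "gr (trunc x) j = 0" using no trunc(1) j by blast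
      then show "meval (pd j F) x = 0" by (simp add: gr_trunc) (simp add: gr_def)
    qed
    then have "d \<le> d - 1"
    proof (rule dvd_homogeneous_degree[OF _ nz])
      fix c x
      have "D1 (c \<odot> x) (unitv j) = c ^ (d - 1) * D1 x (unitv j)" by (rule D1_hom)
      then show "meval (pd j F) (c \<odot> x) = c ^ (d - 1) * meval (pd j F) x"
        using j by (simp add: D1_def lin_form_unitv gr_def)
    qed
    then show False using d2 by simp
  qed
  have "meval F x = 0" for x
  proof -
    have "D1 x x = 0" by (simp add: D1_def lin_form_def gr_def z)
    then show ?thesis using euler[of x] d2 by simp
  qed
  then have "F = 0" using meval_nonzero by blast
  then show False using irr by (simp add: irreducible_def)
qed

end

lemma (in covered_form) no_otriple_at_smooth_point:
  assumes irr: "irreducible F" and nd: "n \<ge> 5 \<or> d \<ge> 3"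
    and p: "vec_in n p" "meval F p = 0" and j: "j \<le> n" "gr p j \<noteq> 0"
  shows "\<not> otriple p u v w"
proof
  assume o: "otriple p u v w"
  show False
  proof (cases "n \<ge> 5")
    case True then show False using no_otriple[OF True p j] o by blast
  next
    case False
    have "gram p u v w \<noteq> 0" using o by (simp add: gram_def otriple_def)
    moreover have "tangent p u" "tangent p v" "tangent p w" using o by (auto simp: otriple_def)
    ultimately have "nondeg p" using p j unfolding nondeg_def by blast
    then show False using nondeg_threefold_degree[OF irr, of p] False n4 nd by simp
  qed
qed

lemma (in covered_form) covered:
  assumes irr: "irreducible F" and nd: "n \<ge> 5 \<or> d \<ge> 3"
  shows "hypersurface_covered n F"
proof -
  obtain x0 v0 i where x0: "vec_in n x0" "meval F x0 = 0" "i \<le> n" "gr x0 i \<noteq> 0" "tangent x0 v0" "D2 x0 v0 v0 \<noteq> 0"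
    using smooth_point_exists[OF ac irr] not_flat[OF ac irr] by blast
  have v0: "vec_in n v0" using x0(5) by (simp add: tangent_def)
  define B where "B = pd i F * formM i v0 v0"
  have B: "meval B x = gr x i * D2 x (tangent_field i v0 x) (tangent_field i v0 x)" for x
    by (simp add: B_def meval_formM gr_def)
  have "tangent_field i v0 x0 = gr x0 i \<odot> v0" using x0(5) by (simp add: tangent_field_def tangent_def fun_eq_iff)
  then have B0: "meval B x0 \<noteq> 0" using x0 by (simp add: B)
  define U where "U = {u. vec_in n u \<and> meval F u = 0 \<and> meval B u \<noteq> 0}"
  have planes: "\<exists>a b. (\<exists>i\<le>n. \<exists>j\<le>n. a i * b j - a j * b i \<noteq> 0) \<and> lin_form n a u = 0 \<and> lin_form n b u = 0 \<and>
      (\<forall>x. vec_in n x \<longrightarrow> lin_form n a x = 0 \<longrightarrow> lin_form n b x = 0 \<longrightarrow> meval F x = 0)" if u: "u \<in> U" for u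
  proof -
    have uv: "vec_in n u" "meval F u = 0" "gr u i \<noteq> 0" "D2 u (tangent_field i v0 u) (tangent_field i v0 u) \<noteq> 0"
      using u by (auto simp: U_def B)
    have nt: "\<not> (\<exists>a b c. otriple u a b c)" using no_otriple_at_smooth_point[OF irr nd uv(1,2) x0(3) uv(3)] by blast
    obtain \<alpha> t where a: "tangent u t" "lin_form n \<alpha> t \<noteq> 0" "lin_form n \<alpha> u = 0"
      "\<And>x. tangent u x \<Longrightarrow> lin_form n \<alpha> x = 0 \<Longrightarrow> meval F x = 0"
      using plane_through_point[OF uv(1,2) x0(3) uv(3) nt tangent_field_tangent[OF x0(3) v0] uv(4)] by blast
    have "\<exists>k\<le>n. \<exists>j\<le>n. gr u k * \<alpha> j - gr u j * \<alpha> k \<noteq> 0"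
    proof (rule ccontr)
      assume "\<not> ?thesis"
      then have z: "gr u i * \<alpha> j = gr u j * \<alpha> i" if "j \<le> n" for j using x0(3) that by auto
      have "gr u i * lin_form n \<alpha> t = (\<Sum>j\<le>n. (gr u i * \<alpha> j) * t j)" by (simp add: lin_form_def sum_distrib_left mult.assoc)
      also have "\<dots> = (\<Sum>j\<le>n. (gr u j * \<alpha> i) * t j)" using z by (intro sum.cong) auto
      also have "\<dots> = \<alpha> i * D1 u t" by (simp add: D1_def lin_form_def sum_distrib_left ac_simps)
      also have "\<dots> = 0" using a(1) by (simp add: tangent_def)
      finally show False using a(2) uv(3) by simp
    qed
    moreover have "lin_form n (gr u) u = 0" using euler[of u] uv(2) by (simp add: D1_def)
    ultimately show ?thesis using a(3,4) by (intro exI[of _ "gr u"] exI[of _ \<alpha>]) (auto simp: tangent_def D1_def)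
  qed
  show ?thesis unfolding hypersurface_covered_def
  proof (intro allI impI)
    fix z assume z: "proj_point n z \<and> meval F z = 0"
    then have zv: "vec_in n z" by (simp add: proj_point_def)
    have dense: "zdense n U z" unfolding zdense_def
    proof (intro ballI impI)
      fix h assume h: "h \<in> MP (Suc n)" "\<forall>u\<in>U. meval h u = 0"
      have "F dvd h * B"
      proof (rule vanishing_imp_dvd[OF ac irr])
        fix x assume x: "meval F x = 0"
        show "meval (h * B) x = 0"
        proof (cases "meval B x = 0")
          case False
          have "B \<in> MP (Suc n)" unfolding B_def formM_def fieldM_def
            by (intro MP_mult MP_sum MP_diff pd_MP FM MP_C) (auto intro!: MP_0 MP_sum MP_mult pd_MP FM MP_C)
          then have "trunc x \<in> U" using x False trunc(1)[of x] FM by (simp add: U_def trunc(2))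
          then have "meval h (trunc x) = 0" using h(2) by blast
          then show ?thesis using trunc(2)[OF h(1)] by simp
        qed simp
      qed
      moreover have "\<not> F dvd B" using B0 x0(2) by (auto elim!: dvdE)
      ultimately have "F dvd h" using irreducible_prime[OF irr] by (auto simp: prime_elem_dvd_mult_iff)
      then show "meval h z = 0" using z by (auto elim!: dvdE)
    qed
    obtain a b k j where ab: "k \<le> n" "j \<le> n" "k \<noteq> j" "a k = 1" "a j = 0" "b k = 0" "b j = 1"
      "lin_form n a z = 0" "lin_form n b z = 0"
      "\<And>x. vec_in n x \<Longrightarrow> lin_form n a x = 0 \<Longrightarrow> lin_form n b x = 0 \<Longrightarrow> meval F x = 0"
      using limit_of_planes[OF ac FM dense zv planes] by blast
    have n2: "n \<ge> 2" using n4 by simp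
    obtain v where "lin_frame n (n - 2) v"
      "\<And>q. in_span (n - 2) v q \<longleftrightarrow> vec_in n q \<and> lin_form n a q = 0 \<and> lin_form n b q = 0"
      using frame_of_two_forms[OF n2 ab(1-7)] by blast
    then show "\<exists>v. lin_frame n (n - 2) v \<and> in_span (n - 2) v z \<and> (\<forall>q. in_span (n - 2) v q \<longrightarrow> meval F q = 0)"
      using ab zv by blast
  qed
qed

theorem theorem7p5:
  fixes F :: "'k::field_char_0 mpoly" and n d :: nat
  assumes "alg_closed_field TYPE('k)"
    and "homog_form n d F"
    and "irreducible F"
    and "d \<ge> 2"
    and "n \<ge> 5 \<or> (n = 4 \<and> d \<ge> 3)"
    and "\<forall>a. hyperplane_coeffs n a \<longrightarrow> section_covered n a F"
  shows "hypersurface_covered n F"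
proof -
  interpret covered_form F n d
    using assms homog_form_MP[OF assms(2)] homog_form_meval[OF assms(2)] by unfold_locales auto
  show ?thesis by (rule covered[OF assms(3)]) (use assms(5) in auto)
qed

end
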